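(* For every real $\lambda > 5.3506$, the hard-core model on $\mathbb{Z}^2$ with activity $\lambda$ admits multiple Gibbs measures; that is, there exist at least two distinct Gibbs measures for the hard-core model with parameter $\lambda$ on $\mathbb{Z}^2$.
   Context: $\mathbb{Z}^2$ denotes the nearest-neighbour graph with vertex set $\mathbb{Z}\times\mathbb{Z}$, in which two vertices are adjacent if they differ in exactly one coordinate, and differ by $\pm1$ in that coordinate. For a graph $G=(V,E)$, $\mathcal{I}(G)$ is the set of independent sets of $G$ (sets of pairwise non-adjacent vertices), a subset of $\{0,1\}^V$ equipped with the cylinder $\sigma$-algebra. Let $G=(V,E)$ be infinite and locally finite and $\lambda>0$. A probability measure $\mu$ on $\mathcal{I}(G)$ is a Gibbs measure for the hard-core model with parameter (activity) $\lambda$ on $G$ if for every finite $\Lambda\subset V$, every $J\in\mathcal{I}(G)$ and $\mu$-almost every $I\in\mathcal{I}(G)$, writing $\bar\Lambda=V\setminus\Lambda$, the conditional probability of $J$ given that the configuration off $\Lambda$ is $I\cap\bar\Lambda$ satisfies $$\mu(J\mid I\cap\bar\Lambda)=\begin{cases}\dfrac{\lambda^{|J\cap\Lambda|}}{Z^I_{\Lambda,\lambda}} & \text{if } I\cap\bar\Lambda=J\cap\bar\Lambda,\\[2mm] 0 & \text{otherwise,}\end{cases}\qquad Z^I_{\Lambda,\lambda}=\sum_{K\in\mathcal{I}(G):\,K\cap\bar\Lambda=I\cap\bar\Lambda}\lambda^{|K\cap\Lambda|}.$$ *)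

theory Defs
  imports "HOL-Probability.Probability"
begin

text \<open>A graph with vertex set the whole type \<open>'v\<close> is given by its adjacency relation.\<close>

definition indep_sets_of :: "('v \<Rightarrow> 'v \<Rightarrow> bool) \<Rightarrow> 'v set set" where
  "indep_sets_of adj = {I. \<forall>u\<in>I. \<forall>v\<in>I. \<not> adj u v}"

definition indep_algebra :: "('v \<Rightarrow> 'v \<Rightarrow> bool) \<Rightarrow> 'v set measure" where
  "indep_algebra adj =
     vimage_algebra (indep_sets_of adj) (\<lambda>I v. v \<in> I)
       (Pi\<^sub>M UNIV (\<lambda>_. count_space (UNIV :: bool set)))"

text \<open>The sub-\<open>\<sigma>\<close>-algebra of events that depend only on the configuration off \<open>\<Lambda>\<close>.\<close>

definition outside_algebra :: "('v \<Rightarrow> 'v \<Rightarrow> bool) \<Rightarrow> 'v set \<Rightarrow> 'v set measure" where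
  "outside_algebra adj \<Lambda> =
     vimage_algebra (indep_sets_of adj) (\<lambda>I. I - \<Lambda>) (indep_algebra adj)"

definition regular_cond_prob :: "'a measure \<Rightarrow> 'a measure \<Rightarrow> ('a \<Rightarrow> 'a measure) \<Rightarrow> bool" where
  "regular_cond_prob M F \<kappa> \<longleftrightarrow>
     \<kappa> \<in> measurable F (prob_algebra M) \<and>
     (\<forall>A\<in>sets M. AE x in M. real_cond_exp M F (indicator A) x = measure (\<kappa> x) A)"

definition hc_partition :: "('v \<Rightarrow> 'v \<Rightarrow> bool) \<Rightarrow> real \<Rightarrow> 'v set \<Rightarrow> 'v set \<Rightarrow> real" where
  "hc_partition adj lam \<Lambda> I =
     (\<Sum>K | K \<in> indep_sets_of adj \<and> K - \<Lambda> = I - \<Lambda>. lam ^ card (K \<inter> \<Lambda>))"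

text \<open>
  \<open>\<mu>(\<cdot> | I - \<Lambda>)\<close> is read as a regular conditional distribution, and the prescribed formula
  is required, for almost every \<open>I\<close>, simultaneously for all \<open>J\<close>. With the quantifier over \<open>J\<close>
  outside, the condition would be void whenever all events \<open>{I. I - \<Lambda> = J - \<Lambda>}\<close> are null.
\<close>

definition hard_core_gibbs :: "('v \<Rightarrow> 'v \<Rightarrow> bool) \<Rightarrow> real \<Rightarrow> 'v set measure \<Rightarrow> bool" where
  "hard_core_gibbs adj lam \<mu> \<longleftrightarrow>
     prob_space \<mu> \<and> sets \<mu> = sets (indep_algebra adj) \<and>
     (\<forall>\<Lambda>. finite \<Lambda> \<longrightarrow>
        (\<exists>\<kappa>. regular_cond_prob \<mu> (outside_algebra adj \<Lambda>) \<kappa> \<and>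
             (AE I in \<mu>. \<forall>J\<in>indep_sets_of adj.
                measure (\<kappa> I) {J} =
                  (if I - \<Lambda> = J - \<Lambda>
                   then lam ^ card (J \<inter> \<Lambda>) / hc_partition adj lam \<Lambda> I else 0))))"

definition z2_adj :: "int \<times> int \<Rightarrow> int \<times> int \<Rightarrow> bool" where
  "z2_adj u v \<longleftrightarrow>
     (fst u = fst v \<and> \<bar>snd u - snd v\<bar> = 1) \<or> (snd u = snd v \<and> \<bar>fst u - fst v\<bar> = 1)"

lemma subalgebra_outside: "subalgebra (indep_algebra adj) (outside_algebra adj \<Lambda>)"
proof -
  let ?P = "Pi\<^sub>M UNIV (\<lambda>_. count_space (UNIV :: bool set))"
  have coord: "(\<lambda>I v. v \<in> I) \<in> measurable (indep_algebra adj) ?P"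
    unfolding indep_algebra_def by (rule measurable_vimage_algebra1) (auto simp: space_PiM)
  have "(\<lambda>I v. v \<in> I - \<Lambda>) \<in> measurable (indep_algebra adj) ?P"
  proof (rule measurable_PiM_single')
    fix v
    show "(\<lambda>I. v \<in> I - \<Lambda>) \<in> measurable (indep_algebra adj) (count_space UNIV)"
      using measurable_compose[OF coord measurable_component_singleton[of v UNIV]]
      by (cases "v \<in> \<Lambda>") auto
  qed auto
  then have "(\<lambda>I. I - \<Lambda>) \<in> measurable (indep_algebra adj) (indep_algebra adj)"
    by (subst (2) indep_algebra_def, intro measurable_vimage_algebra2)
       (auto simp: indep_algebra_def indep_sets_of_def)
  then show ?thesis
    by (auto simp: subalgebra_def outside_algebra_def sets_vimage_algebra2
        indep_algebra_def indep_sets_of_def measurable_def)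
qed

lemma finite_hc_fibre:
  assumes "finite \<Lambda>"
  shows "finite {K. K \<in> indep_sets_of adj \<and> K - \<Lambda> = I - \<Lambda>}"
proof (rule finite_subset)
  show "{K. K \<in> indep_sets_of adj \<and> K - \<Lambda> = I - \<Lambda>} \<subseteq> (\<lambda>S. S \<union> (I - \<Lambda>)) ` Pow \<Lambda>"
  proof
    fix K assume "K \<in> {K. K \<in> indep_sets_of adj \<and> K - \<Lambda> = I - \<Lambda>}"
    then have "K = (K \<inter> \<Lambda>) \<union> (I - \<Lambda>)" by blast
    then show "K \<in> (\<lambda>S. S \<union> (I - \<Lambda>)) ` Pow \<Lambda>" by blast
  qed
qed (use assms in simp)

end

theory Submission
  imports Defs
begin

text \<open>
At high activity the hard-core gas on the chequerboard prefers one of the two parity classes of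
sites, and the boundary condition decides which one. Two Gibbs measures are obtained as limits of
finite-volume measures on growing squares: outside the square, one has all even sites occupied and
the other all odd sites. A Peierls argument tells them apart.

Fix the parity \<open>i\<close> of the boundary condition. The \<open>region\<close> of \<open>i\<close> consists of the occupied sites of
parity \<open>i\<close> and of their neighbours; let \<open>R\<close> be the part of it that is connected to the outside of the
square. A \<^emph>\<open>hole\<close> is a component of the complement of \<open>R\<close>. A bond that leaves a hole joins a site of
parity \<open>i\<close> inside to a site of the other parity outside, and both are vacant.

\<^item> \<^bold>\<open>Energy\<close> (\<open>peierls\<close>). Translating the particles in a hole by one unit keeps the
  configuration independent and frees one inner boundary site for each bond of one of the four
  directions, that is, for a quarter of the \<open>l\<close> boundary bonds. These sites can be occupied at will,
  so that the hole has probability at most \<open>(1 + lam)\<close> to the power \<open>- l / 4\<close>.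

\<^item> \<^bold>\<open>Entropy\<close> (\<open>card_holes_through_edge\<close>, \<open>continuations_bound\<close>). Dually the boundary is one closed
  curve that turns left or right at each step and never meets itself. It is determined by one bond
  and its word of turns. A finite automaton that detects short self-intersections bounds the number
  of words of length \<open>n\<close> by a constant times \<open>1.58746 ^ n\<close>.

Since \<open>1.58746 ^ 4 < 6.3506 < 1 + lam\<close>, the expected number of holes with at least \<open>M\<close> boundary bonds
that meet a fixed segment of length \<open>M\<close> tends to 0. So only long contours have to be counted, for
which the growth rate alone matters. If there is no such hole, then the region of the boundary
parity connects the segment to distance of order \<open>M\<close> (\<open>crossing_if_no_long_hole\<close>), while the region
of the other parity does not, because it is disjoint from \<open>R\<close> and hence trapped in holes
(\<open>no_crossing_if_no_long_hole\<close>). The event that the even region crosses depends on finitely many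
sites; its probability is at least \<open>2 / 3\<close> in one limit and at most \<open>1 / 3\<close> in the other.

That limits exist and are Gibbs measures (\<open>gibbs_limit\<close>) holds on every countable, locally finite
graph: probabilities of local events converge along a subsequence, Kolmogorov's theorem
turns the limits into a measure, and the Gibbs property survives because the
finite-volume conditional probabilities of local events are themselves local functions.
\<close>

section \<open>Limits of measures on independent sets\<close>

text \<open>
The indicators of the increasing events \<open>G \<subseteq> K\<close> span all functions that depend on finitely many
sites. Convergence statements, being linear, therefore need to be checked on these indicators only.
\<close>

lemma local_function_induct:
  fixes \<phi> :: "'v set \<Rightarrow> real"
  assumes "finite \<Delta>"
    and base: "\<And>G. finite G \<Longrightarrow> P (\<lambda>K. of_bool (G \<subseteq> K))"
    and scale: "\<And>c f. P f \<Longrightarrow> P (\<lambda>K. c * f K)"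
    and add: "\<And>f g. P f \<Longrightarrow> P g \<Longrightarrow> P (\<lambda>K. f K + g K)"
  shows "P (\<lambda>K. \<phi> (K \<inter> \<Delta>))"
proof -
  have "P (\<lambda>K. \<phi> (K \<inter> \<Delta>) * of_bool (G \<subseteq> K))" if "finite G" for G
    using assms(1) that
  proof (induction \<Delta> arbitrary: \<phi> G rule: finite_induct)
    case empty
    then show ?case using scale[OF base[of G], of "\<phi> {}"] by simp
  next
    case (insert v \<Delta>)
    let ?\<psi> = "\<lambda>S. \<phi> (insert v S)"
    have "P (\<lambda>K. (\<phi> (K \<inter> \<Delta>) * of_bool (G \<subseteq> K) + (- 1) * (\<phi> (K \<inter> \<Delta>) * of_bool (insert v G \<subseteq> K)))
        + ?\<psi> (K \<inter> \<Delta>) * of_bool (insert v G \<subseteq> K))"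
      using insert.IH[of G \<phi>] insert.IH[of "insert v G" \<phi>] insert.IH[of "insert v G" ?\<psi>] insert.prems
      by (intro add scale) auto
    moreover have "(\<phi> (K \<inter> \<Delta>) * of_bool (G \<subseteq> K) + (- 1) * (\<phi> (K \<inter> \<Delta>) * of_bool (insert v G \<subseteq> K)))
        + ?\<psi> (K \<inter> \<Delta>) * of_bool (insert v G \<subseteq> K)
        = \<phi> (K \<inter> insert v \<Delta>) * of_bool (G \<subseteq> K)" for K
      using insert.hyps by (cases "v \<in> K") auto
    ultimately show ?case by simp
  qed
  from this[of "{}"] show ?thesis by simp
qed

definition wmean :: "'a set \<Rightarrow> ('a \<Rightarrow> real) \<Rightarrow> ('a \<Rightarrow> real) \<Rightarrow> real" where
  "wmean S w f = (\<Sum>K\<in>S. w K * f K)"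

lemma wmean_add: "wmean S w (\<lambda>K. f K + g K) = wmean S w f + wmean S w g"
  by (simp add: wmean_def algebra_simps sum.distrib)

lemma wmean_scale: "wmean S w (\<lambda>K. c * f K) = c * wmean S w f"
  by (simp add: wmean_def sum_distrib_left algebra_simps)

lemma wmean_sum: "wmean S w (\<lambda>K. \<Sum>a\<in>A. f a K) = (\<Sum>a\<in>A. wmean S w (f a))"
  unfolding wmean_def sum_distrib_left by (rule sum.swap)

lemma wmean_mono:
  "(\<And>K. K \<in> S \<Longrightarrow> 0 \<le> w K) \<Longrightarrow> (\<And>K. K \<in> S \<Longrightarrow> f K \<le> g K) \<Longrightarrow> wmean S w f \<le> wmean S w g"
  unfolding wmean_def by (intro sum_mono mult_left_mono)

text \<open>
Tychonoff's theorem in place of a diagonal argument: the cube is compact and metrizable.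
\<close>

lemma diagonal_convergent:
  fixes a :: "nat \<Rightarrow> 'i :: countable \<Rightarrow> real"
  assumes "\<And>n i. a n i \<in> {0..1}"
  obtains r where "strict_mono r" "\<And>i. convergent (\<lambda>k. a (r k) i)"
proof -
  have "compactin (product_topology (\<lambda>_. euclidean) UNIV) (PiE UNIV (\<lambda>_ :: 'i. {0..1 :: real}))"
    by (simp add: compactin_PiE)
  then have "seq_compact (PiE UNIV (\<lambda>_ :: 'i. {0..1 :: real}))"
    by (simp add: euclidean_product_topology compact_eq_seq_compact_metric)
  then obtain l r where r: "strict_mono r" and l: "(a \<circ> r) \<longlonglongrightarrow> l"
    by (rule seq_compactE[of _ a]) (use assms in auto)
  have "(\<lambda>k. a (r k) i) \<longlonglongrightarrow> l i" for i
  proof -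
    have "continuous_on UNIV (\<lambda>f :: 'i \<Rightarrow> real. f i)"
      by (rule continuous_on_product_coordinates)
    then have "isCont (\<lambda>f :: 'i \<Rightarrow> real. f i) l"
      by (simp only: continuous_on_eq_continuous_at[OF open_UNIV] ball_UNIV)
    from isCont_tendsto_compose[OF this l] show ?thesis by (simp add: o_def)
  qed
  then show ?thesis using that r convergent_def by blast
qed

lemma superset_event:
  assumes "finite F" shows "{I \<in> indep_sets_of adj. F \<subseteq> I} \<in> sets (indep_algebra adj)"
proof -
  let ?X = "{f \<in> space (Pi\<^sub>M UNIV (\<lambda>_. count_space (UNIV :: bool set))). \<forall>v\<in>F. f v}"
  have "?X \<in> sets (Pi\<^sub>M UNIV (\<lambda>_. count_space UNIV))"
    using assms by (intro sets.sets_Collect_finite_All) auto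
  from in_vimage_algebra[OF this, of "\<lambda>I v. v \<in> I" "indep_sets_of adj"]
  have "(\<lambda>I v. v \<in> I) -` ?X \<inter> indep_sets_of adj \<in> sets (indep_algebra adj)"
    unfolding indep_algebra_def .
  also have "(\<lambda>I v. v \<in> I) -` ?X \<inter> indep_sets_of adj = {I \<in> indep_sets_of adj. F \<subseteq> I}"
    by (auto simp: space_PiM)
  finally show ?thesis .
qed

lemma space_indep_algebra: "space (indep_algebra adj) = indep_sets_of adj"
  by (simp add: indep_algebra_def)

text \<open>
A sequence of finitely supported probability distributions on independent sets for which the
probabilities of increasing local events converge. The limits of all cylinder probabilities form a
consistent family, from which Kolmogorov's theorem produces the limit measure.
\<close>

locale mean_sequence =
  fixes adj :: "'v :: countable \<Rightarrow> 'v \<Rightarrow> bool" and S :: "nat \<Rightarrow> 'v set set" and w :: "nat \<Rightarrow> 'v set \<Rightarrow> real"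
  assumes finite_S: "finite (S n)" and S_indep: "S n \<subseteq> indep_sets_of adj"
    and w_nonneg: "K \<in> S n \<Longrightarrow> 0 \<le> w n K" and w_sum: "(\<Sum>K\<in>S n. w n K) = 1"
    and conv_base: "finite G \<Longrightarrow> convergent (\<lambda>n. wmean (S n) (w n) (\<lambda>K. of_bool (G \<subseteq> K)))"
begin

lemma conv_local:
  assumes "finite \<Delta>" shows "convergent (\<lambda>n. wmean (S n) (w n) (\<lambda>K. \<phi> (K \<inter> \<Delta>)))"
  by (rule local_function_induct[OF assms])
     (auto simp: wmean_scale wmean_add intro: conv_base convergent_add convergent_mult convergent_const)

definition cyl :: "'v set \<Rightarrow> 'v set \<Rightarrow> real" where
  "cyl J A = lim (\<lambda>n. wmean (S n) (w n) (\<lambda>K. of_bool (K \<inter> J = A)))"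

lemma cyl_tendsto:
  "finite J \<Longrightarrow> (\<lambda>n. wmean (S n) (w n) (\<lambda>K. of_bool (K \<inter> J = A))) \<longlonglongrightarrow> cyl J A"
  unfolding cyl_def using conv_local[of J "\<lambda>B. of_bool (B = A)"] by (simp add: convergent_LIMSEQ_iff)

lemma cyl_nonneg: "finite J \<Longrightarrow> 0 \<le> cyl J A"
  using cyl_tendsto[of J A]
  by (rule LIMSEQ_le_const) (auto intro!: exI sum_nonneg simp: wmean_def w_nonneg)

lemma cyl_eq_0: "finite J \<Longrightarrow> \<not> A \<subseteq> J \<Longrightarrow> cyl J A = 0"
proof -
  assume J: "finite J" "\<not> A \<subseteq> J"
  then have "K \<inter> J \<noteq> A" for K by auto
  then show "cyl J A = 0" using LIMSEQ_unique[OF cyl_tendsto[OF J(1), of A]] by (simp add: wmean_def)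
qed

lemma cyl_marginal:
  assumes "J \<subseteq> H" "finite H"
  shows "cyl J A = (\<Sum>B | B \<subseteq> H \<and> B \<inter> J = A. cyl H B)"
proof (rule LIMSEQ_unique)
  have fin: "finite {B. B \<subseteq> H \<and> B \<inter> J = A}" using assms(2) by simp
  have "of_bool (K \<inter> J = A) = (\<Sum>B | B \<subseteq> H \<and> B \<inter> J = A. of_bool (K \<inter> H = B) :: real)" for K
  proof -
    have "(\<Sum>B | B \<subseteq> H \<and> B \<inter> J = A. of_bool (K \<inter> H = B) :: real)
        = of_bool (K \<inter> H \<in> {B. B \<subseteq> H \<and> B \<inter> J = A})"
      using fin sum.delta'[OF fin, of "K \<inter> H" "\<lambda>_. 1 :: real"] by (simp add: of_bool_def if_distrib cong: if_cong)
    also have "K \<inter> H \<in> {B. B \<subseteq> H \<and> B \<inter> J = A} \<longleftrightarrow> K \<inter> J = A" using assms(1) by auto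
    finally show ?thesis by simp
  qed
  then show "(\<lambda>n. wmean (S n) (w n) (\<lambda>K. of_bool (K \<inter> J = A)))
      \<longlonglongrightarrow> (\<Sum>B | B \<subseteq> H \<and> B \<inter> J = A. cyl H B)"
    by (simp only: wmean_sum) (intro tendsto_sum cyl_tendsto assms(2))
  show "(\<lambda>n. wmean (S n) (w n) (\<lambda>K. of_bool (K \<inter> J = A))) \<longlonglongrightarrow> cyl J A"
    using assms by (intro cyl_tendsto) (rule finite_subset)
qed

lemma cyl_empty: "cyl {} {} = 1"
  using LIMSEQ_unique[OF cyl_tendsto[of "{}" "{}"]] by (simp add: wmean_def w_sum)

definition cyl_pmf :: "'v set \<Rightarrow> 'v set pmf" where
  "cyl_pmf J = embed_pmf (cyl J)"

lemma pmf_cyl_pmf: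
  assumes "finite J" shows "pmf (cyl_pmf J) A = cyl J A"
  unfolding cyl_pmf_def
proof (rule pmf_embed_pmf)
  show "0 \<le> cyl J A" for A using cyl_nonneg[OF assms] .
  have "(\<integral>\<^sup>+ A. ennreal (cyl J A) \<partial>count_space UNIV) = (\<Sum>A\<in>Pow J. ennreal (cyl J A))"
    using assms cyl_eq_0 by (intro nn_integral_count_space') (auto simp: Pow_def)
  also have "\<dots> = ennreal (\<Sum>A | A \<subseteq> J \<and> A \<inter> {} = {}. cyl J A)"
    using cyl_nonneg[OF assms] by (simp add: sum_ennreal Pow_def)
  also have "\<dots> = 1" using cyl_marginal[of "{}" J "{}"] assms cyl_empty by simp
  finally show "(\<integral>\<^sup>+ A. ennreal (cyl J A) \<partial>count_space UNIV) = 1" .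
qed

lemma set_cyl_pmf:
  assumes "finite J" "A \<in> set_pmf (cyl_pmf J)" shows "A \<subseteq> J"
  using cyl_eq_0[OF assms(1), of A] assms(2) by (auto simp: set_pmf_iff pmf_cyl_pmf[OF assms(1)])

lemma map_cyl_pmf:
  assumes "J \<subseteq> H" "finite H"
  shows "map_pmf (\<lambda>B. B \<inter> J) (cyl_pmf H) = cyl_pmf J"
proof (rule pmf_eqI)
  fix A
  have J: "finite J" using assms finite_subset by blast
  have "measure (cyl_pmf H) ((\<lambda>B. B \<inter> J) -` {A}) = measure (cyl_pmf H) {B. B \<subseteq> H \<and> B \<inter> J = A}"
    by (intro measure_eq_AE) (auto simp: AE_measure_pmf_iff dest: set_cyl_pmf[OF assms(2)])
  also have "\<dots> = (\<Sum>B | B \<subseteq> H \<and> B \<inter> J = A. cyl H B)"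
    using assms(2) by (simp add: measure_measure_pmf_finite pmf_cyl_pmf)
  finally show "pmf (map_pmf (\<lambda>B. B \<inter> J) (cyl_pmf H)) A = pmf (cyl_pmf J) A"
    using cyl_marginal[OF assms, of A] by (simp add: pmf_map pmf_cyl_pmf J)
qed

text \<open>
Kolmogorov's theorem is applied to real-valued processes, the reals being a Polish space;
configurations enter through their indicator functions.
\<close>

definition ind_fun :: "'v set \<Rightarrow> 'v set \<Rightarrow> 'v \<Rightarrow> real" where
  "ind_fun J A = (\<lambda>v\<in>J. of_bool (v \<in> A))"

definition cyl_measure :: "'v set \<Rightarrow> ('v \<Rightarrow> real) measure" where
  "cyl_measure J = distr (measure_pmf (cyl_pmf J)) (Pi\<^sub>M J (\<lambda>_. borel)) (ind_fun J)"

lemma ind_fun_measurable: "ind_fun J \<in> measurable (measure_pmf p) (Pi\<^sub>M J (\<lambda>_. borel))"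
  by (auto simp: ind_fun_def space_PiM)

sublocale lim: polish_projective UNIV cyl_measure
proof (intro polish_projective.intro projective_family.intro)
  fix J H :: "'v set" assume JH: "J \<subseteq> H" "finite H"
  have "distr (cyl_measure H) (Pi\<^sub>M J (\<lambda>_. borel)) (\<lambda>f. restrict f J)
      = distr (measure_pmf (cyl_pmf H)) (Pi\<^sub>M J (\<lambda>_. borel)) ((\<lambda>f. restrict f J) \<circ> ind_fun H)"
    unfolding cyl_measure_def using JH
    by (intro distr_distr ind_fun_measurable measurable_restrict_subset)
  also have "(\<lambda>f. restrict f J) \<circ> ind_fun H = ind_fun J \<circ> (\<lambda>B. B \<inter> J)"
    using JH by (auto simp: ind_fun_def fun_eq_iff restrict_def)
  also have "distr (measure_pmf (cyl_pmf H)) (Pi\<^sub>M J (\<lambda>_. borel)) (ind_fun J \<circ> (\<lambda>B. B \<inter> J))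
      = distr (distr (measure_pmf (cyl_pmf H)) (count_space UNIV) (\<lambda>B. B \<inter> J)) (Pi\<^sub>M J (\<lambda>_. borel)) (ind_fun J)"
    by (intro distr_distr[symmetric]) (auto simp: ind_fun_def space_PiM)
  also have "\<dots> = distr (measure_pmf (map_pmf (\<lambda>B. B \<inter> J) (cyl_pmf H))) (Pi\<^sub>M J (\<lambda>_. borel)) (ind_fun J)"
    by (simp add: map_pmf_rep_eq)
  finally show "cyl_measure J = distr (cyl_measure H) (Pi\<^sub>M J (\<lambda>_. borel)) (\<lambda>f. restrict f J)"
    unfolding map_cyl_pmf[OF JH] cyl_measure_def[of J] by (rule sym)
next
  fix J :: "'v set" assume "finite J"
  show "prob_space (cyl_measure J)"
    unfolding cyl_measure_def by (intro measure_pmf.prob_space_distr ind_fun_measurable)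
qed

lemma measure_lim_all_one:
  assumes F: "finite F"
  shows "measure lim.lim {\<omega> \<in> space lim.lim. \<forall>v\<in>F. \<omega> v = 1} = cyl F F"
proof -
  let ?X = "{f \<in> space (Pi\<^sub>M F (\<lambda>_. borel)). \<forall>v\<in>F. f v = (1 :: real)}"
  have X: "?X \<in> sets (Pi\<^sub>M F (\<lambda>_. borel))"
    using F by (intro sets.sets_Collect_finite_All) auto
  have "{\<omega> \<in> space lim.lim. \<forall>v\<in>F. \<omega> v = 1} = prod_emb UNIV (\<lambda>_. borel) F ?X"
    by (auto simp: prod_emb_def space_PiM)
  then have "measure lim.lim {\<omega> \<in> space lim.lim. \<forall>v\<in>F. \<omega> v = 1} = measure (cyl_measure F) ?X"
    using lim.measure_lim_emb[of F ?X] F X by simp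
  also have "\<dots> = measure (cyl_pmf F) (ind_fun F -` ?X \<inter> space (measure_pmf (cyl_pmf F)))"
    unfolding cyl_measure_def by (rule measure_distr[OF ind_fun_measurable X])
  also have "ind_fun F -` ?X \<inter> space (measure_pmf (cyl_pmf F)) = {A. F \<subseteq> A}"
    by (auto simp: ind_fun_def space_PiM)
  also have "measure (cyl_pmf F) {A. F \<subseteq> A} = measure (cyl_pmf F) {F}"
    by (intro measure_eq_AE) (auto simp: AE_measure_pmf_iff dest: set_cyl_pmf[OF F])
  finally show ?thesis by (simp add: measure_pmf_single pmf_cyl_pmf F)
qed

text \<open>
The default value on the null event that the random set is not independent makes the map total into
the space of independent sets.
\<close>

definition conf :: "('v \<Rightarrow> real) \<Rightarrow> 'v set" where
  "conf \<omega> = (if \<forall>u v. adj u v \<longrightarrow> \<not> (\<omega> u = 1 \<and> \<omega> v = 1) then {v. \<omega> v = 1} else {})"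

lemma conf_measurable: "conf \<in> measurable lim.lim (indep_algebra adj)"
  unfolding indep_algebra_def
proof (rule measurable_vimage_algebra2)
  show "conf \<in> space lim.lim \<rightarrow> indep_sets_of adj"
    by (auto simp: conf_def indep_sets_of_def split: if_splits)
  have [measurable]: "(\<lambda>\<omega>. \<omega> v) \<in> borel_measurable lim.lim" for v
    using measurable_component_singleton[of v UNIV "\<lambda>_. borel"] by (simp cong: measurable_cong_sets)
  have mem: "v \<in> conf \<omega> \<longleftrightarrow> (\<forall>u v. adj u v \<longrightarrow> \<not> (\<omega> u = 1 \<and> \<omega> v = 1)) \<and> \<omega> v = 1" for v \<omega>
    by (simp add: conf_def)
  show "(\<lambda>\<omega> v. v \<in> conf \<omega>) \<in> measurable lim.lim (Pi\<^sub>M UNIV (\<lambda>_. count_space UNIV))"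
    unfolding mem by (rule measurable_PiM_single') auto
qed

definition limit_measure :: "'v set measure" where
  "limit_measure = distr lim.lim (indep_algebra adj) conf"

lemma prob_space_limit_measure: "prob_space limit_measure"
  unfolding limit_measure_def by (rule lim.P.prob_space_distr[OF conf_measurable])

lemma sets_limit_measure: "sets limit_measure = sets (indep_algebra adj)"
  by (simp add: limit_measure_def)

lemma cyl_superset_tendsto:
  "finite F \<Longrightarrow> (\<lambda>n. wmean (S n) (w n) (\<lambda>K. of_bool (F \<subseteq> K))) \<longlonglongrightarrow> cyl F F"
proof -
  have "F \<subseteq> K \<longleftrightarrow> K \<inter> F = F" for K by auto
  then show "finite F \<Longrightarrow> ?thesis" using cyl_tendsto[of F F] by simp
qed

lemma AE_indep: "AE \<omega> in lim.lim. \<forall>u v. adj u v \<longrightarrow> \<not> (\<omega> u = 1 \<and> \<omega> v = 1)"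
proof (intro AE_all_countable[THEN iffD2] allI)
  fix u v
  show "AE \<omega> in lim.lim. adj u v \<longrightarrow> \<not> (\<omega> u = 1 \<and> \<omega> v = 1)"
  proof (cases "adj u v")
    case True
    then have "\<not> {u, v} \<subseteq> K" if "K \<in> S n" for K n
      using that S_indep by (auto simp: indep_sets_of_def)
    then have "wmean (S n) (w n) (\<lambda>K. of_bool ({u, v} \<subseteq> K)) = 0" for n
      unfolding wmean_def by (intro sum.neutral) auto
    then have "cyl {u, v} {u, v} = 0"
      using LIMSEQ_unique[OF cyl_superset_tendsto[of "{u, v}"]] by simp
    then have "measure lim.lim {\<omega> \<in> space lim.lim. \<forall>x\<in>{u, v}. \<omega> x = 1} = 0"
      using measure_lim_all_one[of "{u, v}"] by simp
    moreover have [measurable]: "(\<lambda>\<omega>. \<omega> v) \<in> borel_measurable lim.lim" for v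
      using measurable_component_singleton[of v UNIV "\<lambda>_. borel"] by (simp cong: measurable_cong_sets)
    moreover have "{\<omega> \<in> space lim.lim. \<forall>x\<in>{u, v}. \<omega> x = 1} \<in> sets lim.lim"
      by (intro sets.sets_Collect_finite_All) auto
    ultimately have "{\<omega> \<in> space lim.lim. \<forall>x\<in>{u, v}. \<omega> x = 1} \<in> null_sets lim.lim"
      by (simp add: null_setsI lim.P.emeasure_eq_measure)
    then show ?thesis by (rule AE_I') auto
  qed simp
qed

lemma limit_measure_superset:
  assumes F: "finite F"
  shows "(\<lambda>n. wmean (S n) (w n) (\<lambda>K. of_bool (F \<subseteq> K))) \<longlonglongrightarrow>
    measure limit_measure {I \<in> indep_sets_of adj. F \<subseteq> I}"
proof -
  let ?A = "{I \<in> indep_sets_of adj. F \<subseteq> I}"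
  have meas: "conf -` ?A \<inter> space lim.lim \<in> sets lim.lim"
    using superset_event[OF F] conf_measurable by (rule measurable_sets[rotated])
  have [measurable]: "(\<lambda>\<omega>. \<omega> v) \<in> borel_measurable lim.lim" for v
    using measurable_component_singleton[of v UNIV "\<lambda>_. borel"] by (simp cong: measurable_cong_sets)
  have "measure limit_measure ?A = measure lim.lim (conf -` ?A \<inter> space lim.lim)"
    unfolding limit_measure_def by (rule measure_distr[OF conf_measurable superset_event[OF F]])
  also have "\<dots> = measure lim.lim {\<omega> \<in> space lim.lim. \<forall>v\<in>F. \<omega> v = 1}"
  proof (rule measure_eq_AE)
    show "{\<omega> \<in> space lim.lim. \<forall>v\<in>F. \<omega> v = 1} \<in> sets lim.lim"
      using F by (intro sets.sets_Collect_finite_All) auto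
    show "AE \<omega> in lim.lim. (\<omega> \<in> conf -` ?A \<inter> space lim.lim) =
        (\<omega> \<in> {\<omega> \<in> space lim.lim. \<forall>v\<in>F. \<omega> v = 1})"
      using AE_indep AE_space by eventually_elim (auto simp: conf_def indep_sets_of_def)
  qed (fact meas)
  finally show ?thesis
    using cyl_superset_tendsto[OF F] measure_lim_all_one[OF F] by simp
qed


lemma limit_local:
  assumes "finite \<Delta>"
  shows "(\<lambda>n. wmean (S n) (w n) (\<lambda>K. \<phi> (K \<inter> \<Delta>))) \<longlonglongrightarrow> (\<integral>I. \<phi> (I \<inter> \<Delta>) \<partial>limit_measure)"
    and "integrable limit_measure (\<lambda>I. \<phi> (I \<inter> \<Delta>))"
proof -
  let ?P = "\<lambda>f. integrable limit_measure f \<and>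
    (\<lambda>n. wmean (S n) (w n) f) \<longlonglongrightarrow> (\<integral>I. f I \<partial>limit_measure)"
  interpret prob_space limit_measure by (rule prob_space_limit_measure)
  have space: "space limit_measure = indep_sets_of adj"
    using sets_eq_imp_space_eq[OF sets_limit_measure] by (simp add: space_indep_algebra)
  have "?P (\<lambda>K. \<phi> (K \<inter> \<Delta>))"
  proof (rule local_function_induct[OF assms, where P = ?P])
    fix G :: "'v set" assume G: "finite G"
    let ?A = "{I \<in> indep_sets_of adj. G \<subseteq> I}"
    have A: "?A \<in> sets limit_measure" using superset_event[OF G] by (simp add: sets_limit_measure)
    have eq: "of_bool (G \<subseteq> I) = indicator ?A I" if "I \<in> space limit_measure" for I
      using that by (auto simp: space indicator_def)
    have "integrable limit_measure (\<lambda>I. of_bool (G \<subseteq> I) :: real)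
        \<longleftrightarrow> integrable limit_measure (indicator ?A :: _ \<Rightarrow> real)"
      by (rule Bochner_Integration.integrable_cong) (auto simp: eq)
    moreover have "(\<integral>I. of_bool (G \<subseteq> I) \<partial>limit_measure) = (\<integral>I. indicator ?A I \<partial>limit_measure :: real)"
      by (rule Bochner_Integration.integral_cong) (auto simp: eq)
    ultimately show "?P (\<lambda>K. of_bool (G \<subseteq> K))"
      using limit_measure_superset[OF G] A by (simp add: emeasure_eq_measure)
  qed (auto simp: wmean_scale wmean_add intro: tendsto_intros)
  then show "(\<lambda>n. wmean (S n) (w n) (\<lambda>K. \<phi> (K \<inter> \<Delta>))) \<longlonglongrightarrow> (\<integral>I. \<phi> (I \<inter> \<Delta>) \<partial>limit_measure)"
    and "integrable limit_measure (\<lambda>I. \<phi> (I \<inter> \<Delta>))" by blast+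
qed

end

section \<open>Gibbs measures as thermodynamic limits\<close>

definition hc_fibre :: "('v \<Rightarrow> 'v \<Rightarrow> bool) \<Rightarrow> 'v set \<Rightarrow> 'v set \<Rightarrow> 'v set set" where
  "hc_fibre adj \<Lambda> \<xi> = {K. K \<in> indep_sets_of adj \<and> K - \<Lambda> = \<xi> - \<Lambda>}"

definition hc_weight :: "('v \<Rightarrow> 'v \<Rightarrow> bool) \<Rightarrow> real \<Rightarrow> 'v set \<Rightarrow> 'v set \<Rightarrow> 'v set \<Rightarrow> real" where
  "hc_weight adj lam \<Lambda> \<xi> K = lam ^ card (K \<inter> \<Lambda>) / hc_partition adj lam \<Lambda> \<xi>"

abbreviation hc_mean ::
  "('v \<Rightarrow> 'v \<Rightarrow> bool) \<Rightarrow> real \<Rightarrow> 'v set \<Rightarrow> 'v set \<Rightarrow> ('v set \<Rightarrow> real) \<Rightarrow> real" where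
  "hc_mean adj lam \<Lambda> \<xi> \<equiv> wmean (hc_fibre adj \<Lambda> \<xi>) (hc_weight adj lam \<Lambda> \<xi>)"

definition hc_kernel :: "('v \<Rightarrow> 'v \<Rightarrow> bool) \<Rightarrow> real \<Rightarrow> 'v set \<Rightarrow> 'v set \<Rightarrow> 'v set measure" where
  "hc_kernel adj lam \<Lambda> \<xi> =
     distr (point_measure (hc_fibre adj \<Lambda> \<xi>) (\<lambda>K. ennreal (hc_weight adj lam \<Lambda> \<xi> K)))
       (indep_algebra adj) (\<lambda>K. K)"

lemma hc_partition_cong: "K - \<Lambda> = \<xi> - \<Lambda> \<Longrightarrow> hc_partition adj lam \<Lambda> K = hc_partition adj lam \<Lambda> \<xi>"
  by (simp add: hc_partition_def)

lemma hc_weight_cong: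
  assumes "K - \<Lambda> = \<xi> - \<Lambda>" shows "hc_weight adj lam \<Lambda> K = hc_weight adj lam \<Lambda> \<xi>"
  unfolding hc_weight_def hc_partition_cong[OF assms] ..

lemma hc_partition_fibre: "hc_partition adj lam \<Lambda> \<xi> = (\<Sum>K\<in>hc_fibre adj \<Lambda> \<xi>. lam ^ card (K \<inter> \<Lambda>))"
  by (simp add: hc_partition_def hc_fibre_def)

lemma indep_subset: "K \<in> indep_sets_of adj \<Longrightarrow> L \<subseteq> K \<Longrightarrow> L \<in> indep_sets_of adj"
  by (auto simp: indep_sets_of_def)

locale hard_core_graph =
  fixes adj :: "'v :: countable \<Rightarrow> 'v \<Rightarrow> bool" and lam :: real
  assumes lam_pos: "0 < lam" and locally_finite: "finite {u. adj v u \<or> adj u v}"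
begin

abbreviation \<Omega> :: "'v set set" where "\<Omega> \<equiv> indep_sets_of adj"
abbreviation fibre where "fibre \<equiv> hc_fibre adj"
abbreviation Z where "Z \<equiv> hc_partition adj lam"
abbreviation weight where "weight \<equiv> hc_weight adj lam"
abbreviation mean where "mean \<equiv> hc_mean adj lam"
abbreviation kernel where "kernel \<equiv> hc_kernel adj lam"

lemma fibre_subset: "fibre \<Lambda> \<xi> \<subseteq> \<Omega>"
  by (auto simp: hc_fibre_def)

lemma finite_fibre: "finite \<Lambda> \<Longrightarrow> finite (fibre \<Lambda> \<xi>)"
  unfolding hc_fibre_def by (rule finite_hc_fibre)

lemma partition_pos: "finite \<Lambda> \<Longrightarrow> \<xi> \<in> \<Omega> \<Longrightarrow> 0 < Z \<Lambda> \<xi>"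
  unfolding hc_partition_fibre
  by (rule sum_pos[OF finite_fibre]) (auto simp: lam_pos hc_fibre_def)

lemma weight_nonneg: "finite \<Lambda> \<Longrightarrow> \<xi> \<in> \<Omega> \<Longrightarrow> 0 \<le> weight \<Lambda> \<xi> K"
  using partition_pos[of \<Lambda> \<xi>] lam_pos by (simp add: hc_weight_def)

lemma weight_sum: "finite \<Lambda> \<Longrightarrow> \<xi> \<in> \<Omega> \<Longrightarrow> (\<Sum>K\<in>fibre \<Lambda> \<xi>. weight \<Lambda> \<xi> K) = 1"
  using partition_pos[of \<Lambda> \<xi>]
  by (simp add: hc_weight_def hc_partition_fibre[symmetric] flip: sum_divide_distrib)

lemma mean_bounds:
  assumes "finite \<Lambda>" "\<xi> \<in> \<Omega>" "\<And>K. K \<in> fibre \<Lambda> \<xi> \<Longrightarrow> 0 \<le> f K" "\<And>K. K \<in> fibre \<Lambda> \<xi> \<Longrightarrow> f K \<le> 1"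
  shows "0 \<le> mean \<Lambda> \<xi> f" "mean \<Lambda> \<xi> f \<le> 1"
proof -
  show "0 \<le> mean \<Lambda> \<xi> f"
    unfolding wmean_def using assms weight_nonneg by (intro sum_nonneg mult_nonneg_nonneg)
  have "mean \<Lambda> \<xi> f \<le> mean \<Lambda> \<xi> (\<lambda>_. 1)"
    by (rule wmean_mono) (use assms weight_nonneg in auto)
  then show "mean \<Lambda> \<xi> f \<le> 1" using weight_sum[OF assms(1,2)] by (simp add: wmean_def)
qed

text \<open>
Resampling inside \<open>\<Lambda>\<close> preserves the finite-volume measure on a larger set: two configurations that
agree off \<open>\<Lambda>\<close> have weights in \<open>\<Delta>\<close> whose ratio is that of their weights in \<open>\<Lambda>\<close>.
\<close>

lemma mean_consistent:
  assumes "\<Lambda> \<subseteq> \<Delta>" "finite \<Delta>" "\<xi> \<in> \<Omega>"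
  shows "mean \<Delta> \<xi> (\<lambda>K. mean \<Lambda> K f) = mean \<Delta> \<xi> f"
proof -
  have \<Lambda>: "finite \<Lambda>" using assms finite_subset by blast
  let ?F = "fibre \<Delta> \<xi>"
  have sub: "fibre \<Lambda> K \<subseteq> ?F" if "K \<in> ?F" for K
    using that assms(1) by (auto simp: hc_fibre_def)
  have sym: "L \<in> fibre \<Lambda> K \<longleftrightarrow> K \<in> fibre \<Lambda> L" if "K \<in> ?F" "L \<in> ?F" for K L
    using that by (auto simp: hc_fibre_def)
  have inner: "(\<Sum>K\<in>fibre \<Lambda> L. weight \<Delta> \<xi> K * weight \<Lambda> K L) = weight \<Delta> \<xi> L" if L: "L \<in> ?F" for L
  proof -
    have L': "L \<in> \<Omega>" using L by (simp add: hc_fibre_def)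
    have "(\<Sum>K\<in>fibre \<Lambda> L. weight \<Delta> \<xi> K * weight \<Lambda> K L)
        = (\<Sum>K\<in>fibre \<Lambda> L. lam ^ card (K \<inter> \<Lambda>) * (weight \<Delta> \<xi> L / Z \<Lambda> L))"
    proof (rule sum.cong)
      fix K assume K: "K \<in> fibre \<Lambda> L"
      then have eq: "K - \<Lambda> = L - \<Lambda>" by (simp add: hc_fibre_def)
      have split: "card (M \<inter> \<Delta>) = card (M \<inter> \<Lambda>) + card ((M - \<Lambda>) \<inter> \<Delta>)" for M
      proof -
        have "M \<inter> \<Delta> = (M \<inter> \<Lambda>) \<union> ((M - \<Lambda>) \<inter> \<Delta>)" using assms(1) by blast
        then show ?thesis using \<Lambda> assms(2) by (simp add: card_Un_disjoint disjoint_iff)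
      qed
      show "weight \<Delta> \<xi> K * weight \<Lambda> K L = lam ^ card (K \<inter> \<Lambda>) * (weight \<Delta> \<xi> L / Z \<Lambda> L)"
        unfolding hc_weight_cong[OF eq] using split[of K] split[of L]
        by (simp add: hc_weight_def eq power_add)
    qed simp
    also have "\<dots> = Z \<Lambda> L * (weight \<Delta> \<xi> L / Z \<Lambda> L)"
      by (simp only: hc_partition_fibre sum_distrib_right)
    also have "\<dots> = weight \<Delta> \<xi> L" using partition_pos[OF \<Lambda> L'] by simp
    finally show ?thesis .
  qed
  have "mean \<Delta> \<xi> (\<lambda>K. mean \<Lambda> K f) = (\<Sum>K\<in>?F. \<Sum>L\<in>fibre \<Lambda> K. weight \<Delta> \<xi> K * weight \<Lambda> K L * f L)"
    by (simp add: wmean_def sum_distrib_left mult.assoc)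
  also have "\<dots> = (\<Sum>K\<in>?F. \<Sum>L\<in>{L \<in> ?F. L \<in> fibre \<Lambda> K}. weight \<Delta> \<xi> K * weight \<Lambda> K L * f L)"
    using sub by (intro sum.cong) auto
  also have "\<dots> = (\<Sum>L\<in>?F. \<Sum>K\<in>{K \<in> ?F. L \<in> fibre \<Lambda> K}. weight \<Delta> \<xi> K * weight \<Lambda> K L * f L)"
    using finite_fibre[OF assms(2)] by (intro sum.swap_restrict)
  also have "\<dots> = (\<Sum>L\<in>?F. (\<Sum>K\<in>fibre \<Lambda> L. weight \<Delta> \<xi> K * weight \<Lambda> K L) * f L)"
  proof (rule sum.cong)
    fix L assume L: "L \<in> ?F"
    then have "{K \<in> ?F. L \<in> fibre \<Lambda> K} = fibre \<Lambda> L" using sym sub by blast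
    then show "(\<Sum>K\<in>{K \<in> ?F. L \<in> fibre \<Lambda> K}. weight \<Delta> \<xi> K * weight \<Lambda> K L * f L) =
        (\<Sum>K\<in>fibre \<Lambda> L. weight \<Delta> \<xi> K * weight \<Lambda> K L) * f L"
      by (simp add: sum_distrib_right)
  qed simp
  also have "\<dots> = mean \<Delta> \<xi> f" by (simp add: wmean_def inner)
  finally show ?thesis .
qed

lemma sum_fibre:
  assumes "finite \<Lambda>"
  shows "(\<Sum>K\<in>fibre \<Lambda> \<xi>. g K) = (\<Sum>S\<in>Pow \<Lambda>. of_bool (S \<union> (\<xi> - \<Lambda>) \<in> \<Omega>) * (g (S \<union> (\<xi> - \<Lambda>)) :: real))"
proof -
  let ?B = "{S \<in> Pow \<Lambda>. S \<union> (\<xi> - \<Lambda>) \<in> \<Omega>}"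
  have "(\<Sum>K\<in>fibre \<Lambda> \<xi>. g K) = (\<Sum>S\<in>?B. g (S \<union> (\<xi> - \<Lambda>)))"
  proof (rule sum.reindex_bij_witness[where i = "\<lambda>S. S \<union> (\<xi> - \<Lambda>)" and j = "\<lambda>K. K \<inter> \<Lambda>"])
    fix K assume "K \<in> fibre \<Lambda> \<xi>"
    moreover from this have "K \<inter> \<Lambda> \<union> (\<xi> - \<Lambda>) = K" by (auto simp: hc_fibre_def)
    ultimately show "K \<inter> \<Lambda> \<union> (\<xi> - \<Lambda>) = K" "K \<inter> \<Lambda> \<in> ?B" "g (K \<inter> \<Lambda> \<union> (\<xi> - \<Lambda>)) = g K"
      by (simp_all add: hc_fibre_def)
  next
    fix S assume "S \<in> ?B"
    then show "(S \<union> (\<xi> - \<Lambda>)) \<inter> \<Lambda> = S" "S \<union> (\<xi> - \<Lambda>) \<in> fibre \<Lambda> \<xi>"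
      by (auto simp: hc_fibre_def)
  qed
  also have "\<dots> = (\<Sum>S\<in>Pow \<Lambda>. of_bool (S \<union> (\<xi> - \<Lambda>) \<in> \<Omega>) * g (S \<union> (\<xi> - \<Lambda>)))"
    using assms by (intro sum.mono_neutral_cong_left) auto
  finally show ?thesis .
qed

text \<open>
Writing the configurations of a fibre as \<open>S \<union> (\<xi> - \<Lambda>)\<close> turns the mean into a quotient of sums over
an index set that is independent of \<open>\<xi>\<close>. Measurability and locality in \<open>\<xi>\<close> are read off from this.
\<close>

lemma mean_eq_quotient:
  assumes "finite \<Lambda>"
  shows "mean \<Lambda> \<xi> f =
    (\<Sum>S\<in>Pow \<Lambda>. of_bool (S \<union> (\<xi> - \<Lambda>) \<in> \<Omega>) * (lam ^ card S * f (S \<union> (\<xi> - \<Lambda>)))) /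
    (\<Sum>S\<in>Pow \<Lambda>. of_bool (S \<union> (\<xi> - \<Lambda>) \<in> \<Omega>) * lam ^ card S)"
proof -
  have int: "(S \<union> (\<xi> - \<Lambda>)) \<inter> \<Lambda> = S" if "S \<in> Pow \<Lambda>" for S using that by auto
  have "mean \<Lambda> \<xi> f = (\<Sum>K\<in>fibre \<Lambda> \<xi>. lam ^ card (K \<inter> \<Lambda>) * f K) / (\<Sum>K\<in>fibre \<Lambda> \<xi>. lam ^ card (K \<inter> \<Lambda>))"
    by (simp add: wmean_def hc_weight_def sum_divide_distrib hc_partition_fibre)
  then show ?thesis
    unfolding sum_fibre[OF assms] using int by (auto intro!: arg_cong2[where f = "(/)"] sum.cong)
qed

definition ngh :: "'v set \<Rightarrow> 'v set" where
  "ngh \<Lambda> = \<Lambda> \<union> (\<Union>v\<in>\<Lambda>. {u. adj v u \<or> adj u v})"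

lemma finite_ngh: "finite \<Lambda> \<Longrightarrow> finite (ngh \<Lambda>)"
  using locally_finite by (auto simp: ngh_def)

lemma mean_local:
  assumes "finite \<Lambda>" "K \<in> \<Omega>"
  shows "mean \<Lambda> K (\<lambda>L. of_bool (F \<subseteq> L)) = mean \<Lambda> (K \<inter> (F \<union> ngh \<Lambda>)) (\<lambda>L. of_bool (F \<subseteq> L))"
proof -
  let ?K = "K \<inter> (F \<union> ngh \<Lambda>)"
  have "S \<union> (K - \<Lambda>) \<in> \<Omega> \<longleftrightarrow> S \<union> (?K - \<Lambda>) \<in> \<Omega>" if "S \<in> Pow \<Lambda>" for S
    using that assms(2) unfolding indep_sets_of_def ngh_def by blast
  moreover have "F \<subseteq> S \<union> (K - \<Lambda>) \<longleftrightarrow> F \<subseteq> S \<union> (?K - \<Lambda>)" for S by blast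
  ultimately show ?thesis unfolding mean_eq_quotient[OF assms(1)]
    by (intro arg_cong2[where f = "(/)"] sum.cong) simp_all
qed

lemma indep_algebra_singleton: "J \<in> \<Omega> \<Longrightarrow> {J} \<in> sets (indep_algebra adj)"
proof -
  assume J: "J \<in> \<Omega>"
  have ev: "{I \<in> \<Omega>. v \<in> I} \<in> sets (indep_algebra adj)" for v
    using superset_event[of "{v}" adj] by simp
  have "{I \<in> space (indep_algebra adj). \<forall>v. v \<in> I \<longleftrightarrow> v \<in> J} \<in> sets (indep_algebra adj)"
  proof (rule sets.sets_Collect_countable_All)
    fix v
    have "{I \<in> space (indep_algebra adj). (v \<in> I) = (v \<in> J)} =
        (if v \<in> J then {I \<in> \<Omega>. v \<in> I} else space (indep_algebra adj) - {I \<in> \<Omega>. v \<in> I})"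
      by (auto simp: space_indep_algebra)
    then show "{I \<in> space (indep_algebra adj). (v \<in> I) = (v \<in> J)} \<in> sets (indep_algebra adj)"
      using ev by auto
  qed
  also have "{I \<in> space (indep_algebra adj). \<forall>v. v \<in> I \<longleftrightarrow> v \<in> J} = {J}"
    using J by (auto simp: space_indep_algebra)
  finally show ?thesis .
qed

lemma emeasure_kernel:
  assumes "finite \<Lambda>" "\<xi> \<in> \<Omega>" "A \<in> sets (indep_algebra adj)"
  shows "emeasure (kernel \<Lambda> \<xi>) A = ennreal (mean \<Lambda> \<xi> (indicator A))"
proof -
  let ?F = "fibre \<Lambda> \<xi>"
  let ?p = "point_measure ?F (\<lambda>K. ennreal (weight \<Lambda> \<xi> K))"
  have "emeasure (kernel \<Lambda> \<xi>) A = emeasure ?p ((\<lambda>K. K) -` A \<inter> space ?p)"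
    unfolding hc_kernel_def
    by (rule emeasure_distr[OF _ assms(3)]) (auto simp: hc_fibre_def space_indep_algebra)
  also have "\<dots> = (\<Sum>K\<in>A \<inter> ?F. ennreal (weight \<Lambda> \<xi> K))"
    using finite_fibre[OF assms(1)]
    by (subst emeasure_point_measure_finite) (auto simp: space_point_measure vimage_def)
  also have "\<dots> = ennreal (\<Sum>K\<in>A \<inter> ?F. weight \<Lambda> \<xi> K)"
    using weight_nonneg[OF assms(1,2)] by (simp add: sum_ennreal)
  also have "(\<Sum>K\<in>A \<inter> ?F. weight \<Lambda> \<xi> K) = mean \<Lambda> \<xi> (indicator A)"
    unfolding wmean_def using finite_fibre[OF assms(1)]
    by (intro sum.mono_neutral_cong_left) (auto simp: indicator_def)
  finally show ?thesis .
qed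

lemma measure_kernel:
  assumes "finite \<Lambda>" "\<xi> \<in> \<Omega>" "A \<in> sets (indep_algebra adj)"
  shows "measure (kernel \<Lambda> \<xi>) A = mean \<Lambda> \<xi> (indicator A)"
  using emeasure_kernel[OF assms] mean_bounds(1)[OF assms(1,2), of "indicator A"] by (simp add: measure_def)

lemma sets_kernel: "sets (kernel \<Lambda> \<xi>) = sets (indep_algebra adj)"
  by (simp add: hc_kernel_def)

lemma prob_space_kernel:
  assumes "finite \<Lambda>" "\<xi> \<in> \<Omega>" shows "prob_space (kernel \<Lambda> \<xi>)"
proof
  have "space (kernel \<Lambda> \<xi>) = \<Omega>" by (simp add: hc_kernel_def space_indep_algebra)
  moreover have "mean \<Lambda> \<xi> (indicator \<Omega>) = 1"
    using weight_sum[OF assms] by (simp add: wmean_def hc_fibre_def indicator_def)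
  ultimately show "emeasure (kernel \<Lambda> \<xi>) (space (kernel \<Lambda> \<xi>)) = 1"
    using emeasure_kernel[OF assms, of \<Omega>] sets.top[of "indep_algebra adj"] by (simp add: space_indep_algebra)
qed

lemma kernel_singleton:
  assumes "finite \<Lambda>" "I \<in> \<Omega>" "J \<in> \<Omega>"
  shows "measure (kernel \<Lambda> I) {J} = (if I - \<Lambda> = J - \<Lambda> then lam ^ card (J \<inter> \<Lambda>) / Z \<Lambda> I else 0)"
proof -
  have "mean \<Lambda> I (indicator {J}) = (\<Sum>K\<in>fibre \<Lambda> I. if K = J then weight \<Lambda> I K else 0)"
    unfolding wmean_def by (intro sum.cong) (auto simp: indicator_def)
  also have "\<dots> = (if J \<in> fibre \<Lambda> I then weight \<Lambda> I J else 0)"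
    using finite_fibre[OF assms(1)] by (simp add: sum.delta')
  finally show ?thesis
    using measure_kernel[OF assms(1,2) indep_algebra_singleton[OF assms(3)]] assms(3)
    by (auto simp: hc_fibre_def hc_weight_def)
qed

lemma space_outside: "space (outside_algebra adj \<Lambda>) = \<Omega>"
  by (simp add: outside_algebra_def)

lemma outside_event:
  assumes "B \<in> sets (outside_algebra adj \<Lambda>)"
  obtains B' where "B = {I \<in> \<Omega>. I - \<Lambda> \<in> B'}"
proof -
  have "(\<lambda>I. I - \<Lambda>) \<in> \<Omega> \<rightarrow> space (indep_algebra adj)"
    by (auto simp: space_indep_algebra indep_sets_of_def)
  then obtain B' where "B = (\<lambda>I. I - \<Lambda>) -` B' \<inter> \<Omega>"
    using assms unfolding outside_algebra_def by (auto simp: sets_vimage_algebra2)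
  then show ?thesis using that[of B'] by auto
qed

lemma pred_outside: "v \<notin> \<Lambda> \<Longrightarrow> Measurable.pred (outside_algebra adj \<Lambda>) (\<lambda>I. v \<in> I)"
proof -
  assume v: "v \<notin> \<Lambda>"
  have "(\<lambda>I. I - \<Lambda>) -` {I \<in> \<Omega>. {v} \<subseteq> I} \<inter> \<Omega> \<in> sets (outside_algebra adj \<Lambda>)"
    unfolding outside_algebra_def by (intro in_vimage_algebra superset_event) simp
  also have "(\<lambda>I. I - \<Lambda>) -` {I \<in> \<Omega>. {v} \<subseteq> I} \<inter> \<Omega> = {I \<in> space (outside_algebra adj \<Lambda>). v \<in> I}"
    using v by (auto simp: space_outside intro: indep_subset)
  finally show ?thesis by (simp add: pred_def)
qed

text \<open>
The configuration obtained by prescribing \<open>S\<close> inside \<open>\<Lambda>\<close> is a function of the outside alone. It need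
not be independent, so that its independence is part of the event.
\<close>

lemma glue_event:
  assumes "S \<subseteq> \<Lambda>" "B \<in> sets (indep_algebra adj)"
  shows "{\<xi> \<in> \<Omega>. S \<union> (\<xi> - \<Lambda>) \<in> B} \<in> sets (outside_algebra adj \<Lambda>)"
proof -
  let ?O = "outside_algebra adj \<Lambda>" and ?g = "\<lambda>\<xi>. S \<union> (\<xi> - \<Lambda>)"
  let ?P = "Pi\<^sub>M UNIV (\<lambda>_ :: 'v. count_space (UNIV :: bool set))"
  have coord [measurable]: "Measurable.pred ?O (\<lambda>\<xi>. v \<in> ?g \<xi>)" for v
    using pred_outside[of v \<Lambda>] by (cases "v \<in> \<Lambda>") auto
  have chi: "(\<lambda>\<xi> v. v \<in> ?g \<xi>) \<in> measurable ?O ?P"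
    by (rule measurable_PiM_single', rule coord) simp
  obtain X where X: "X \<in> sets ?P" "B = (\<lambda>I v. v \<in> I) -` X \<inter> \<Omega>"
    using assms(2) unfolding indep_algebra_def by (auto simp: sets_vimage_algebra2 space_PiM)
  have "{\<xi> \<in> space ?O. ?g \<xi> \<in> \<Omega>} = {\<xi> \<in> space ?O. \<forall>u v. adj u v \<longrightarrow> \<not> (u \<in> ?g \<xi> \<and> v \<in> ?g \<xi>)}"
    by (auto simp: indep_sets_of_def)
  also have "\<dots> \<in> sets ?O" by measurable
  finally have "{\<xi> \<in> space ?O. ?g \<xi> \<in> \<Omega>} \<inter> ((\<lambda>\<xi> v. v \<in> ?g \<xi>) -` X \<inter> space ?O) \<in> sets ?O"
    using measurable_sets[OF chi X(1)] by auto
  also have "{\<xi> \<in> space ?O. ?g \<xi> \<in> \<Omega>} \<inter> ((\<lambda>\<xi> v. v \<in> ?g \<xi>) -` X \<inter> space ?O) = {\<xi> \<in> \<Omega>. ?g \<xi> \<in> B}"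
    using X(2) by (auto simp: space_outside)
  finally show ?thesis .
qed

lemma mean_measurable:
  assumes "finite \<Lambda>" "A \<in> sets (indep_algebra adj)"
  shows "(\<lambda>\<xi>. mean \<Lambda> \<xi> (indicator A)) \<in> borel_measurable (outside_algebra adj \<Lambda>)"
proof -
  let ?O = "outside_algebra adj \<Lambda>" and ?g = "\<lambda>S \<xi>. S \<union> (\<xi> - \<Lambda>)"
  have ind: "(\<lambda>\<xi>. indicator {\<xi> \<in> \<Omega>. ?g S \<xi> \<in> B} \<xi> :: real) \<in> borel_measurable ?O"
    if "S \<in> Pow \<Lambda>" "B \<in> sets (indep_algebra adj)" for S B
    using glue_event[of S \<Lambda> B] that by simp
  have "\<Omega> \<in> sets (indep_algebra adj)"
    using sets.top[of "indep_algebra adj"] by (simp add: space_indep_algebra)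
  then have "(\<lambda>\<xi>. (\<Sum>S\<in>Pow \<Lambda>. lam ^ card S * indicator {\<xi> \<in> \<Omega>. ?g S \<xi> \<in> A} \<xi>) /
      (\<Sum>S\<in>Pow \<Lambda>. lam ^ card S * indicator {\<xi> \<in> \<Omega>. ?g S \<xi> \<in> \<Omega>} \<xi>)) \<in> borel_measurable ?O"
    using ind assms(2)
    by (intro borel_measurable_divide borel_measurable_sum borel_measurable_times borel_measurable_const) auto
  moreover have "(\<Sum>S\<in>Pow \<Lambda>. lam ^ card S * indicator {\<xi> \<in> \<Omega>. ?g S \<xi> \<in> A} \<xi>) /
      (\<Sum>S\<in>Pow \<Lambda>. lam ^ card S * indicator {\<xi> \<in> \<Omega>. ?g S \<xi> \<in> \<Omega>} \<xi>) = mean \<Lambda> \<xi> (indicator A)"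
    if \<xi>: "\<xi> \<in> space ?O" for \<xi>
  proof -
    have "A \<subseteq> \<Omega>" using sets.sets_into_space[OF assms(2)] by (simp add: space_indep_algebra)
    then have "(\<Sum>S\<in>Pow \<Lambda>. lam ^ card S * indicator {\<xi> \<in> \<Omega>. ?g S \<xi> \<in> A} \<xi>) =
        (\<Sum>S\<in>Pow \<Lambda>. of_bool (?g S \<xi> \<in> \<Omega>) * (lam ^ card S * indicator A (?g S \<xi>)))"
      using \<xi> by (intro sum.cong) (auto simp: indicator_def space_outside)
    moreover have "(\<Sum>S\<in>Pow \<Lambda>. lam ^ card S * indicator {\<xi> \<in> \<Omega>. ?g S \<xi> \<in> \<Omega>} \<xi>) =
        (\<Sum>S\<in>Pow \<Lambda>. of_bool (?g S \<xi> \<in> \<Omega>) * lam ^ card S)"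
      using \<xi> by (intro sum.cong) (auto simp: indicator_def space_outside)
    ultimately show ?thesis unfolding mean_eq_quotient[OF assms(1)] by simp
  qed
  ultimately show ?thesis by (simp cong: measurable_cong)
qed


definition upsets :: "'v set set set" where
  "upsets = {{I \<in> \<Omega>. F \<subseteq> I} | F. finite F}"

lemma upsets_Int_stable: "Int_stable upsets"
proof (rule Int_stableI)
  fix a b assume "a \<in> upsets" "b \<in> upsets"
  then obtain F G where "finite F" "finite G" "a = {I \<in> \<Omega>. F \<subseteq> I}" "b = {I \<in> \<Omega>. G \<subseteq> I}"
    by (auto simp: upsets_def)
  then have "finite (F \<union> G)" "a \<inter> b = {I \<in> \<Omega>. F \<union> G \<subseteq> I}" by auto
  then show "a \<inter> b \<in> upsets" unfolding upsets_def by blast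
qed

lemma top_in_upsets: "\<Omega> \<in> upsets"
  unfolding upsets_def by (auto intro!: exI[of _ "{}"])

lemma sets_indep_algebra_upsets: "sets (indep_algebra adj) = sigma_sets \<Omega> upsets"
proof
  have sub: "upsets \<subseteq> Pow \<Omega>" by (auto simp: upsets_def)
  let ?N = "sigma \<Omega> upsets"
  have "(\<lambda>I v. v \<in> I) \<in> measurable ?N (Pi\<^sub>M UNIV (\<lambda>_. count_space UNIV))"
  proof (rule measurable_PiM_single')
    fix v
    have "{I \<in> \<Omega>. {v} \<subseteq> I} \<in> upsets" unfolding upsets_def by blast
    then have "{I \<in> space ?N. v \<in> I} \<in> sets ?N" using sub by auto
    then show "(\<lambda>I. v \<in> I) \<in> measurable ?N (count_space UNIV)" by (simp add: pred_def)
  qed simp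
  then have "{(\<lambda>I v. v \<in> I) -` A \<inter> \<Omega> | A. A \<in> sets (Pi\<^sub>M UNIV (\<lambda>_. count_space (UNIV :: bool set)))} \<subseteq> sets ?N"
    using sub by (auto dest: measurable_sets)
  then have "sigma_sets \<Omega> {(\<lambda>I v. v \<in> I) -` A \<inter> \<Omega> | A. A \<in> sets (Pi\<^sub>M UNIV (\<lambda>_. count_space (UNIV :: bool set)))} \<subseteq> sets ?N"
    using sub sets.sigma_sets_subset[of _ ?N] by simp
  then show "sets (indep_algebra adj) \<subseteq> sigma_sets \<Omega> upsets"
    using sub by (simp add: indep_algebra_def sets_vimage_algebra)
  have "upsets \<subseteq> sets (indep_algebra adj)"
    by (auto simp: upsets_def intro: superset_event)
  then show "sigma_sets \<Omega> upsets \<subseteq> sets (indep_algebra adj)"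
    using sets.sigma_sets_subset[of upsets "indep_algebra adj"] by (simp add: space_indep_algebra)
qed

text \<open>
It suffices that resampling preserves the probabilities of increasing local events. These events form
an intersection-stable generator, so resampling preserves \<open>\<mu>\<close>. An event \<open>B\<close> off \<open>\<Lambda>\<close> is not
affected by resampling inside \<open>\<Lambda>\<close>; stationarity applied to \<open>A \<inter> B\<close> is thus the identity that
characterises the conditional expectation of the indicator of \<open>A\<close>.
\<close>

lemma gibbs_if_stationary:
  assumes prob: "prob_space \<mu>" and sets: "sets \<mu> = sets (indep_algebra adj)"
    and stat: "\<And>\<Lambda> F. finite \<Lambda> \<Longrightarrow> finite F \<Longrightarrow>
      (\<integral>\<^sup>+ I. ennreal (mean \<Lambda> I (indicator {I \<in> \<Omega>. F \<subseteq> I})) \<partial>\<mu>) = emeasure \<mu> {I \<in> \<Omega>. F \<subseteq> I}"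
  shows "hard_core_gibbs adj lam \<mu>"
  unfolding hard_core_gibbs_def
proof (intro conjI allI impI prob sets)
  fix \<Lambda> :: "'v set" assume \<Lambda>: "finite \<Lambda>"
  interpret prob_space \<mu> by (rule prob)
  have space: "space \<mu> = \<Omega>"
    using sets_eq_imp_space_eq[OF sets] by (simp add: space_indep_algebra)
  let ?O = "outside_algebra adj \<Lambda>"
  have subalg: "subalgebra \<mu> ?O"
    using subalgebra_outside[of adj \<Lambda>] sets space
    by (simp add: subalgebra_def space_indep_algebra)
  have ker_O: "kernel \<Lambda> \<in> measurable ?O (prob_algebra \<mu>)"
  proof (rule measurable_prob_algebraI)
    show "kernel \<Lambda> \<in> measurable ?O (subprob_algebra \<mu>)"
    proof (rule measurable_subprob_algebra)
      fix A assume "A \<in> sets \<mu>"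
      then have A: "A \<in> sets (indep_algebra adj)" by (simp add: sets)
      have "(\<lambda>I. ennreal (mean \<Lambda> I (indicator A))) \<in> borel_measurable ?O"
        using mean_measurable[OF \<Lambda> A] by simp
      moreover have "emeasure (kernel \<Lambda> I) A = ennreal (mean \<Lambda> I (indicator A))" if "I \<in> space ?O" for I
        using that by (intro emeasure_kernel[OF \<Lambda> _ A]) (simp add: space_outside)
      ultimately show "(\<lambda>I. emeasure (kernel \<Lambda> I) A) \<in> borel_measurable ?O"
        by (subst measurable_cong)
    qed (auto simp: space_outside sets sets_kernel intro: prob_space_imp_subprob_space prob_space_kernel[OF \<Lambda>])
  qed (auto simp: space_outside intro: prob_space_kernel[OF \<Lambda>])
  have ker: "kernel \<Lambda> \<in> measurable \<mu> (subprob_algebra \<mu>)"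
    using measurable_from_subalg[OF subalg measurable_prob_algebraD[OF ker_O]] .
  have bind_eq: "\<mu> \<bind> kernel \<Lambda> = \<mu>"
  proof (rule measure_eqI_generator_eq[OF upsets_Int_stable])
    show "upsets \<subseteq> Pow \<Omega>" by (auto simp: upsets_def)
    have sets_bind: "sets (\<mu> \<bind> kernel \<Lambda>) = sets \<mu>"
      using not_empty by (intro sets_bind[OF sets_kernel[folded sets]]) auto
    show "sets (\<mu> \<bind> kernel \<Lambda>) = sigma_sets \<Omega> upsets" "sets \<mu> = sigma_sets \<Omega> upsets"
      unfolding sets_bind by (simp_all add: sets sets_indep_algebra_upsets)
    have bind: "emeasure (\<mu> \<bind> kernel \<Lambda>) X = (\<integral>\<^sup>+ I. ennreal (mean \<Lambda> I (indicator X)) \<partial>\<mu>)"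
      if "X \<in> sets \<mu>" for X
      unfolding emeasure_bind[OF not_empty ker that] using that
      by (intro nn_integral_cong emeasure_kernel \<Lambda>) (simp_all add: space sets)
    show eq: "emeasure (\<mu> \<bind> kernel \<Lambda>) X = emeasure \<mu> X" if "X \<in> upsets" for X
    proof -
      obtain F where F: "finite F" "X = {I \<in> \<Omega>. F \<subseteq> I}" using \<open>X \<in> upsets\<close> by (auto simp: upsets_def)
      then show ?thesis using bind[of X] superset_event[of F adj] stat[OF \<Lambda> F(1)] by (simp add: sets)
    qed
    show "range (\<lambda>_ :: nat. \<Omega>) \<subseteq> upsets" "(\<Union>i :: nat. \<Omega>) = \<Omega>"
      using top_in_upsets by auto
    show "emeasure (\<mu> \<bind> kernel \<Lambda>) \<Omega> \<noteq> \<infinity>" for i :: nat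
      using eq[OF top_in_upsets] by simp
  qed
  have mean_meas: "(\<lambda>I. mean \<Lambda> I (indicator A)) \<in> borel_measurable \<mu>" if "A \<in> sets \<mu>" for A
    using measurable_from_subalg[OF subalg mean_measurable[OF \<Lambda>]] that by (simp add: sets)
  have mean_01: "0 \<le> mean \<Lambda> I (indicator A)" "mean \<Lambda> I (indicator A) \<le> 1" if "I \<in> \<Omega>" for I A
    using mean_bounds[OF \<Lambda> that, of "indicator A"] by auto
  have mean_integrable: "integrable \<mu> (\<lambda>I. mean \<Lambda> I (indicator A))" if "A \<in> sets \<mu>" for A
    using mean_meas[OF that] mean_01 by (intro integrable_const_bound[where B = 1]) (auto simp: space)
  have stationary: "(\<integral>I. mean \<Lambda> I (indicator A) \<partial>\<mu>) = measure \<mu> A" if A: "A \<in> sets \<mu>" for A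
  proof -
    have "emeasure \<mu> A = (\<integral>\<^sup>+ I. emeasure (kernel \<Lambda> I) A \<partial>\<mu>)"
      using emeasure_bind[OF not_empty ker A] bind_eq by simp
    also have "\<dots> = (\<integral>\<^sup>+ I. ennreal (mean \<Lambda> I (indicator A)) \<partial>\<mu>)"
      using emeasure_kernel[OF \<Lambda>] A by (intro nn_integral_cong) (auto simp: space sets)
    also have "\<dots> = ennreal (\<integral>I. mean \<Lambda> I (indicator A) \<partial>\<mu>)"
      using mean_integrable[OF A] mean_01 by (intro nn_integral_eq_integral) (auto simp: space)
    finally have "ennreal (measure \<mu> A) = ennreal (\<integral>I. mean \<Lambda> I (indicator A) \<partial>\<mu>)"
      by (simp add: emeasure_eq_measure)
    moreover have "0 \<le> (\<integral>I. mean \<Lambda> I (indicator A) \<partial>\<mu>)"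
      using mean_01 by (intro integral_nonneg_AE AE_I2) (simp add: space)
    ultimately show ?thesis by (simp add: ennreal_inj)
  qed
  have "regular_cond_prob \<mu> ?O (kernel \<Lambda>)"
    unfolding regular_cond_prob_def
  proof (intro conjI ker_O ballI)
    fix A assume A: "A \<in> sets \<mu>"
    interpret finite_measure_subalgebra \<mu> ?O by unfold_locales (rule subalg)
    have meas_eq: "measure (kernel \<Lambda> I) A = mean \<Lambda> I (indicator A)" if "I \<in> space \<mu>" for I
      using measure_kernel[OF \<Lambda>] that A by (simp add: space sets)
    have "AE I in \<mu>. real_cond_exp \<mu> ?O (indicator A) I = mean \<Lambda> I (indicator A)"
    proof (rule real_cond_exp_charact)
      fix B assume B: "B \<in> sets ?O"
      then obtain B' where B': "B = {I \<in> \<Omega>. I - \<Lambda> \<in> B'}" by (rule outside_event)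
      have B\<mu>: "B \<in> sets \<mu>" using B subalg by (auto simp: subalgebra_def)
      have "indicator B I * mean \<Lambda> I (indicator A) = mean \<Lambda> I (indicator (A \<inter> B))"
        if "I \<in> \<Omega>" for I
        unfolding wmean_def sum_distrib_left
        by (intro sum.cong) (use that in \<open>auto simp: B' hc_fibre_def indicator_def\<close>)
      then have "(\<integral>I\<in>B. mean \<Lambda> I (indicator A) \<partial>\<mu>) = (\<integral>I. mean \<Lambda> I (indicator (A \<inter> B)) \<partial>\<mu>)"
        unfolding set_lebesgue_integral_def by (intro Bochner_Integration.integral_cong) (auto simp: space)
      also have "\<dots> = measure \<mu> (A \<inter> B)" using A B\<mu> by (intro stationary) auto
      also have "\<dots> = (\<integral>I\<in>B. indicator A I \<partial>\<mu>)"
        unfolding set_lebesgue_integral_def using A B\<mu>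
        by (simp add: indicator_inter_arith[symmetric] Int_commute)
      finally show "(\<integral>I\<in>B. indicator A I \<partial>\<mu>) = (\<integral>I\<in>B. mean \<Lambda> I (indicator A) \<partial>\<mu>)" by simp
    next
      show "integrable \<mu> (indicator A :: _ \<Rightarrow> real)" using A by (simp add: emeasure_eq_measure)
      show "integrable \<mu> (\<lambda>I. mean \<Lambda> I (indicator A))" by (rule mean_integrable[OF A])
      show "(\<lambda>I. mean \<Lambda> I (indicator A)) \<in> borel_measurable ?O"
        using A by (intro mean_measurable \<Lambda>) (simp add: sets)
    qed
    then show "AE I in \<mu>. real_cond_exp \<mu> ?O (indicator A) I = measure (kernel \<Lambda> I) A"
      using AE_space by eventually_elim (simp add: meas_eq)
  qed
  moreover have "AE I in \<mu>. \<forall>J\<in>\<Omega>. measure (kernel \<Lambda> I) {J} =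
      (if I - \<Lambda> = J - \<Lambda> then lam ^ card (J \<inter> \<Lambda>) / Z \<Lambda> I else 0)"
    by (intro AE_I2 ballI kernel_singleton[OF \<Lambda>]) (simp_all add: space)
  ultimately show "\<exists>\<kappa>. regular_cond_prob \<mu> ?O \<kappa> \<and> (AE I in \<mu>. \<forall>J\<in>\<Omega>. measure (\<kappa> I) {J} =
      (if I - \<Lambda> = J - \<Lambda> then lam ^ card (J \<inter> \<Lambda>) / Z \<Lambda> I else 0))" by blast
qed

text \<open>
The limit inherits stationarity from the consistency of the finite-volume measures: for an event on
finitely many sites, the resampled probability depends only on the sites in and next to \<open>\<Lambda>\<close> and on
those of the event, so that both sides of the identity pass to the limit.
\<close>

theorem gibbs_limit:
  fixes D :: "nat \<Rightarrow> 'v set" and \<xi> :: "'v set"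
  assumes fin: "\<And>n. finite (D n)" and \<xi>: "\<xi> \<in> \<Omega>"
    and exhaust: "\<And>F. finite F \<Longrightarrow> \<forall>\<^sub>F n in sequentially. F \<subseteq> D n"
  shows "\<exists>\<mu> r. hard_core_gibbs adj lam \<mu> \<and> strict_mono r \<and> (\<forall>\<Delta> \<phi>. finite \<Delta> \<longrightarrow>
      (\<lambda>n. mean (D (r n)) \<xi> (\<lambda>K. \<phi> (K \<inter> \<Delta>))) \<longlonglongrightarrow> (\<integral>I. \<phi> (I \<inter> \<Delta>) \<partial>\<mu>))"
proof -
  let ?a = "\<lambda>n xs. mean (D n) \<xi> (\<lambda>K. of_bool (set xs \<subseteq> K))"
  have "?a n xs \<in> {0..1}" for n xs
    using mean_bounds[OF fin \<xi>, of _ "\<lambda>K. of_bool (set xs \<subseteq> K)"] by auto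
  from diagonal_convergent[of ?a, OF this] obtain r where r: "strict_mono r"
    and conv: "\<And>xs. convergent (\<lambda>k. ?a (r k) xs)" by blast
  interpret mean_sequence adj "\<lambda>n. fibre (D (r n)) \<xi>" "\<lambda>n. weight (D (r n)) \<xi>"
  proof
    fix G :: "'v set" assume "finite G"
    then obtain xs where "set xs = G" using finite_list by auto
    then show "convergent (\<lambda>n. mean (D (r n)) \<xi> (\<lambda>K. of_bool (G \<subseteq> K)))" using conv[of xs] by simp
  qed (use finite_fibre fin weight_nonneg weight_sum \<xi> fibre_subset in auto)
  interpret prob_space limit_measure by (rule prob_space_limit_measure)
  have space: "space limit_measure = \<Omega>"
    using sets_eq_imp_space_eq[OF sets_limit_measure] by (simp add: space_indep_algebra)
  have "hard_core_gibbs adj lam limit_measure"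
  proof (rule gibbs_if_stationary[OF prob_space_limit_measure sets_limit_measure])
    fix \<Lambda> F :: "'v set" assume \<Lambda>: "finite \<Lambda>" and F: "finite F"
    let ?f = "\<lambda>L. of_bool (F \<subseteq> L) :: real" and ?A = "{I \<in> \<Omega>. F \<subseteq> I}"
    let ?\<Delta> = "F \<union> ngh \<Lambda>"
    have \<Delta>: "finite ?\<Delta>" using F finite_ngh[OF \<Lambda>] by simp
    have ind: "mean \<Lambda> I (indicator ?A) = mean \<Lambda> (I \<inter> ?\<Delta>) ?f" if "I \<in> \<Omega>" for I
    proof -
      have "mean \<Lambda> I (indicator ?A) = mean \<Lambda> I ?f"
        unfolding wmean_def by (intro sum.cong) (auto simp: hc_fibre_def indicator_def)
      then show ?thesis using mean_local[OF \<Lambda> that] by simp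
    qed
    have "(\<lambda>n. mean (D (r n)) \<xi> (\<lambda>K. mean \<Lambda> (K \<inter> ?\<Delta>) ?f)) \<longlonglongrightarrow>
        (\<integral>I. mean \<Lambda> (I \<inter> ?\<Delta>) ?f \<partial>limit_measure)"
      by (rule limit_local(1)[OF \<Delta>])
    moreover have "\<forall>\<^sub>F n in sequentially. \<Lambda> \<subseteq> D (r n)"
      using exhaust[OF \<Lambda>] filterlim_subseq[OF r] by (rule eventually_compose_filterlim)
    then have "\<forall>\<^sub>F n in sequentially. mean (D (r n)) \<xi> (\<lambda>K. mean \<Lambda> (K \<inter> ?\<Delta>) ?f) = mean (D (r n)) \<xi> ?f"
    proof eventually_elim
      case (elim n)
      have "mean (D (r n)) \<xi> (\<lambda>K. mean \<Lambda> (K \<inter> ?\<Delta>) ?f) = mean (D (r n)) \<xi> (\<lambda>K. mean \<Lambda> K ?f)"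
        unfolding wmean_def[of "fibre (D (r n)) \<xi>"]
        using mean_local[OF \<Lambda>] by (intro sum.cong) (auto simp: hc_fibre_def)
      then show ?case using mean_consistent[OF elim fin \<xi>] by simp
    qed
    ultimately have "(\<lambda>n. mean (D (r n)) \<xi> ?f) \<longlonglongrightarrow> (\<integral>I. mean \<Lambda> (I \<inter> ?\<Delta>) ?f \<partial>limit_measure)"
      by (rule Lim_transform_eventually)
    with limit_measure_superset[OF F]
    have "measure limit_measure ?A = (\<integral>I. mean \<Lambda> (I \<inter> ?\<Delta>) ?f \<partial>limit_measure)"
      by (rule LIMSEQ_unique)
    moreover have "(\<integral>\<^sup>+ I. ennreal (mean \<Lambda> I (indicator ?A)) \<partial>limit_measure) =
        (\<integral>\<^sup>+ I. ennreal (mean \<Lambda> (I \<inter> ?\<Delta>) ?f) \<partial>limit_measure)"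
      using ind by (intro nn_integral_cong) (simp add: space)
    moreover have "\<dots> = ennreal (\<integral>I. mean \<Lambda> (I \<inter> ?\<Delta>) ?f \<partial>limit_measure)"
      by (intro nn_integral_eq_integral limit_local(2)[OF \<Delta>] AE_I2 mean_bounds(1)[OF \<Lambda>])
         (auto simp: space intro: indep_subset)
    ultimately show "(\<integral>\<^sup>+ I. ennreal (mean \<Lambda> I (indicator ?A)) \<partial>limit_measure) = emeasure limit_measure ?A"
      by (simp add: emeasure_eq_measure)
  qed
  then show ?thesis using r limit_local(1) by blast
qed

end

section \<open>Turn words of contours\<close>

text \<open>
A contour turns by a right angle at each step. Its word of turns (\<open>True\<close> for left) is encoded by the
first turn and one letter per later turn, telling whether that turn has the same sense as the one
before. A reflection of the contour changes only the first turn.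
\<close>

fun turn_word :: "bool \<Rightarrow> bool list \<Rightarrow> bool list" where
  "turn_word b [] = [b]"
| "turn_word b (c # r) = b # turn_word (if c then b else \<not> b) r"

text \<open>
A bond that leaves a hole is given by its inner site and its direction. The result is the bond
reached by a sequence of turns, in coordinates where the first bond has inner site \<open>0\<close> and direction
\<open>1\<close> in the Gaussian integers. A left turn keeps the inner site and multiplies the direction by the
imaginary unit \<open>i\<close>, a right turn leads to inner site \<open>1 + i\<close> and direction \<open>- i\<close>. Reading the word
from the front, the remaining turns are performed in the frame of the bond reached by the first.
\<close>

fun turtle :: "bool list \<Rightarrow> (int \<times> int) \<times> (int \<times> int)" where
  "turtle [] = ((0, 0), (1, 0))"
| "turtle (b # w) = (case turtle w of ((x, y), (p, q)) \<Rightarrow>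
     if b then ((- y, x), (- q, p)) else ((1 + y, 1 - x), (q, - p)))"

text \<open>
The contour turns inside a unit square. The turn determines which of the four corners of the
square lie in the hole: the inner site of the bond does, its outer site does not, and the two
corners ahead do if and only if the turn is to the right.
\<close>

fun corners :: "bool \<Rightarrow> (int \<times> int) \<times> (int \<times> int) \<Rightarrow> ((int \<times> int) \<times> bool) list" where
  "corners b ((x, y), (p, q)) =
     [((x, y), True), ((x + p, y + q), False), ((x - q, y + p), \<not> b), ((x + p - q, y + q + p), \<not> b)]"

text \<open>
Either the contour has closed up, or the first and the last turn of the word disagree about whether
some site belongs to the hole. This sees collisions of the contour with itself, and also some
dead ends from which it could not return.
\<close>

definition impossible :: "bool list \<Rightarrow> bool" where
  "impossible w \<longleftrightarrow> turtle w = ((0, 0), (1, 0)) \<or>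
     (\<exists>(p, s) \<in> set (corners (hd w) ((0, 0), (1, 0))).
      \<exists>(q, t) \<in> set (corners (last w) (turtle (butlast w))). p = q \<and> s \<noteq> t)"

text \<open>
Demanding impossibility for both senses of the first turn spares a proof that \<open>impossible\<close> is
invariant under reflection.
\<close>

definition excluded :: "bool list \<Rightarrow> bool" where
  "excluded r \<longleftrightarrow> impossible (turn_word True r) \<and> impossible (turn_word False r)"

definition admissible :: "bool list \<Rightarrow> bool" where
  "admissible r \<longleftrightarrow> (\<forall>a b c. r = a @ b @ c \<longrightarrow> \<not> excluded b)"

definition continuations :: "bool list \<Rightarrow> nat \<Rightarrow> nat" where
  "continuations p n = card {q. length q = n \<and> admissible (p @ q)}"

lemma finite_continuations: "finite {q :: bool list. length q = n \<and> P q}"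
  by (rule finite_subset[OF _ finite_lists_length_eq[of UNIV n]]) auto

lemma admissible_factor: "admissible (a @ b @ c) \<Longrightarrow> admissible b"
  unfolding admissible_def by (metis append.assoc)

lemma continuations_append_le: "continuations (a @ p) n \<le> continuations p n"
  unfolding continuations_def
  by (rule card_mono[OF finite_continuations])
     (auto dest: admissible_factor[of a _ "[]", simplified])

lemma continuations_drop_le: "continuations p n \<le> continuations (drop k p) n"
  using continuations_append_le[of "take k p" "drop k p" n] by simp

lemma continuations_excluded: "excluded p \<Longrightarrow> continuations p n = 0"
  by (auto simp: continuations_def admissible_def card_eq_0_iff) (metis append_Nil)

lemma continuations_0: "continuations p 0 \<le> 1"
proof -
  have "{q. length q = 0 \<and> admissible (p @ q)} \<subseteq> {[]}" by auto
  then show ?thesis unfolding continuations_def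
    using card_mono by (metis card.empty card_insert_disjoint empty_iff finite.emptyI finite_insert One_nat_def)
qed

lemma continuations_Suc:
  "continuations p (Suc n) \<le> continuations (p @ [False]) n + continuations (p @ [True]) n"
proof -
  let ?A = "\<lambda>c. {q. length q = n \<and> admissible ((p @ [c]) @ q)}"
  have "{q. length q = Suc n \<and> admissible (p @ q)} \<subseteq> (#) False ` ?A False \<union> (#) True ` ?A True"
  proof
    fix q assume q: "q \<in> {q. length q = Suc n \<and> admissible (p @ q)}"
    then obtain c q' where "q = c # q'" by (cases q) auto
    with q show "q \<in> (#) False ` ?A False \<union> (#) True ` ?A True" by (cases c) auto
  qed
  then have "continuations p (Suc n) \<le> card ((#) False ` ?A False \<union> (#) True ` ?A True)"
    unfolding continuations_def by (intro card_mono) (auto intro: finite_continuations)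
  also have "\<dots> \<le> card ((#) False ` ?A False) + card ((#) True ` ?A True)" by (rule card_Un_le)
  also have "\<dots> \<le> continuations (p @ [False]) n + continuations (p @ [True]) n"
    unfolding continuations_def by (intro add_mono card_image_le finite_continuations)
  finally show ?thesis .
qed

text \<open>
An automaton whose states are words, namely the paths from the root to the nodes \<open>N\<close>, the oldest
letter being nearest to the root. A node carries a weight and the subtries for the letters \<open>False\<close>
and \<open>True\<close>. The leaf \<open>X\<close> marks an excluded word. The leaf \<open>J k\<close> makes the automaton forget the
oldest \<open>k\<close> letters; this can only increase the number of continuations. The short names keep the
table below readable.
\<close>

datatype suffix_trie = X | J nat | N int suffix_trie suffix_trie

text \<open>
A path that leaves the trie yields a jump, which \<open>supersolution\<close> rejects as a target of another jump.
\<close>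

fun subtrie :: "suffix_trie \<Rightarrow> bool list \<Rightarrow> suffix_trie" where
  "subtrie t [] = t"
| "subtrie (N w l r) (c # p) = subtrie (if c then r else l) p"
| "subtrie X (c # p) = J 0"
| "subtrie (J n) (c # p) = J 0"

fun weight :: "suffix_trie \<Rightarrow> int" where
  "weight (N w l r) = w"
| "weight X = 0"
| "weight (J k) = 0"

fun bound_at :: "suffix_trie \<Rightarrow> bool list \<Rightarrow> suffix_trie \<Rightarrow> int" where
  "bound_at tr p (N w l r) = w"
| "bound_at tr p X = 0"
| "bound_at tr p (J k) = weight (subtrie tr (drop k p))"

fun is_jump :: "suffix_trie \<Rightarrow> bool" where
  "is_jump (N w l r) = False"
| "is_jump X = False"
| "is_jump (J k) = True"

text \<open>
The weights are eigenvector-like: the sum over the two successors of a state is at most \<open>1.58746\<close>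
times the weight of the state. By induction on the length the weights then dominate the number of
continuations.
\<close>

fun supersolution :: "suffix_trie \<Rightarrow> bool list \<Rightarrow> suffix_trie \<Rightarrow> bool" where
  "supersolution tr p X \<longleftrightarrow> excluded p"
| "supersolution tr p (J k) \<longleftrightarrow> \<not> is_jump (subtrie tr (drop k p))"
| "supersolution tr p (N w l r) \<longleftrightarrow>
     1 \<le> w \<and> 100000 * (bound_at tr (p @ [False]) l + bound_at tr (p @ [True]) r) \<le> 158746 * w \<and>
     supersolution tr (p @ [False]) l \<and> supersolution tr (p @ [True]) r"

lemma supersolution_subtrie:
  "supersolution tr p t \<Longrightarrow> \<not> is_jump (subtrie t q) \<Longrightarrow> supersolution tr (p @ q) (subtrie t q)"
proof (induction t q arbitrary: p rule: subtrie.induct)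
  case (2 w l r c q)
  from 2(1)[of "p @ [c]"] 2(2,3) show ?case by (cases c) auto
qed auto

lemma continuations_le_weight:
  assumes sup: "supersolution tr [] tr" and "\<not> is_jump (subtrie tr p)"
  shows "real (continuations p n) \<le> real_of_int (weight (subtrie tr p)) * 1.58746 ^ n"
  using assms(2)
proof (induction n arbitrary: p)
  case 0
  note ss = supersolution_subtrie[OF sup 0, simplified]
  show ?case
    using ss continuations_0[of p] continuations_excluded[of p 0] by (cases "subtrie tr p") (use 0 in auto)
next
  case (Suc n)
  note ss = supersolution_subtrie[OF sup Suc.prems, simplified]
  show ?case
  proof (cases "subtrie tr p")
    case X
    then show ?thesis using ss continuations_excluded[of p "Suc n"] by auto
  next
    case (J k)
    then show ?thesis using Suc.prems by simp
  next
    case (N w l r)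
    have child: "subtrie tr (p @ [c]) = (if c then r else l)" for c
    proof -
      have "subtrie t (q @ [c]) = (if c then r else l)" if "subtrie t q = N w l r" for t q
        using that by (induction t q rule: subtrie.induct) auto
      then show ?thesis using N .
    qed
    \<comment> \<open>A child that is a node or excluded is itself a path of the trie; a jump is compared with its target.\<close>
    have step: "real (continuations (p @ [c]) n)
        \<le> real_of_int (bound_at tr (p @ [c]) t) * 1.58746 ^ n"
      if t: "t = (if c then r else l)" and st: "supersolution tr (p @ [c]) t" for c t
    proof (cases t)
      case (J k)
      have "real (continuations (p @ [c]) n) \<le> real (continuations (drop k (p @ [c])) n)"
        using continuations_drop_le of_nat_le_iff by blast
      also have "\<dots> \<le> real_of_int (weight (subtrie tr (drop k (p @ [c])))) * 1.58746 ^ n"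
        using st J by (intro Suc.IH) simp
      finally show ?thesis using J by simp
    qed (use Suc.IH[of "p @ [c]"] child[of c] t in auto)
    have ss': "supersolution tr p (N w l r)" using ss N by simp
    have "real (continuations p (Suc n))
        \<le> real (continuations (p @ [False]) n) + real (continuations (p @ [True]) n)"
      using continuations_Suc[of p n] by linarith
    also have "\<dots> \<le> real_of_int (bound_at tr (p @ [False]) l) * 1.58746 ^ n
        + real_of_int (bound_at tr (p @ [True]) r) * 1.58746 ^ n"
      using ss' step[of l False] step[of r True] by (intro add_mono) auto
    also have "\<dots> = real_of_int (bound_at tr (p @ [False]) l + bound_at tr (p @ [True]) r) * 1.58746 ^ n"
      by (simp add: algebra_simps)
    also have "\<dots> \<le> (1.58746 * real_of_int w) * 1.58746 ^ n"
    proof (rule mult_right_mono)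
      have "100000 * (bound_at tr (p @ [False]) l + bound_at tr (p @ [True]) r) \<le> 158746 * w"
        using ss' by simp
      then have "real_of_int (100000 * (bound_at tr (p @ [False]) l + bound_at tr (p @ [True]) r))
          \<le> real_of_int (158746 * w)" by (rule of_int_le_iff[THEN iffD2])
      then show "real_of_int (bound_at tr (p @ [False]) l + bound_at tr (p @ [True]) r)
          \<le> 1.58746 * real_of_int w" by simp
    qed simp
    finally show ?thesis using N by (simp add: algebra_simps)
  qed
qed

section \<open>An automaton for turn words\<close>

text \<open>
The states are prefixes of a selection of excluded words of at most 22 letters. The
weights approximate the positive eigenvector of the transition matrix, whose eigenvalue is about
\<open>1.5874\<close>, scaled to \<open>100000\<close> at the empty word and rounded to integers that satisfy the inequalities.
\<close>

definition contour_trie :: suffix_trie where "contour_trie =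
  N 100000 (N 98571 (N 96353 (N 95621 (N 94613 (N 94333 (N 94029 (N 93863 (J 1) (N 55134 (N 87520
  (N 80083 (N 90036 (N 85992 (J 2) (N 44124 (N 70042 (N 53384 (N 73904 (N 60385 (N 81558 (N 73750
  (J 12) (N 23353 (N 37070 X (J 14)) (J 19))) (J 13)) (N 14299 (N 22697 (J 3) (N 35972 (N 57101 (J
  13) X) (J 19))) (J 17))) (J 9)) (N 10839 (N 17204 (J 5) (N 27307 (N 43347 (N 68322 (N 57994 (J
  13) X) (J 13)) (J 3)) (J 17))) (J 15))) (J 2)) (J 12))) (J 4)) (N 37087 (N 58872 (N 38560 (N
  61210 (J 1) (N 54398 (N 86351 (J 8) (N 52247 (N 82937 (N 73663 (J 11) (N 23242 (N 36894 X (J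
  12)) (J 19))) (J 11)) (J 16))) (J 14))) (J 5)) (N 54893 (N 87138 (J 5) (N 48007 (N 76206 (N
  62046 (N 82266 (N 73666 (J 14) (N 23260 (N 36922 X (J 14)) (J 19))) (J 12)) (N 16227 (N 25758 (J
  3) (N 35987 (N 57125 (J 14) X) (J 19))) (J 17))) (J 10)) (J 14))) (J 12))) (J 10))) (J 2)) (J
  7))) (N 55397 (N 87937 (N 80746 (J 1) (N 37623 (N 59722 (N 39021 (N 61942 (N 42767 (N 67888 (N
  52049 (N 82623 (N 76021 (J 12) (N 26812 (N 42561 (N 8716 X (J 2)) (J 13)) (J 18))) (J 10)) (N 2
  (N 2 (J 2) X) (J 16))) (J 10)) (J 2)) (J 2)) (J 4)) (J 2)) (J 9))) (J 1)) (J 6))) (N 55715 (N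
  88442 (N 81547 (N 90553 (N 86812 (N 92379 (N 90927 (J 5) (N 50619 (N 80353 (N 68707 (N 85856 (N
  79358 (J 7) (N 33593 (N 53325 (N 26848 (N 35864 X (J 14)) (J 5)) (J 7)) (J 17))) (J 9)) (N 23209
  (N 36841 (N 13361 (N 21208 (J 3) (N 33663 (N 53437 (J 13) X) (J 19))) (J 10)) (N 45121 (N 71626
  (J 10) (N 23384 (N 37119 X (J 15)) (J 19))) (J 17))) (J 15))) (J 7)) (J 12))) (J 6)) (N 45426 (N
  72109 (J 1) (N 57800 (N 91752 (J 6) (N 55004 (N 87313 (N 79678 (J 7) (N 33490 (N 53161 (N 26727
  (N 35750 X (J 12)) (J 5)) (J 7)) (J 17))) (J 10)) (J 14))) (J 12))) (J 10))) (J 2)) (J 1)) (N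
  58845 (N 93411 (J 1) (N 57637 (N 91492 (N 86311 (J 2) (N 44019 (N 69876 (N 53259 (N 73783 (N
  60372 (N 81558 (N 73750 (J 12) (N 23353 (N 37070 X (J 14)) (J 19))) (J 13)) (N 14276 (N 22661 (J
  2) (N 35972 (N 57101 (J 13) X) (J 19))) (J 17))) (J 7)) (N 10762 (N 17082 (J 9) (N 27114 (N
  43040 (N 68322 (N 57994 (J 13) X) (J 13)) (J 3)) (J 17))) (J 15))) (J 2)) (J 12))) (J 5)) (J
  9))) (J 7))) (J 5))) (N 55854 (N 88662 (N 81756 (N 90885 (N 87340 (J 2) (N 45747 (N 72619 (N
  56664 (N 77442 (N 66002 (N 86052 (N 80883 (J 9) (N 34675 (N 55043 (N 28531 (N 41826 (N 9464 X (J
  2)) (J 13)) (J 2)) (J 11)) (J 16))) (J 10)) (N 18720 (N 29716 (N 58 (N 11 (J 2) X) (J 4)) (N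
  47114 (N 74789 (J 10) (N 28077 (N 44570 (N 11826 X (J 2)) (J 14)) (J 18))) (J 16))) (J 14))) (J
  6)) (N 12508 (N 19854 (J 2) (N 31514 (N 50025 (N 78923 (N 74822 (J 10) (N 26713 (N 42404 (N 8444
  X (J 2)) (J 14)) (J 18))) (J 10)) (N 488 (N 773 (J 2) X) (J 16))) (J 14))) (J 12))) (J 4)) (J
  9))) (J 1)) (N 38894 (N 61740 (N 42225 (N 67027 (N 50838 (N 80701 (N 72388 (N 91556 (N 90201 (J
  10) (N 49321 (N 78292 (N 65435 (J 9) (N 13836 (N 21963 (J 7) X) (J 19))) (J 11)) (J 16))) (J 8))
  (N 23353 (N 37070 (N 2 X (J 2)) (J 9)) (J 14))) (J 8)) (N 2 (N 2 (J 2) X) (J 12))) (N 55560 (N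
  88195 (J 5) (N 55175 (N 87585 (N 81042 (J 8) (N 34954 (N 55487 (N 29514 (N 41376 (N 8930 X (J
  2)) (J 11)) (J 2)) (J 9)) (J 16))) (J 8)) (J 13))) (J 11))) (J 2)) (N 55781 (N 88547 (J 2) (N
  50244 (N 79758 (N 67684 (N 86767 (N 80811 (J 11) (N 34602 (N 54927 (N 28581 (N 41354 (N 8716 X
  (J 2)) (J 13)) (J 2)) (J 11)) (J 16))) (J 9)) (N 20674 (N 32818 (N 4902 (N 7778 (J 2) X) (J 4))
  (N 47195 (N 74918 (J 11) (N 28244 (N 44834 (N 12246 X (J 2)) (J 14)) (J 18))) (J 16))) (J 14)))
  (J 7)) (J 11))) (J 9))) (J 7))) (N 58985 (N 93633 (N 90642 (J 1) (N 50194 (N 79678 (N 67914 (N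
  87234 (N 81724 (J 2) (N 38659 (N 61367 (N 40666 (N 64553 (N 45540 (N 72291 (N 59038 (J 14) X) (J
  15)) (J 2)) (J 11)) (J 6)) (J 2)) (J 14))) (J 4)) (N 20574 (N 32658 (J 6) (N 51840 (N 82291 (J
  2) (N 41643 (N 66104 (N 46009 (N 73035 (N 59012 (J 16) X) (J 14)) (J 3)) (J 12)) (J 16))) (J
  14))) (J 12))) (J 2)) (J 9))) (J 1)) (J 6))) (J 4))) (N 57176 (N 90761 (N 85021 (N 92033 (J 1)
  (N 56930 (N 90370 (J 1) (N 58627 (N 93065 (N 89741 (J 4) (N 48763 (N 77407 (N 64310 (N 84387 (N
  77205 (J 5) (N 31487 (N 49982 (N 22594 (N 35864 X (J 14)) (J 9)) (J 5)) (J 17))) (J 7)) (N 17698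
  (N 28093 (J 9) (N 44594 (N 70788 (J 5) (N 23384 (N 37119 X (J 15)) (J 19))) (J 17))) (J 15))) (J
  5)) (J 12))) (J 4)) (J 9))) (J 7))) (J 1)) (N 59052 (N 93738 (N 90810 (N 93691 (J 1) (N 56665 (N
  89950 (N 83916 (J 6) (N 41175 (N 65361 (N 46364 (N 73598 (N 60372 (N 81558 (N 73750 (J 12) (N
  23353 (N 37070 X (J 14)) (J 19))) (J 13)) (N 14277 (N 22662 (J 7) (N 35972 (N 57101 (J 13) X) (J
  19))) (J 17))) (J 7)) (J 7)) (J 7)) (J 12))) (J 5)) (J 9))) (J 1)) (N 57989 (N 92052 (N 87200 (N
  92990 (N 90689 (J 7) (N 50282 (N 79818 (N 68091 (N 84879 (N 77807 (J 7) (N 31506 (N 50012 (N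
  22643 (N 35864 X (J 14)) (J 7)) (J 5)) (J 17))) (J 9)) (N 23209 (N 36841 (N 13361 (N 21207 (J 7)
  (N 33663 (N 53437 (J 13) X) (J 19))) (J 10)) (N 45121 (N 71626 (J 10) (N 23384 (N 37119 X (J
  15)) (J 19))) (J 17))) (J 15))) (J 7)) (J 12))) (J 5)) (N 45431 (N 72116 (N 56816 (N 77760 (N
  66685 (J 1) (N 19598 (N 31110 X (J 1)) (J 15))) (J 5)) (J 1)) (N 57661 (N 91531 (J 7) (N 54615
  (N 86695 (N 78696 (J 7) (N 32234 (N 51168 (N 22523 (N 35750 X (J 12)) (J 7)) (J 13)) (J 17))) (J
  10)) (J 14))) (J 12))) (J 10))) (J 3)) (J 7))) (J 5))) (J 3))) (N 57328 (N 91003 (N 85059 (N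
  92094 (N 89163 (N 92895 (N 91746 (J 2) (N 51919 (N 82415 (N 71980 (N 87590 (N 82110 (J 4) (N
  37961 (N 60260 (N 37856 (N 53339 (N 27742 (N 39592 (N 7133 X (J 2)) (J 15)) (J 2)) (J 11)) (J
  2)) (J 4)) (J 14))) (J 6)) (N 26671 (N 42337 (N 17447 (N 27693 (N 3 (N 2 (J 2) X) (J 5)) (N
  43958 (N 69779 (J 10) (N 25941 (N 41179 (N 7379 X (J 2)) (J 13)) (J 18))) (J 16))) (J 7)) (N
  49760 (N 78989 (J 7) (N 35072 (N 55673 (N 29453 (N 40360 (N 7146 X (J 2)) (J 14)) (J 2)) (J 12))
  (J 16))) (J 14))) (J 12))) (J 4)) (J 9))) (J 3)) (N 48641 (N 77213 (N 63957 (N 83897 (N 76248 (N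
  89689 (N 86657 (J 7) (N 43840 (N 69592 (N 51625 (N 78487 (N 67660 (J 9) (N 15023 (N 23847 (J 5)
  X) (J 19))) (J 11)) (N 3465 (N 5499 (J 2) (N 4640 (N 7364 X (J 2)) (J 19))) (J 17))) (J 9)) (J
  14))) (J 8)) (N 31346 (N 49759 (N 22649 (N 35873 (N 16 X (J 2)) (J 9)) (J 2)) (N 56340 (N 89434
  (J 8) (N 51325 (N 81473 (N 70407 (J 9) (N 18773 (N 29800 (J 7) X) (J 19))) (J 12)) (J 16))) (J
  14))) (J 12))) (J 4)) (N 17629 (N 27983 (N 3 (N 2 (J 2) X) (J 5)) (N 44418 (N 70508 (N 88055 (N
  89317 (J 8) (N 49722 (N 78928 (N 66421 (J 13) (N 13404 (N 21276 (J 5) X) (J 19))) (J 12)) (J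
  16))) (J 8)) (N 23870 (N 37891 (N 1226 X (J 2)) (J 10)) (J 14))) (J 12))) (J 10))) (J 2)) (J
  7))) (N 57025 (N 90522 (N 84825 (J 3) (N 42617 (N 67651 (N 49999 (N 79368 (N 69531 (N 88754 (N
  85172 (J 9) (N 41484 (N 65852 (N 45688 (N 72525 (N 58196 (J 11) X) (J 13)) (J 4)) (J 11)) (J
  16))) (J 10)) (N 21620 (N 34319 (J 4) (N 54478 (N 86478 (J 10) (N 46631 (N 74023 (N 58580 (J 11)
  X) (J 14)) (J 18))) (J 16))) (J 14))) (J 4)) (J 4)) (J 4)) (J 9))) (J 2)) (J 6))) (N 42928 (N
  68145 (N 50782 (N 80612 (N 71506 (N 90249 (N 87545 (J 5) (N 45251 (N 71831 (N 55179 (J 3) (N 2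
  (N 2 (J 2) X) (J 15))) (J 7)) (J 12))) (J 6)) (N 23260 (N 36923 (N 2 X (J 2)) (J 5)) (J 10))) (N
  56456 (N 89618 (J 3) (N 57434 (N 91171 (N 86734 (J 6) (N 43990 (N 69829 (N 52281 (N 77517 (N
  66299 (J 7) (N 14175 (N 22500 (J 5) X) (J 19))) (J 9)) (N 5476 (N 8691 (J 11) (N 13794 (N 21895
  X (J 5)) (J 19))) (J 17))) (J 7)) (J 14))) (J 6)) (J 11))) (J 9))) (N 2 (N 2 (J 2) X) (J 8))) (N
  57390 (N 91100 (N 90314 (N 92904 (J 3) (N 55416 (N 87967 (N 80769 (J 8) (N 36178 (N 57430 (N
  33774 (N 53612 (N 28648 (N 40151 (N 8021 X (J 2)) (J 15)) (J 2)) (J 9)) (J 9)) (J 9)) (J 14)))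
  (J 7)) (J 11))) (J 3)) (N 54297 (N 86191 (N 77896 (N 90389 (N 86561 (J 9) (N 43730 (N 69417 (N
  51581 (N 77866 (N 66674 (J 9) (N 13835 (N 21961 (J 5) X) (J 19))) (J 11)) (N 4016 (N 6374 (J 2)
  (N 5114 (N 8117 X (J 2)) (J 19))) (J 17))) (J 9)) (J 14))) (J 7)) (N 33261 (N 52799 (N 27422 (N
  43528 (N 12346 X (J 1)) (J 7)) (J 2)) (N 56392 (N 89516 (J 9) (N 51416 (N 81618 (N 70636 (J 9)
  (N 19440 (N 30859 (J 8) X) (J 19))) (J 12)) (J 16))) (J 14))) (J 12))) (J 5)) (J 9))) (J 7))) (J
  5))) (N 59398 (N 94288 (N 90912 (N 93853 (N 92059 (J 4) (N 52458 (N 83271 (N 73573 (N 87726 (N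
  82326 (J 4) (N 38680 (N 61401 (N 40720 (N 64561 (N 45554 (N 72291 (N 59038 (J 14) X) (J 15)) (J
  4)) (J 11)) (J 4)) (J 2)) (J 14))) (J 6)) (N 29063 (N 46134 (N 20674 (N 32816 (J 4) (N 52092 (N
  82690 (J 10) (N 46436 (N 73713 (N 59022 (J 13) X) (J 13)) (J 18))) (J 16))) (J 7)) (N 52561 (N
  83434 (J 7) (N 42129 (N 66875 (N 47234 (N 73035 (N 59012 (J 16) X) (J 14)) (J 4)) (J 12)) (J
  16))) (J 14))) (J 12))) (J 4)) (J 9))) (J 2)) (N 50460 (N 80100 (N 68585 (N 87919 (N 82811 (N
  91069 (N 88846 (J 7) (N 47316 (N 75110 (N 60383 (N 81628 (N 72646 (J 9) (N 22938 (N 36412 X (J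
  9)) (J 19))) (J 11)) (N 14225 (N 22580 (J 4) (N 35841 (N 56895 (J 12) X) (J 19))) (J 17))) (J
  9)) (J 14))) (J 8)) (N 40385 (N 64107 (N 45015 (N 71457 (N 56501 (J 5) X) (J 9)) (J 4)) (N 56748
  (N 90082 (J 8) (N 52352 (N 83104 (N 72996 (J 9) (N 22883 (N 36324 X (J 9)) (J 19))) (J 12)) (J
  16))) (J 14))) (J 12))) (J 2)) (N 20952 (N 33259 (J 4) (N 52795 (N 83807 (N 88984 (N 90793 (J 8)
  (N 52065 (N 82648 (N 72325 (J 13) (N 22775 (N 36153 X (J 14)) (J 19))) (J 12)) (J 16))) (J 8))
  (J 1)) (J 12))) (J 10))) (N 58565 (N 92967 (J 4) (N 56894 (N 90313 (N 84440 (J 4) (N 41351 (N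
  65641 (N 45495 (N 72217 (N 57887 (N 72291 (N 59038 (J 14) X) (J 15)) (J 3)) (J 9)) (J 4)) (J
  10)) (J 14))) (J 7)) (J 11))) (J 9))) (J 7))) (N 58760 (N 93276 (N 89143 (J 2) (N 47925 (N 76076
  (N 62060 (N 86084 (N 79898 (N 86256 (N 81207 (J 9) (N 35190 (N 55861 (N 29829 (N 41826 (N 9464 X
  (J 2)) (J 13)) (J 2)) (J 11)) (J 16))) (J 10)) (N 40573 (N 64406 (J 6) (N 49385 (N 78393 (J 10)
  (N 33798 (N 53651 (N 26242 X (J 9)) (J 14)) (J 18))) (J 16))) (J 14))) (J 4)) (N 12431 (N 19732
  (J 6) (N 31321 (N 49719 (N 78923 (N 74822 (J 10) (N 26713 (N 42404 (N 8444 X (J 2)) (J 14)) (J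
  18))) (J 10)) (N 2 (N 2 (J 2) X) (J 16))) (J 14))) (J 12))) (J 5)) (J 9))) (J 2)) (J 6))) (J
  4))) (J 2))) (N 60117 (N 95430 (N 91697 (J 1) (N 51402 (N 81595 (J 1) (N 58703 (N 93185 (J 1) (N
  57240 (N 90863 (N 85312 (J 1) (N 42737 (N 67840 (N 48986 (N 77760 (N 66685 (J 2) (N 19598 (N
  31110 X (J 2)) (J 16))) (J 6)) (J 1)) (J 7)) (J 11))) (J 4)) (J 8))) (J 6))) (J 4))) (N 59788 (N
  94907 (N 91393 (J 1) (N 51062 (N 81056 (N 69964 (J 1) (N 21162 (N 33592 (J 3) (N 53323 (N 84645
  (J 4) (N 44050 (N 69925 (N 52075 (N 82664 (N 74298 (J 13) (N 24263 (N 38515 (N 2530 X (J 4)) (J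
  13)) (J 18))) (J 11)) (N 2 (N 2 (J 3) X) (J 16))) (J 9)) (J 13))) (J 11))) (J 9))) (J 2)) (J
  6))) (J 1)) (J 3))) (J 1))) (N 60167 (N 95510 (N 91749 (N 94158 (N 92362 (N 93676 (N 92986 (N
  93717 (N 93632 (J 3) (N 54768 (N 86938 (N 79159 (J 2) (N 35621 (N 56544 (N 34864 (N 55343 (N
  33455 (N 53105 (N 28584 (N 45373 (N 16890 X (J 3)) (J 13)) (J 3)) (J 13)) (J 5)) (J 2)) (J 7))
  (J 2)) (J 12))) (J 4)) (J 9))) (J 1)) (N 53887 (N 85540 (N 76941 (N 89055 (N 84435 (J 2) (N
  41651 (N 66117 (N 47154 (N 68099 (N 51170 (N 76784 (N 66171 (J 12) (N 11323 (N 17973 (J 3) X) (J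
  19))) (J 13)) (N 4446 (N 7056 (J 3) (N 11143 (N 17687 X (J 3)) (J 19))) (J 17))) (J 9)) (N 6755
  (N 10721 (J 5) (N 17016 (N 27010 (N 42389 (N 16828 X (J 3)) (J 13)) (J 3)) (J 17))) (J 15))) (J
  2)) (J 12))) (J 4)) (N 33081 (N 52512 (N 29909 (N 47477 (N 22112 (N 35099 (N 2 X (J 1)) (J 11))
  (J 3)) (N 53254 (N 84535 (J 8) (N 49365 (N 78361 (N 66400 (J 11) (N 11713 (N 18592 (J 3) X) (J
  19))) (J 11)) (J 16))) (J 14))) (J 5)) (N 53448 (N 84844 (J 5) (N 44366 (N 70427 (N 52872 (N
  77536 (N 66158 (J 14) (N 11343 (N 18005 (J 3) X) (J 19))) (J 12)) (N 6394 (N 10149 (J 3) (N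
  11209 (N 17792 X (J 3)) (J 19))) (J 17))) (J 10)) (J 14))) (J 12))) (J 10))) (J 2)) (J 7))) (J
  1)) (N 52938 (N 84034 (N 74784 (N 88562 (N 83652 (N 92004 (N 90331 (J 5) (N 49672 (N 78850 (N
  66320 (J 3) (N 17687 (N 28076 (N 4089 (N 6488 (J 3) (N 10296 (N 16342 X (J 3)) (J 19))) (J 10))
  (N 40480 (N 64258 (J 10) (N 11689 (N 18554 (J 3) X) (J 19))) (J 17))) (J 15))) (J 7)) (J 12)))
  (J 6)) (N 40785 (N 64742 (N 44160 (N 70022 (N 54223 (J 1) (N 24 (N 37 (J 1) X) (J 15))) (J 7))
  (N 80 (N 125 (J 3) (N 195 (N 308 X (J 1)) (J 15))) (J 13))) (J 5)) (J 10))) (J 2)) (N 30150 (N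
  47860 (N 22050 (N 35001 (N 2 X (J 1)) (J 1)) (J 3)) (N 53923 (N 85597 (J 3) (N 45562 (N 72325 (N
  55885 (J 1) (N 1946 (N 3088 (J 1) X) (J 15))) (J 8)) (J 12))) (J 10))) (J 8))) (N 58611 (N 93038
  (J 1) (N 57046 (N 90554 (N 84822 (J 2) (N 41656 (N 66125 (N 47305 (N 68416 (N 51853 (N 76989 (N
  66496 (J 12) (N 11838 (N 18791 (J 3) X) (J 19))) (J 13)) (N 5324 (N 8450 (J 2) (N 13413 (N 21291
  X (J 3)) (J 19))) (J 17))) (J 7)) (N 6678 (N 10599 (J 9) (N 16823 (N 26704 (N 42389 (N 16828 X
  (J 3)) (J 13)) (J 3)) (J 17))) (J 15))) (J 2)) (J 12))) (J 5)) (J 9))) (J 7))) (J 5))) (N 57103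
  (N 90645 (J 1) (N 58869 (N 93448 (N 90349 (J 1) (N 49728 (N 78938 (N 66740 (N 86454 (N 80487 (J
  2) (N 36695 (N 58250 (N 35717 (N 56697 (N 33071 (N 52497 (N 27618 X (J 7)) (J 15)) (J 2)) (J
  11)) (J 6)) (J 2)) (J 14))) (J 4)) (N 19489 (N 30936 (J 6) (N 49107 (N 77952 (J 2) (N 34756 (N
  55171 (N 28656 (N 45488 (N 15285 X (J 3)) (J 14)) (J 3)) (J 12)) (J 16))) (J 14))) (J 12))) (J
  2)) (J 9))) (J 1)) (J 6))) (J 4))) (N 51484 (N 81725 (N 70820 (N 90072 (N 85954 (N 92208 (N
  90655 (J 3) (N 50188 (N 79668 (N 67619 (J 1) (N 19748 (N 31348 (N 3 (N 2 (J 1) X) (J 8)) (J 1))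
  (J 13))) (J 5)) (J 10))) (J 4)) (N 44234 (N 70218 (N 52852 (J 1) (N 2 (N 2 (J 1) X) (J 11))) (J
  3)) (J 8))) (J 1)) (N 22348 (N 35474 (N 2 X (J 1)) (N 56310 (N 89386 (J 1) (N 51576 (N 81872 (N
  71040 (J 1) (N 22380 (N 35525 (N 2 X (J 3)) (J 1)) (J 13))) (J 6)) (J 10))) (J 8))) (J 6))) (N
  58909 (N 93513 (N 90680 (N 93485 (J 1) (N 56338 (N 89431 (N 83093 (J 6) (N 39868 (N 63287 (N
  43072 (N 68372 (N 52077 (N 77344 (N 67059 (J 12) (N 12733 (N 20211 (J 3) X) (J 19))) (J 13)) (N
  5325 (N 8451 (J 7) (N 13413 (N 21291 X (J 3)) (J 19))) (J 17))) (J 7)) (J 7)) (J 7)) (J 12))) (J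
  5)) (J 9))) (J 1)) (N 57761 (N 91689 (N 86623 (N 92687 (N 90209 (J 7) (N 49521 (N 78609 (N 66172
  (J 3) (N 18238 (N 28951 (N 5003 (N 7940 (J 7) (N 12601 (N 20002 X (J 3)) (J 19))) (J 10)) (N
  40954 (N 65011 (J 10) (N 12885 (N 20452 (J 3) X) (J 19))) (J 17))) (J 15))) (J 7)) (J 12))) (J
  5)) (N 44818 (N 71143 (N 54230 (J 1) (N 3 (N 3 (J 7) (N 2 (N 2 X (J 1)) (J 15))) (J 13))) (J 6))
  (J 10))) (J 3)) (J 7))) (J 5))) (J 3))) (N 59862 (N 95025 (N 91580 (N 94015 (N 92316 (J 2) (N
  52865 (N 83917 (N 74599 (N 88268 (N 83186 (J 2) (N 40046 (N 63568 (J 2) (N 56748 (N 90082 (J 8)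
  (N 52352 (N 83104 (N 72996 (J 9) (N 22883 (N 36324 X (J 9)) (J 19))) (J 12)) (J 16))) (J 14)))
  (J 12))) (J 4)) (J 2)) (J 2)) (J 7))) (N 56922 (N 90358 (N 84565 (J 3) (N 42204 (N 66995 (N
  48958 (N 77715 (N 66908 (N 86611 (N 81771 (J 9) (N 36085 (N 57282 (N 32084 (N 50929 (N 23914 X
  (J 7)) (J 13)) (J 4)) (J 11)) (J 16))) (J 10)) (N 19599 (N 31111 (J 4) (N 49385 (N 78393 (J 10)
  (N 33798 (N 53651 (N 26242 X (J 9)) (J 14)) (J 18))) (J 16))) (J 14))) (J 4)) (J 4)) (J 4)) (J
  9))) (J 2)) (J 6))) (N 51358 (N 81526 (N 70711 (N 89899 (J 2) (N 56750 (N 90085 (J 3) (N 58175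
  (N 92347 (N 88601 (J 6) (N 46953 (N 74533 (N 59748 (N 80829 (N 71557 (J 7) (N 22521 (N 35749 X
  (J 7)) (J 19))) (J 9)) (N 14015 (N 22247 (J 11) (N 35314 (N 56057 (J 7) X) (J 19))) (J 17))) (J
  7)) (J 14))) (J 6)) (J 11))) (J 9))) (J 2)) (J 1)) (J 5))) (N 59261 (N 94072 (N 90405 (N 93579
  (N 91624 (J 4) (N 51767 (N 82174 (N 71832 (N 86804 (N 80862 (J 4) (N 36355 (N 57711 (N 34862 (N
  55262 (N 30794 (N 48859 (N 21844 X (J 5)) (J 15)) (J 4)) (J 11)) (J 4)) (J 2)) (J 14))) (J 6))
  (N 27222 (N 43212 (N 18361 (N 29145 (J 4) (N 46264 (N 73440 (J 10) (N 31752 (N 50403 (N 22020 X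
  (J 5)) (J 13)) (J 18))) (J 16))) (J 7)) (N 50235 (N 79742 (J 7) (N 36268 (N 57571 (N 32466 (N
  49591 (N 21798 X (J 5)) (J 14)) (J 4)) (J 12)) (J 16))) (J 14))) (J 12))) (J 4)) (J 9))) (J 2))
  (N 49930 (N 79258 (N 67111 (N 88980 (N 84496 (N 89894 (N 86981 (J 7) (N 44356 (N 70410 (N 52924
  (N 78487 (N 67660 (J 9) (N 15023 (N 23847 (J 5) X) (J 19))) (J 11)) (N 5526 (N 8770 (J 4) (N
  13919 (N 22094 X (J 5)) (J 19))) (J 17))) (J 9)) (J 14))) (J 8)) (J 4)) (J 2)) (N 17552 (N 27861
  (J 4) (N 44225 (N 70202 (N 88055 (N 89317 (J 8) (N 49722 (N 78928 (N 66421 (J 13) (N 13404 (N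
  21276 (J 5) X) (J 19))) (J 12)) (J 16))) (J 8)) (N 23384 (N 37120 (N 2 X (J 1)) (J 10)) (J 14)))
  (J 12))) (J 10))) (J 3)) (J 7))) (N 58923 (N 93534 (N 89552 (J 2) (N 48575 (N 77108 (N 63698 (N
  83564 (N 75898 (J 2) (N 30586 (N 48552 (N 22594 (N 35864 X (J 11)) (J 6)) (N 54478 (N 86478 (J
  10) (N 46631 (N 74023 (N 58580 (J 11) X) (J 14)) (J 18))) (J 16))) (J 14))) (J 4)) (J 2)) (J 5))
  (J 9))) (J 2)) (J 6))) (J 4))) (J 2))) (N 1 X X))"

lemma supersolution_contour_trie: "supersolution contour_trie [] contour_trie"
  by code_simp

lemma continuations_bound: "real (continuations [] n) \<le> 100000 * 1.58746 ^ n"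
  using continuations_le_weight[OF supersolution_contour_trie, of "[]" n]
  by (simp add: contour_trie_def)

section \<open>Contours of holes\<close>

type_synonym site = "int \<times> int"

definition dirs :: "site set" where
  "dirs = {(1, 0), (0, 1), (-1, 0), (0, -1)}"

definition rot :: "site \<Rightarrow> site" where
  "rot p = (- snd p, fst p)"

definition even_site :: "site \<Rightarrow> bool" where
  "even_site p \<longleftrightarrow> even (fst p + snd p)"

text \<open>
Boundary bonds are recorded as pairs of an inner site and a direction, so that each contour edge is
oriented with the hole on its left.
\<close>

definition bd :: "site set \<Rightarrow> (site \<times> site) set" where
  "bd H = {(v, d). v \<in> H \<and> d \<in> dirs \<and> v + d \<notin> H}"

lemma bd_iff: "(v, d) \<in> bd H \<longleftrightarrow> v \<in> H \<and> d \<in> dirs \<and> v + d \<notin> H"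
  by (simp add: bd_def)

definition left_turn :: "site set \<Rightarrow> site \<times> site \<Rightarrow> bool" where
  "left_turn H e \<longleftrightarrow> fst e + rot (snd e) \<notin> H"

text \<open>
The dual edge of the bond \<open>(v, d)\<close> is traversed in the direction \<open>rot d\<close>. It arrives in the unit
square with corners \<open>v\<close>, \<open>v + d\<close>, \<open>v + rot d\<close>, \<open>v + d + rot d\<close>, and the contour continues across
another side of that square.
\<close>

definition next_edge :: "site set \<Rightarrow> site \<times> site \<Rightarrow> site \<times> site" where
  "next_edge H = (\<lambda>(v, d). if v + rot d \<in> H then (v + d + rot d, - rot d) else (v, rot d))"

text \<open>
Connectedness, stated through locally constant functions: this is the form in which it is used,
and it spares paths.
\<close>

definition linked :: "(int \<times> int) set \<Rightarrow> bool" where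
  "linked S \<longleftrightarrow> (\<forall>f :: site \<Rightarrow> bool.
     (\<forall>u\<in>S. \<forall>v\<in>S. z2_adj u v \<longrightarrow> f u = f v) \<longrightarrow> (\<forall>u\<in>S. \<forall>v\<in>S. f u = f v))"

lemma linkedD:
  fixes f :: "site \<Rightarrow> bool"
  assumes "linked S" "\<And>u v. u \<in> S \<Longrightarrow> v \<in> S \<Longrightarrow> z2_adj u v \<Longrightarrow> f u = f v" "x \<in> S" "y \<in> S"
  shows "f x = f y"
  using assms(1)[unfolded linked_def, THEN spec, of f] assms(2-4) by blast

lemma z2_adj_iff_dirs: "z2_adj u v \<longleftrightarrow> v - u \<in> dirs"
  by (cases u; cases v) (auto simp: z2_adj_def dirs_def)

lemma z2_adj_add_dir: "d \<in> dirs \<Longrightarrow> z2_adj u (u + d)"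
  by (simp add: z2_adj_iff_dirs)

lemma z2_adjE:
  assumes "z2_adj u v" obtains d where "d \<in> dirs" "v = u + d"
  using assms by (metis add.commute diff_add_cancel z2_adj_iff_dirs)

lemma rot_uminus: "rot (- u) = - rot u"
  and rot_rot: "rot (rot u) = - u"
  by (simp_all add: rot_def prod_eq_iff)

lemma rot_dirs: "d \<in> dirs \<Longrightarrow> rot d \<in> dirs" and uminus_dirs: "d \<in> dirs \<Longrightarrow> - d \<in> dirs"
  by (auto simp: dirs_def rot_def)

lemma even_site_add_dir: "d \<in> dirs \<Longrightarrow> even_site (v + d) \<longleftrightarrow> \<not> even_site v"
  by (auto simp: even_site_def dirs_def)

lemma finite_dirs [simp]: "finite dirs"
  by (simp add: dirs_def)

lemma finite_bd: "finite H \<Longrightarrow> finite (bd H)"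
  by (rule finite_subset[of _ "H \<times> dirs"]) (auto simp: bd_def)

lemma int_parity_primitive:
  fixes c :: "int \<Rightarrow> bool"
  shows "\<exists>g :: int \<Rightarrow> bool. g 0 = False \<and> (\<forall>x. g (x + 1) = (g x \<noteq> c x))"
proof -
  let ?s = "\<lambda>x. (\<Sum>z\<in>{0..<x}. of_bool (c z)) + (\<Sum>z\<in>{x..<0}. of_bool (c z)) :: int"
  have "odd (?s 0) = False" by simp
  moreover have "odd (?s (x + 1)) = (odd (?s x) \<noteq> c x)" for x
  proof (cases "0 \<le> x")
    case True
    then have "{0..<x + 1} = insert x {0..<x}" by auto
    then show ?thesis using True by (simp del: sum_of_bool_eq)
  next
    case False
    then have "{x..<0} = insert x {x + 1..<0}" by auto
    then show ?thesis using False by (simp del: sum_of_bool_eq)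
  qed
  ultimately show ?thesis by (intro exI[of _ "\<lambda>x. odd (?s x)"]) blast
qed

text \<open>
A discrete Poincare lemma modulo 2: an assignment of parities to the bonds of the lattice that sums
to 0 around every unit square is the coboundary of a function on the sites.
\<close>

lemma parity_potential:
  fixes h w :: "site \<Rightarrow> bool"
  assumes face: "\<And>x y. (h (x, y) \<noteq> w (x + 1, y)) = (h (x, y + 1) \<noteq> w (x, y))"
  shows "\<exists>g :: site \<Rightarrow> bool. (\<forall>x y. (g (x + 1, y) \<noteq> g (x, y)) = h (x, y)) \<and>
    (\<forall>x y. (g (x, y + 1) \<noteq> g (x, y)) = w (x, y))"
proof -
  obtain a where a: "a 0 = False" "\<And>x. a (x + 1) = (a x \<noteq> h (x, 0))"
    using int_parity_primitive[of "\<lambda>x. h (x, 0)"] by metis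
  have "\<exists>k. k 0 = False \<and> (\<forall>y. k (y + 1) = (k y \<noteq> w (x, y)))" for x
    using int_parity_primitive[of "\<lambda>y. w (x, y)"] by metis
  then obtain k where k: "\<And>x. k x 0 = False" "\<And>x y. k x (y + 1) = (k x y \<noteq> w (x, y))" by metis
  define g where "g = (\<lambda>(x, y). a x \<noteq> k x y)"
  have vert: "(g (x, y + 1) \<noteq> g (x, y)) = w (x, y)" for x y
    using k(2)[of x y] by (auto simp: g_def)
  have "(g (x + 1, y) \<noteq> g (x, y)) = h (x, y)" for x y
  proof (induction y rule: int_induct[where k = 0])
    case base
    then show ?case using a(2)[of x] k(1) by (auto simp: g_def)
  next
    case (step1 y)
    then show ?case using vert[of x y] vert[of "x + 1" y] face[of x y] by auto
  next
    case (step2 y)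
    then show ?case using vert[of x "y - 1"] vert[of "x + 1" "y - 1"] face[of x "y - 1"] by auto
  qed
  with vert show ?thesis by blast
qed

lemma linked_UNIV: "linked UNIV"
  unfolding linked_def
proof (intro allI impI ballI)
  fix f :: "site \<Rightarrow> bool" and u v
  assume "\<forall>u\<in>UNIV. \<forall>v\<in>UNIV. z2_adj u v \<longrightarrow> f u = f v"
  then have hor: "f (x + 1, y) = f (x, y)" and ver: "f (x, y + 1) = f (x, y)" for x y
    by (auto simp: z2_adj_def)
  have ver0: "f (x, y) = f (x, 0)" for x y
    by (induction y rule: int_induct[where k = 0]) (use ver ver[of x "_ - 1"] in auto)
  have "f (x, 0) = f (0, 0)" for x
    by (induction x rule: int_induct[where k = 0]) (use hor hor[of "_ - 1" 0] in auto)
  with ver0 show "f u = f v" by (metis surj_pair)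
qed

text \<open>
Only this information about holes matters for their contours. That all inner boundary sites have the
same parity forces every neighbour of a site of the other parity in \<open>H\<close> to be in \<open>H\<close>, and it makes
the contour turn at each step.
\<close>

locale hole =
  fixes H :: "site set" and inner :: bool
  assumes finite_H: "finite H" and H_nonempty: "H \<noteq> {}"
    and inner_site: "(v, d) \<in> bd H \<Longrightarrow> even_site v = inner"
    and linked_H: "linked H" and linked_compl: "linked (- H)"
begin

lemma finite_bd_H: "finite (bd H)"
  using finite_bd[OF finite_H] .

lemma outer_dir: "v \<in> H \<Longrightarrow> d \<in> dirs \<Longrightarrow> even_site v \<noteq> inner \<Longrightarrow> v + d \<in> H"
  using inner_site[of v d] by (auto simp: bd_def)

lemma right_corner:
  assumes "(v, d) \<in> bd H" "v + rot d \<in> H"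
  shows "v + d + rot d \<in> H"
  using outer_dir[of "v + rot d" d] assms inner_site[OF assms(1)] even_site_add_dir rot_dirs
  by (auto simp: bd_def add_ac)

lemma next_edge_bd: "e \<in> bd H \<Longrightarrow> next_edge H e \<in> bd H"
  using right_corner by (cases e) (auto simp: next_edge_def bd_def rot_dirs uminus_dirs)

lemma next_edge_inj: "inj_on (next_edge H) (bd H)"
proof (rule inj_onI)
  have mixed: False
    if "(v, d) \<in> bd H" "v + rot d \<notin> H" "(v', d') \<in> bd H" "v' + rot d' \<in> H"
      "v = v' + d' + rot d'" "rot d = - rot d'" for v d v' d'
  proof -
    have "d = - d'" using that(6) by (metis rot_rot rot_uminus minus_minus)
    then have "v + d = v' + rot d'" using that(5) by simp
    moreover have "v + d \<notin> H" using that(1) by (simp add: bd_def)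
    ultimately show False using that(4) by simp
  qed
  have rot_inj: "rot d = rot d' \<Longrightarrow> d = d'" for d d'
    by (metis rot_rot minus_equation_iff minus_minus)
  fix e e' assume e: "e \<in> bd H" "e' \<in> bd H" "next_edge H e = next_edge H e'"
  obtain v d v' d' where [simp]: "e = (v, d)" "e' = (v', d')" by (cases e; cases e')
  have bd: "(v, d) \<in> bd H" "(v', d') \<in> bd H" using e by simp_all
  show "e = e'"
  proof (cases "v + rot d \<in> H")
    case right: True
    then have "v' + rot d' \<in> H"
      using e(3) mixed[OF bd(2) _ bd(1)] by (fastforce simp: next_edge_def split: if_splits)
    then have n: "next_edge H (v, d) = (v + d + rot d, - rot d)"
      "next_edge H (v', d') = (v' + d' + rot d', - rot d')"
      using right by (simp_all add: next_edge_def)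
    have "next_edge H (v, d) = next_edge H (v', d')" using e(3) by simp
    then have eq: "v + d + rot d = v' + d' + rot d' \<and> - rot d = - rot d'"
      unfolding n prod.inject .
    then have "d = d'" using rot_inj[of d d'] by simp
    then show ?thesis using eq by simp
  next
    case left: False
    then have "v' + rot d' \<notin> H"
      using e(3) mixed[OF bd(1) _ bd(2)] by (fastforce simp: next_edge_def split: if_splits)
    then show ?thesis
      using e(3) left rot_inj[of d d'] by (simp add: next_edge_def)
  qed
qed

definition crosses :: "(site \<times> site) set \<Rightarrow> site \<Rightarrow> site \<Rightarrow> bool" where
  "crosses S p q \<longleftrightarrow> (p, q - p) \<in> S \<or> (q, p - q) \<in> S"

lemma crosses_commute: "crosses S p q = crosses S q p"
  by (auto simp: crosses_def)

text \<open>
Among the sides of the unit square at \<open>v\<close>, of which \<open>v\<close> and \<open>v + d + rot d\<close> are the corners of inner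
parity, an even number is crossed by \<open>S\<close>.
\<close>

definition even_face :: "(site \<times> site) set \<Rightarrow> site \<Rightarrow> site \<Rightarrow> bool" where
  "even_face S v d \<longleftrightarrow>
     (((v, d) \<in> S) \<noteq> ((v + d + rot d, - d) \<in> S)) = (((v, rot d) \<in> S) \<noteq> ((v + d + rot d, - rot d) \<in> S))"

lemma crosses_inner:
  assumes "S \<subseteq> bd H" "even_site v = inner" "d \<in> dirs"
  shows "crosses S v (v + d) \<longleftrightarrow> (v, d) \<in> S"
  using assms inner_site[of "v + d" "- d"] even_site_add_dir[of d v]
  by (auto simp: crosses_def)

text \<open>
This replaces planar topology. A set \<open>S\<close> of boundary bonds that crosses each unit square evenly is
the coboundary of a function \<open>g\<close>. Since \<open>S\<close> has no bond inside \<open>H\<close> or inside its complement, and both are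
connected, \<open>g\<close> is constant on each of them; so \<open>S\<close> is empty or contains the whole boundary.
\<close>

lemma cocycle_eq_bd:
  assumes S: "S \<subseteq> bd H" "S \<noteq> {}"
    and even: "\<And>v d. d \<in> dirs \<Longrightarrow> even_site v = inner \<Longrightarrow> even_face S v d"
  shows "S = bd H"
proof -
  define h where "h p = crosses S p (p + (1, 0))" for p
  define w where "w p = crosses S p (p + (0, 1))" for p
  have face: "(h (x, y) \<noteq> w (x + 1, y)) = (h (x, y + 1) \<noteq> w (x, y))" for x y
  proof (cases "even_site (x, y) = inner")
    case True
    let ?v = "(x, y)"
    have e: "even_site (x + 1, y + 1) = inner" using True by (simp add: even_site_def)
    have "h (x, y) = ((?v, (1, 0)) \<in> S)" "w (x, y) = ((?v, (0, 1)) \<in> S)"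
      unfolding h_def w_def by (rule crosses_inner[OF S(1) True]; simp add: dirs_def)+
    moreover have "h (x, y + 1) = (((x + 1, y + 1), (-1, 0)) \<in> S)"
      "w (x + 1, y) = (((x + 1, y + 1), (0, -1)) \<in> S)"
      using crosses_inner[OF S(1) e, of "(-1, 0)"] crosses_inner[OF S(1) e, of "(0, -1)"]
      by (auto simp: h_def w_def dirs_def crosses_commute)
    ultimately show ?thesis
      using even[of "(1, 0)" ?v] True by (auto simp: even_face_def rot_def dirs_def)
  next
    case False
    let ?v = "(x + 1, y)"
    have e1: "even_site ?v = inner" and e2: "even_site (x, y + 1) = inner"
      using False by (auto simp: even_site_def)
    have "h (x, y) = ((?v, (-1, 0)) \<in> S)" "w (x + 1, y) = ((?v, (0, 1)) \<in> S)"
      using crosses_inner[OF S(1) e1, of "(-1, 0)"] crosses_inner[OF S(1) e1, of "(0, 1)"]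
      by (auto simp: h_def w_def dirs_def crosses_commute)
    moreover have "h (x, y + 1) = (((x, y + 1), (1, 0)) \<in> S)"
      "w (x, y) = (((x, y + 1), (0, -1)) \<in> S)"
      using crosses_inner[OF S(1) e2, of "(1, 0)"] crosses_inner[OF S(1) e2, of "(0, -1)"]
      by (auto simp: h_def w_def dirs_def crosses_commute)
    ultimately show ?thesis
      using even[of "(0, 1)" ?v] e1 by (auto simp: even_face_def rot_def dirs_def)
  qed
  obtain g :: "site \<Rightarrow> bool" where g: "\<And>x y. (g (x + 1, y) \<noteq> g (x, y)) = h (x, y)"
    "\<And>x y. (g (x, y + 1) \<noteq> g (x, y)) = w (x, y)"
    using parity_potential[of h w, OF face] by auto
  have cross: "crosses S p q \<longleftrightarrow> g p \<noteq> g q" if "z2_adj p q" for p q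
  proof -
    obtain x y where p: "p = (x, y)" by (cases p)
    from that consider "q = (x + 1, y)" | "q = (x - 1, y)" | "q = (x, y + 1)" | "q = (x, y - 1)"
      unfolding p by (cases q) (auto simp: z2_adj_def abs_if split: if_splits)
    then show ?thesis
    proof cases
      case 1 then show ?thesis using g(1)[of x y] by (auto simp: p h_def)
    next
      case 2 then show ?thesis using g(1)[of "x - 1" y] by (auto simp: p h_def crosses_commute)
    next
      case 3 then show ?thesis using g(2)[of x y] by (auto simp: p w_def)
    next
      case 4 then show ?thesis using g(2)[of x "y - 1"] by (auto simp: p w_def crosses_commute)
    qed
  qed
  have same_side: "g p = g q" if "(p \<in> H) = (q \<in> H)" "z2_adj p q" for p q
    using cross[OF that(2)] that(1) S(1) by (auto simp: crosses_def bd_def)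
  have inside: "\<forall>u\<in>H. \<forall>v\<in>H. z2_adj u v \<longrightarrow> g u = g v"
    and outside: "\<forall>u\<in>-H. \<forall>v\<in>-H. z2_adj u v \<longrightarrow> g u = g v"
    by (intro ballI impI same_side; simp)+
  note const = linked_H[unfolded linked_def, THEN spec, THEN mp, OF inside]
    linked_compl[unfolded linked_def, THEN spec, THEN mp, OF outside]
  obtain v d where vd: "(v, d) \<in> S" using S(2) by auto
  then have in_bd: "(v, d) \<in> bd H" using S(1) by auto
  then have "g v \<noteq> g (v + d)"
    using cross[of v "v + d"] vd z2_adj_add_dir[of d v] by (auto simp: crosses_def bd_def)
  have "(v', d') \<in> S" if "(v', d') \<in> bd H" for v' d'
  proof -
    have "g v' = g v" "g (v' + d') = g (v + d)"
      using const(1)[THEN bspec, THEN bspec, of v' v] const(2)[THEN bspec, THEN bspec, of "v' + d'" "v + d"]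
        that in_bd by (simp_all add: bd_def)
    then have "crosses S v' (v' + d')"
      using cross[of v' "v' + d'"] z2_adj_add_dir[of d' v'] that \<open>g v \<noteq> g (v + d)\<close>
      by (auto simp: bd_def)
    then show ?thesis
      using crosses_inner[OF S(1) inner_site[OF that]] that by (auto simp: bd_def)
  qed
  then show ?thesis using S(1) by auto
qed

text \<open>
Of the four possible boundary bonds around a square, the contour enters the square through two and
leaves it through the other two, and \<open>next_edge\<close> matches those present. If \<open>S\<close> respects the matching,
it crosses the square evenly.
\<close>

lemma even_face_if_paired:
  assumes S: "S \<subseteq> bd H" and v: "even_site v = inner" and d: "d \<in> dirs"
    and A: "(v, d) \<in> bd H \<Longrightarrow> (v, d) \<in> S \<longleftrightarrow> next_edge H (v, d) \<in> S"
    and D: "(v + d + rot d, - d) \<in> bd H \<Longrightarrow>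
      (v + d + rot d, - d) \<in> S \<longleftrightarrow> next_edge H (v + d + rot d, - d) \<in> S"
  shows "even_face S v d"
proof -
  let ?w = "v + d + rot d"
  have up: "v + d \<in> H \<Longrightarrow> v \<in> H \<and> ?w \<in> H" "v + rot d \<in> H \<Longrightarrow> v \<in> H \<and> ?w \<in> H"
    using outer_dir[of "v + d" "- d"] outer_dir[of "v + d" "rot d"]
      outer_dir[of "v + rot d" "- rot d"] outer_dir[of "v + rot d" d]
      even_site_add_dir[of d v] even_site_add_dir[of "rot d" v] v d rot_dirs[OF d] uminus_dirs
    by (auto simp: add_ac)
  have nD: "next_edge H (?w, - d) = (if v + d \<in> H then (v, rot d) else (?w, - rot d))"
    by (simp add: next_edge_def rot_uminus add_ac)
  have nA: "next_edge H (v, d) = (if v + rot d \<in> H then (?w, - rot d) else (v, rot d))"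
    by (simp add: next_edge_def)
  have bds: "(v, d) \<in> bd H \<longleftrightarrow> v \<in> H \<and> v + d \<notin> H" "(v, rot d) \<in> bd H \<longleftrightarrow> v \<in> H \<and> v + rot d \<notin> H"
    "(?w, - d) \<in> bd H \<longleftrightarrow> ?w \<in> H \<and> v + rot d \<notin> H" "(?w, - rot d) \<in> bd H \<longleftrightarrow> ?w \<in> H \<and> v + d \<notin> H"
    using d rot_dirs uminus_dirs by (auto simp: bd_def)
  have S_bd: "a \<notin> bd H \<Longrightarrow> a \<notin> S" for a using S by blast
  show ?thesis
    using S_bd[of "(v, d)"] S_bd[of "(v, rot d)"] S_bd[of "(?w, - d)"] S_bd[of "(?w, - rot d)"] A D up
    unfolding even_face_def nA nD bds
    by (cases "v \<in> H"; cases "?w \<in> H"; cases "v + d \<in> H"; cases "v + rot d \<in> H"; simp)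
qed

text \<open>
The boundary is a single closed curve, since an orbit of the permutation \<open>next_edge\<close> is evenly
crossing.
\<close>

lemma orbit_eq_bd:
  assumes e: "e \<in> bd H"
  shows "{(next_edge H ^^ k) e | k. True} = bd H"
proof (rule cocycle_eq_bd)
  let ?O = "{(next_edge H ^^ k) e | k. True}"
  have in_bd: "(next_edge H ^^ k) e \<in> bd H" for k by (induction k) (auto simp: e next_edge_bd)
  then show sub: "?O \<subseteq> bd H" by auto
  show "?O \<noteq> {}" by blast
  have "next_edge H ` ?O \<subseteq> ?O" by (auto intro: exI[of _ "Suc _"])
  moreover have "inj_on (next_edge H) ?O" using next_edge_inj sub inj_on_subset by blast
  moreover have "finite ?O" using sub finite_bd_H finite_subset by blast
  ultimately have onto: "next_edge H ` ?O = ?O" by (simp add: endo_inj_surj)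
  have paired: "a \<in> ?O \<longleftrightarrow> next_edge H a \<in> ?O" if "a \<in> bd H" for a
  proof
    assume "next_edge H a \<in> ?O"
    then have "next_edge H a \<in> next_edge H ` ?O" unfolding onto .
    then show "a \<in> ?O" using inj_on_image_mem_iff[OF next_edge_inj that sub] by simp
  next
    assume "a \<in> ?O"
    then have "next_edge H a \<in> next_edge H ` ?O" by (rule imageI)
    then show "next_edge H a \<in> ?O" unfolding onto .
  qed
  show "even_face ?O v d" if "d \<in> dirs" "even_site v = inner" for v d
    by (rule even_face_if_paired[OF sub that(2,1)]; rule paired)
qed

text \<open>
The contour does not touch itself at a corner. Otherwise it passes through some unit square twice.
The part of it between leaving this square and the next return to it crosses every square evenly,
this one included, and so it would be the whole boundary; but it misses the bond \<open>(v, d)\<close> before it.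
\<close>

lemma no_ambiguous_face:
  assumes A: "(v, d) \<in> bd H" and left: "v + rot d \<notin> H"
  shows "v + d + rot d \<notin> H"
proof
  let ?w = "v + d + rot d"
  assume w: "?w \<in> H"
  let ?B = "(v, rot d)" and ?C = "(?w, - rot d)" and ?D = "(?w, - d)"
  have d: "d \<in> dirs" and vH: "v \<in> H" and vd: "v + d \<notin> H" using A by (auto simp: bd_def)
  have D: "?D \<in> bd H" using w left d uminus_dirs by (auto simp: bd_def)
  have nA: "next_edge H (v, d) = ?B" using left by (simp add: next_edge_def)
  have nD: "next_edge H ?D = ?C" using vd by (simp add: next_edge_def rot_uminus add_ac)
  have B: "?B \<in> bd H" using next_edge_bd[OF A] nA by simp
  have vw: "v \<noteq> ?w" using d by (auto simp: dirs_def rot_def prod_eq_iff)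
  \<comment> \<open>The contour leaves the square through \<open>?B\<close> and \<open>?C\<close>; \<open>S\<close> is the part from \<open>?B\<close> until it enters through \<open>?D\<close>.\<close>
  define m where "m = (LEAST m. (next_edge H ^^ m) ?B = ?D)"
  have "?D \<in> {(next_edge H ^^ k) ?B | k. True}" using orbit_eq_bd[OF B] D by simp
  then have "\<exists>m. (next_edge H ^^ m) ?B = ?D" by auto
  then have m: "(next_edge H ^^ m) ?B = ?D" and m_least: "\<And>k. k < m \<Longrightarrow> (next_edge H ^^ k) ?B \<noteq> ?D"
    unfolding m_def by (auto intro: LeastI_ex dest: not_less_Least)
  define S where "S = {(next_edge H ^^ k) ?B | k. k \<le> m}"
  have in_bd: "(next_edge H ^^ k) ?B \<in> bd H" for k by (induction k) (auto simp: B next_edge_bd)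
  then have sub: "S \<subseteq> bd H" by (auto simp: S_def)
  have BS: "?B \<in> S" unfolding S_def by (auto intro: exI[of _ 0])
  have DS: "?D \<in> S" unfolding S_def using m[symmetric] by blast
  have AS: "(v, d) \<notin> S"
  proof
    assume "(v, d) \<in> S"
    then obtain k where k: "k \<le> m" "(next_edge H ^^ k) ?B = (v, d)" by (auto simp: S_def)
    have "k \<noteq> m" using k(2) m vw by auto
    then have "Suc k \<le> m" using k(1) by simp
    have "(next_edge H ^^ Suc k) ?B = ?B" using k(2) nA by simp
    then have "(next_edge H ^^ (m - Suc k)) ?B = (next_edge H ^^ (m - Suc k)) ((next_edge H ^^ Suc k) ?B)" by simp
    also have "\<dots> = (next_edge H ^^ m) ?B" using \<open>Suc k \<le> m\<close>
      by (metis add.commute comp_apply funpow_add le_add_diff_inverse)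
    finally show False using m m_least[of "m - Suc k"] \<open>Suc k \<le> m\<close> by simp
  qed
  have CS: "?C \<notin> S"
  proof
    assume "?C \<in> S"
    then obtain k where k: "k \<le> m" "(next_edge H ^^ k) ?B = ?C" by (auto simp: S_def)
    have "k \<noteq> 0" using k(2) vw by (cases k) (simp_all add: prod_eq_iff)
    then obtain j where j: "k = Suc j" by (cases k) auto
    then have "next_edge H ((next_edge H ^^ j) ?B) = next_edge H ?D" using k nD by simp
    then have "(next_edge H ^^ j) ?B = ?D" using next_edge_inj in_bd D by (meson inj_onD)
    then show False using m_least[of j] j k by simp
  qed
  have paired: "a \<in> S \<longleftrightarrow> next_edge H a \<in> S" if a: "a \<in> bd H" "a \<noteq> (v, d)" "a \<noteq> ?D" for a
  proof
    assume "a \<in> S"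
    then obtain k where k: "k \<le> m" "a = (next_edge H ^^ k) ?B" by (auto simp: S_def)
    have "k \<noteq> m" using k(2) m a(3) by auto
    then show "next_edge H a \<in> S" unfolding S_def using k by (auto intro!: exI[of _ "Suc k"])
  next
    assume "next_edge H a \<in> S"
    then obtain k where k: "k \<le> m" "next_edge H a = (next_edge H ^^ k) ?B" by (auto simp: S_def)
    have "k \<noteq> 0"
    proof
      assume "k = 0"
      then have "next_edge H a = next_edge H (v, d)" using k(2) nA by simp
      then show False using next_edge_inj a A by (meson inj_onD)
    qed
    then obtain j where j: "k = Suc j" by (cases k) auto
    then have "next_edge H a = next_edge H ((next_edge H ^^ j) ?B)" using k by simp
    then have "a = (next_edge H ^^ j) ?B" using next_edge_inj in_bd a(1) by (meson inj_onD)
    then show "a \<in> S" unfolding S_def using k j by auto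
  qed
  have "S = bd H"
  proof (rule cocycle_eq_bd[OF sub])
    show "S \<noteq> {}" using BS by auto
    fix v' d' assume v': "d' \<in> dirs" "even_site v' = inner"
    show "even_face S v' d'"
    proof (cases "(v', d') = (v, d) \<or> (v', d') = ?D")
      case True
      then show ?thesis
        using AS BS CS DS by (auto simp: even_face_def rot_uminus add_ac)
    next
      case False
      then have "(v', d') \<noteq> (v, d)" "(v', d') \<noteq> ?D" by blast+
      moreover have "(v' + d' + rot d', - d') \<noteq> (v, d)" "(v' + d' + rot d', - d') \<noteq> ?D"
        using False by (auto simp: rot_uminus)
      ultimately show ?thesis
        by (intro even_face_if_paired[OF sub v'(2,1)] paired)
    qed
  qed
  then show False using A AS by simp
qed

lemma next_edge_period:
  assumes "e \<in> bd H" "(next_edge H ^^ n) e = e" "0 < n" shows "card (bd H) \<le> n"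
proof -
  have "(next_edge H ^^ k) e \<in> (\<lambda>j. (next_edge H ^^ j) e) ` {..<n}" for k
  proof -
    have "(next_edge H ^^ k) e = (next_edge H ^^ (k mod n)) e"
    proof -
      have "(next_edge H ^^ (n * i)) e = e" for i
        using assms(2) by (induction i) (auto simp: funpow_add)
      then have "(next_edge H ^^ (k mod n + n * (k div n))) e = (next_edge H ^^ (k mod n)) e"
        by (simp only: funpow_add comp_apply)
      then show ?thesis by simp
    qed
    then show ?thesis using assms(3) by auto
  qed
  then have "bd H \<subseteq> (\<lambda>j. (next_edge H ^^ j) e) ` {..<n}"
    unfolding orbit_eq_bd[OF assms(1), symmetric] by (auto simp only: mem_Collect_eq)
  then have "card (bd H) \<le> card ((\<lambda>j. (next_edge H ^^ j) e) ` {..<n})" by (rule card_mono[rotated]) simp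
  also have "\<dots> \<le> n" using card_image_le[of "{..<n}"] by simp
  finally show ?thesis .
qed

lemma bd_eq_segment:
  assumes "e \<in> bd H"
  shows "bd H = (\<lambda>k. (next_edge H ^^ k) e) ` {..<card (bd H)}"
proof -
  let ?N = "card (bd H)"
  have in_bd: "(next_edge H ^^ k) e \<in> bd H" for k by (induction k) (auto simp: assms next_edge_bd)
  have "inj_on (\<lambda>k. (next_edge H ^^ k) e) {..<?N}"
  proof (rule linorder_inj_onI)
    fix i j assume ij: "i < j" "j \<in> {..<?N}"
    show "(next_edge H ^^ i) e \<noteq> (next_edge H ^^ j) e"
    proof
      assume eq: "(next_edge H ^^ i) e = (next_edge H ^^ j) e"
      then have "(next_edge H ^^ (j - i)) ((next_edge H ^^ i) e) = (next_edge H ^^ i) e"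
        using ij(1) by (metis comp_apply funpow_add le_add_diff_inverse2 less_imp_le_nat)
      then show False using next_edge_period[OF in_bd, of "j - i" i] ij by auto
    qed
  qed auto
  then have "card ((\<lambda>k. (next_edge H ^^ k) e) ` {..<?N}) = ?N" by (simp add: card_image)
  then show ?thesis using in_bd finite_bd_H by (metis card_subset_eq image_subsetI)
qed


definition turns_from :: "site \<times> site \<Rightarrow> nat \<Rightarrow> bool list" where
  "turns_from e n = map (\<lambda>k. left_turn H ((next_edge H ^^ k) e)) [0..<n]"

definition rel_turns :: "site \<times> site \<Rightarrow> nat \<Rightarrow> bool list" where
  "rel_turns e n = map (\<lambda>k. left_turn H ((next_edge H ^^ k) e) = left_turn H ((next_edge H ^^ Suc k) e)) [0..<n]"

lemma turns_from_Suc: "turns_from e (Suc n) = left_turn H e # turns_from (next_edge H e) n"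
  unfolding turns_from_def by (subst upt_conv_Cons) (simp_all add: map_Suc_upt[symmetric] funpow_swap1 o_def del: upt_Suc)

lemma rel_turns_Suc:
  "rel_turns e (Suc n) = (left_turn H e = left_turn H (next_edge H e)) # rel_turns (next_edge H e) n"
  unfolding rel_turns_def by (subst upt_conv_Cons) (simp_all add: map_Suc_upt[symmetric] funpow_swap1 o_def del: upt_Suc)

lemma turn_word_rel_turns: "turn_word (left_turn H e) (rel_turns e n) = turns_from e (Suc n)"
proof (induction n arbitrary: e)
  case 0
  show ?case by (simp add: rel_turns_def turns_from_def)
next
  case (Suc n)
  have "(if left_turn H e = left_turn H (next_edge H e) then left_turn H e else \<not> left_turn H e) = left_turn H (next_edge H e)"
    by auto
  then show ?case using Suc by (simp add: rel_turns_Suc turns_from_Suc[of e])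
qed

definition cmul :: "site \<Rightarrow> site \<Rightarrow> site" where
  "cmul p q = (fst p * fst q - snd p * snd q, fst p * snd q + snd p * fst q)"

text \<open>
With sites regarded as Gaussian integers, the contour from the bond \<open>(v, d)\<close> is the image of the
turtle path under the similarity \<open>z \<mapsto> v + d z\<close>.
\<close>

lemma next_edge_power_turtle:
  "(next_edge H ^^ n) (v, d) =
     (v + cmul d (fst (turtle (turns_from (v, d) n))), cmul d (snd (turtle (turns_from (v, d) n))))"
proof (induction n arbitrary: v d)
  case 0
  show ?case by (simp add: turns_from_def cmul_def prod_eq_iff)
next
  case (Suc n)
  obtain v' d' where e': "next_edge H (v, d) = (v', d')" by (metis surj_pair)
  obtain x y p q where tr: "turtle (turns_from (v', d') n) = ((x, y), (p, q))" by (metis surj_pair)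
  have tr': "turtle (turns_from (v, d) (Suc n)) =
      (if left_turn H (v, d) then ((- y, x), (- q, p)) else ((1 + y, 1 - x), (q, - p)))"
    by (simp add: turns_from_Suc e' tr)
  have v': "v' = (if left_turn H (v, d) then v else v + d + rot d)"
      "d' = (if left_turn H (v, d) then rot d else - rot d)"
    using e' by (simp_all add: next_edge_def left_turn_def split: if_splits)
  have "(next_edge H ^^ Suc n) (v, d) = (next_edge H ^^ n) (v', d')" by (simp add: funpow_swap1 e')
  also have "\<dots> = (v' + cmul d' (x, y), cmul d' (p, q))" using Suc.IH tr by simp
  also have "\<dots> = (v + cmul d (fst (turtle (turns_from (v, d) (Suc n)))),
      cmul d (snd (turtle (turns_from (v, d) (Suc n)))))"
    unfolding v' tr' by (simp add: cmul_def rot_def prod_eq_iff algebra_simps)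
  finally show ?case .
qed

lemma corners_label:
  assumes e: "(v + cmul d x, cmul d p) \<in> bd H"
    and "(q, s) \<in> set (corners (left_turn H (v + cmul d x, cmul d p)) (x, p))"
  shows "(v + cmul d q \<in> H) = s"
proof -
  obtain x1 x2 p1 p2 where [simp]: "x = (x1, x2)" "p = (p1, p2)" by (cases x; cases p)
  let ?v = "v + cmul d x" and ?d = "cmul d p"
  have lin: "v + cmul d (x1 + p1, x2 + p2) = ?v + ?d" "v + cmul d (x1 - p2, x2 + p1) = ?v + rot ?d"
    "v + cmul d (x1 + p1 - p2, x2 + p2 + p1) = ?v + ?d + rot ?d"
    by (simp_all add: cmul_def rot_def prod_eq_iff algebra_simps)
  have "?v \<in> H" "?v + ?d \<notin> H" using e by (auto simp: bd_def)
  moreover have "?v + ?d + rot ?d \<in> H \<longleftrightarrow> ?v + rot ?d \<in> H"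
    using no_ambiguous_face[OF e] right_corner[OF e] by blast
  ultimately show ?thesis
    using assms(2) lin by (auto simp: left_turn_def add.assoc)
qed

lemma not_impossible:
  assumes e: "e \<in> bd H" and n: "0 < n" "n < card (bd H)"
  shows "\<not> impossible (turns_from e n)"
proof
  assume imp: "impossible (turns_from e n)"
  obtain v d where [simp]: "e = (v, d)" by (cases e)
  obtain m where [simp]: "n = Suc m" using n by (cases n) auto
  have "turtle (turns_from e n) \<noteq> ((0, 0), (1, 0))"
  proof
    assume "turtle (turns_from e n) = ((0, 0), (1, 0))"
    then have "(next_edge H ^^ n) e = e"
      using next_edge_power_turtle[of n v d] by (simp add: cmul_def prod_eq_iff)
    then show False using next_edge_period[OF e _ n(1)] n(2) by simp
  qed
  moreover have hd: "hd (turns_from e n) = left_turn H e" by (simp add: turns_from_Suc)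
  moreover have last: "last (turns_from e n) = left_turn H ((next_edge H ^^ m) e)"
    and butlast: "butlast (turns_from e n) = turns_from e m"
    by (simp_all add: turns_from_def)
  ultimately obtain p s t where ps: "(p, s) \<in> set (corners (left_turn H e) ((0, 0), (1, 0)))"
    and pt: "(p, t) \<in> set (corners (left_turn H ((next_edge H ^^ m) e)) (turtle (turns_from e m)))" and "s \<noteq> t"
    using imp unfolding impossible_def by auto
  have one: "v + cmul d (0, 0) = v" "cmul d (1, 0) = d" by (simp_all add: cmul_def prod_eq_iff)
  have "(v + cmul d p \<in> H) = s"
    using corners_label[of v d "(0, 0)" "(1, 0)" p s] ps e unfolding one by simp
  moreover have "(v + cmul d p \<in> H) = t"
  proof -
    have "(next_edge H ^^ m) e \<in> bd H" by (induction m) (use e next_edge_bd in auto)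
    then show ?thesis
      using corners_label[of v d "fst (turtle (turns_from e m))" "snd (turtle (turns_from e m))" p t]
        pt next_edge_power_turtle[of m v d] by simp
  qed
  ultimately show False using \<open>s \<noteq> t\<close> by simp
qed

lemma admissible_rel_turns:
  assumes e: "e \<in> bd H" and n: "Suc n < card (bd H)"
  shows "admissible (rel_turns e n)"
  unfolding admissible_def
proof (intro allI impI notI)
  fix a b c assume abc: "rel_turns e n = a @ b @ c" and "excluded b"
  let ?e = "(next_edge H ^^ length a) e"
  have len: "length a + length b \<le> n" using arg_cong[OF abc, of length] by (simp add: rel_turns_def)
  have "b = take (length b) (drop (length a) (rel_turns e n))" using abc by simp
  also have "\<dots> = rel_turns ?e (length b)"
    by (rule nth_equalityI) (use len in \<open>auto simp: rel_turns_def funpow_add[symmetric] funpow_swap1 add.commute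
        simp flip: comp_apply[of "next_edge H ^^ _" "next_edge H ^^ _"]\<close>)
  finally have b: "b = rel_turns ?e (length b)" .
  have "?e \<in> bd H" by (induction a) (use e next_edge_bd in auto)
  then have "\<not> impossible (turns_from ?e (Suc (length b)))"
    using not_impossible len n by simp
  then have "\<not> impossible (turn_word (left_turn H ?e) b)"
    using turn_word_rel_turns[of ?e "length b"] b by simp
  with \<open>excluded b\<close> show False by (cases "left_turn H ?e") (auto simp: excluded_def)
qed

end

text \<open>
The sites at which the two holes agree form a union of components of the lattice, because crossing a
bond changes membership for both holes or for neither.
\<close>

lemma hole_eq_if_bd_eq:
  assumes "bd H = bd H'" "e \<in> bd H"
  shows "H = H'"
proof -
  let ?f = "\<lambda>u. (u \<in> H) = (u \<in> H')"
  have same: "?f u = ?f v" if adj: "z2_adj u v" for u v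
  proof -
    obtain d where d: "d \<in> dirs" "v = u + d" using z2_adjE[OF adj] by blast
    then have "u = v + (- d)" by simp
    with d have "(u, d) \<in> bd H \<longleftrightarrow> u \<in> H \<and> v \<notin> H" "(v, - d) \<in> bd H \<longleftrightarrow> v \<in> H \<and> u \<notin> H"
      "(u, d) \<in> bd H' \<longleftrightarrow> u \<in> H' \<and> v \<notin> H'" "(v, - d) \<in> bd H' \<longleftrightarrow> v \<in> H' \<and> u \<notin> H'"
      using uminus_dirs by (auto simp: bd_def)
    then show ?thesis using assms(1) by blast
  qed
  have "\<forall>u\<in>UNIV. \<forall>v\<in>UNIV. ?f u = ?f v"
    by (rule linked_UNIV[unfolded linked_def, THEN spec, THEN mp]) (intro ballI impI same)
  then have "?f u = ?f (fst e)" for u by blast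
  moreover have "fst e \<in> H" "fst e \<in> H'"
    using assms(2) assms(2)[unfolded assms(1)] by (auto simp: bd_def)
  ultimately show ?thesis by blast
qed

lemma hole_determined:
  assumes "hole H i" "hole H' i" "e \<in> bd H" "e \<in> bd H'"
    and card: "card (bd H) = Suc (Suc n)" "card (bd H') = Suc (Suc n)"
    and "left_turn H e = left_turn H' e" "hole.rel_turns H e n = hole.rel_turns H' e n"
  shows "H = H'"
proof (rule hole_eq_if_bd_eq[OF _ assms(3)])
  interpret A: hole H i by fact
  interpret B: hole H' i by fact
  have w: "A.turns_from e (Suc n) = B.turns_from e (Suc n)"
    using assms(7,8) A.turn_word_rel_turns[of e n] B.turn_word_rel_turns[of e n] by simp
  have "(next_edge H ^^ k) e = (next_edge H' ^^ k) e" if "k \<le> Suc n" for k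
  proof -
    have "take k (A.turns_from e (Suc n)) = take k (B.turns_from e (Suc n))" using w by simp
    then have "A.turns_from e k = B.turns_from e k"
      using that by (simp add: A.turns_from_def B.turns_from_def take_map del: upt_Suc)
    then show ?thesis
      using A.next_edge_power_turtle[of k "fst e" "snd e"] B.next_edge_power_turtle[of k "fst e" "snd e"] by simp
  qed
  then have "(\<lambda>k. (next_edge H ^^ k) e) ` {..<Suc (Suc n)} = (\<lambda>k. (next_edge H' ^^ k) e) ` {..<Suc (Suc n)}"
    by (intro image_cong) auto
  then show "bd H = bd H'"
    using A.bd_eq_segment[OF assms(3)] B.bd_eq_segment[OF assms(4)] card by simp
qed

lemma card_holes_through_edge:
  fixes e :: "site \<times> site" and n :: nat and i :: bool
  defines "Hs \<equiv> {H. hole H i \<and> e \<in> bd H \<and> card (bd H) = Suc (Suc n)}"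
  shows "finite Hs" "card Hs \<le> 2 * continuations [] n"
proof -
  let ?code = "\<lambda>H. (left_turn H e, hole.rel_turns H e n)"
  let ?W = "(UNIV :: bool set) \<times> {q. length q = n \<and> admissible ([] @ q)}"
  have inj: "inj_on ?code Hs"
  proof (rule inj_onI)
    fix H H' assume "H \<in> Hs" "H' \<in> Hs" "?code H = ?code H'"
    then show "H = H'"
      unfolding Hs_def by (intro hole_determined[of H i H' e n]) auto
  qed
  have img: "?code ` Hs \<subseteq> ?W"
  proof
    fix z assume "z \<in> ?code ` Hs"
    then obtain H where H: "hole H i" "e \<in> bd H" "card (bd H) = Suc (Suc n)" and z: "z = ?code H"
      by (auto simp: Hs_def)
    interpret hole H i by fact
    show "z \<in> ?W"
      using admissible_rel_turns[OF H(2), of n] H(3) z by (simp add: rel_turns_def)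
  qed
  have fin: "finite ?W" by (intro finite_cartesian_product finite_continuations) simp
  show "finite Hs" using inj img fin by (meson finite_subset finite_imageD)
  have "card Hs \<le> card ?W" using card_inj_on_le[OF inj img fin] .
  then show "card Hs \<le> 2 * continuations [] n"
    by (simp add: continuations_def card_cartesian_product)
qed

section \<open>The Peierls estimate\<close>

lemma sum_power_card_Pow:
  "finite F \<Longrightarrow> (\<Sum>A\<in>Pow F. x ^ card A) = (1 + x :: real) ^ card F"
proof (induction F rule: finite_induct)
  case (insert a F)
  have inj: "inj_on (insert a) (Pow F)" using insert.hyps by (auto simp: inj_on_def)
  have "(\<Sum>A\<in>Pow (insert a F). x ^ card A) = (\<Sum>A\<in>Pow F. x ^ card A) + (\<Sum>A\<in>insert a ` Pow F. x ^ card A)"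
    unfolding Pow_insert using insert.hyps by (intro sum.union_disjoint) auto
  also have "(\<Sum>A\<in>insert a ` Pow F. x ^ card A) = (\<Sum>A\<in>Pow F. x * x ^ card A)"
    unfolding sum.reindex[OF inj] using insert.hyps
    by (intro sum.cong) (auto simp: card_insert_if finite_subset)
  also have "\<dots> = x * (\<Sum>A\<in>Pow F. x ^ card A)" by (simp add: sum_distrib_left)
  finally show ?case using insert by (simp add: algebra_simps)
qed simp

lemma z2_adj_sym: "z2_adj u v \<Longrightarrow> z2_adj v u"
  by (auto simp: z2_adj_def)

lemma z2_adj_even: "z2_adj u v \<Longrightarrow> even_site v \<longleftrightarrow> \<not> even_site u"
  by (metis even_site_add_dir z2_adjE)

lemma z2_hard_core_graph: "0 < lam \<Longrightarrow> hard_core_graph z2_adj lam"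
proof
  fix v :: "int \<times> int"
  have "{u. z2_adj v u \<or> z2_adj u v} \<subseteq> (\<lambda>d. v + d) ` dirs"
  proof
    fix u assume "u \<in> {u. z2_adj v u \<or> z2_adj u v}"
    then have "z2_adj v u" using z2_adj_sym by blast
    then obtain d where "d \<in> dirs" "u = v + d" by (rule z2_adjE)
    then show "u \<in> (\<lambda>d. v + d) ` dirs" by blast
  qed
  then show "finite {u. z2_adj v u \<or> z2_adj u v}" by (rule finite_subset) simp
qed

text \<open>
The event whose probability the Peierls estimate bounds; it holds for each hole of a configuration.
\<close>

definition vacant :: "site set \<Rightarrow> site set \<Rightarrow> bool" where
  "vacant H K \<longleftrightarrow> (\<forall>(v, d)\<in>bd H. v \<notin> K \<and> v + d \<notin> K)"

context hole
begin

text \<open>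
Translation by \<open>d\<close> maps the sites of inner parity that do not exit in direction \<open>d\<close> onto the sites of
the other parity. So the number of exits is the same in all four directions.
\<close>

lemma card_exits:
  assumes "d \<in> dirs"
  shows "card {v. (v, d) \<in> bd H} + card {v \<in> H. even_site v \<noteq> inner} = card {v \<in> H. even_site v = inner}"
proof -
  let ?E = "{v \<in> H. even_site v = inner}" and ?O = "{v \<in> H. even_site v \<noteq> inner}"
  have "?E = {v. (v, d) \<in> bd H} \<union> (\<lambda>v. v - d) ` ?O"
  proof (intro equalityI subsetI)
    fix v assume v: "v \<in> ?E"
    show "v \<in> {v. (v, d) \<in> bd H} \<union> (\<lambda>v. v - d) ` ?O"
    proof (cases "v + d \<in> H")
      case True
      then have "v + d \<in> ?O" using v even_site_add_dir[OF assms] by auto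
      then show ?thesis by (intro UnI2 image_eqI[of _ _ "v + d"]) simp
    qed (use v assms in \<open>auto simp: bd_def\<close>)
  next
    fix v assume "v \<in> {v. (v, d) \<in> bd H} \<union> (\<lambda>v. v - d) ` ?O"
    then show "v \<in> ?E"
    proof
      assume "v \<in> {v. (v, d) \<in> bd H}"
      then show ?thesis using inner_site[of v d] by (simp add: bd_iff)
    next
      assume "v \<in> (\<lambda>v. v - d) ` ?O"
      then obtain w where w: "w \<in> H" "even_site w \<noteq> inner" "v = w + - d" by auto
      then show ?thesis
        using outer_dir[of w "- d"] even_site_add_dir[OF uminus_dirs[OF assms], of w] uminus_dirs[OF assms] by auto
    qed
  qed
  moreover have "{v. (v, d) \<in> bd H} \<inter> (\<lambda>v. v - d) ` ?O = {}" by (auto simp: bd_def)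
  moreover have "finite {v. (v, d) \<in> bd H}"
    by (rule finite_subset[OF _ finite_H]) (auto simp: bd_def)
  ultimately have "card ?E = card {v. (v, d) \<in> bd H} + card ((\<lambda>v. v - d) ` ?O)"
    using finite_H by (simp add: card_Un_disjoint)
  also have "card ((\<lambda>v. v - d) ` ?O) = card ?O" by (rule card_image) (auto simp: inj_on_def)
  finally show ?thesis by simp
qed

lemma card_bd:
  assumes "d \<in> dirs" shows "card (bd H) = 4 * card {v. (v, d) \<in> bd H}"
proof -
  have same: "card {v. (v, d') \<in> bd H} = card {v. (v, d) \<in> bd H}" if "d' \<in> dirs" for d'
    using card_exits[OF that] card_exits[OF assms] by linarith
  have "bd H = (\<Union>d'\<in>dirs. (\<lambda>v. (v, d')) ` {v. (v, d') \<in> bd H})" by (auto simp: bd_def)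
  also have "card \<dots> = (\<Sum>d'\<in>dirs. card ((\<lambda>v. (v, d')) ` {v. (v, d') \<in> bd H}))"
  proof (rule card_UN_disjoint)
    show "\<forall>d'\<in>dirs. finite ((\<lambda>v. (v, d')) ` {v. (v, d') \<in> bd H})"
      using finite_H by (auto intro!: finite_imageI finite_subset[OF _ finite_H] simp: bd_def)
  qed auto
  also have "\<dots> = (\<Sum>d'\<in>dirs. card {v. (v, d) \<in> bd H})"
    using same by (intro sum.cong) (auto simp: card_image inj_on_def)
  also have "\<dots> = 4 * card {v. (v, d) \<in> bd H}" by (simp add: dirs_def)
  finally show ?thesis .
qed

text \<open>
In the lemmas below \<open>A\<close> consists of freed sites, that is, inner boundary sites \<open>v\<close> with \<open>v - s\<close> outside the hole.
\<close>

definition shift :: "site \<Rightarrow> site set \<Rightarrow> site set \<Rightarrow> site set" where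
  "shift s K A = (K - H) \<union> (\<lambda>v. v + s) ` (K \<inter> H) \<union> A"

lemma shift_into:
  assumes "vacant H K" "s \<in> dirs" shows "(\<lambda>v. v + s) ` (K \<inter> H) \<subseteq> H"
proof
  fix x assume "x \<in> (\<lambda>v. v + s) ` (K \<inter> H)"
  then obtain v where v: "v \<in> K" "v \<in> H" "x = v + s" by blast
  then have "(v, s) \<notin> bd H" using assms(1) by (auto simp: vacant_def)
  then show "x \<in> H" using v assms(2) by (simp add: bd_iff)
qed

text \<open>
The result has untouched, translated and freed sites. A site outside the hole that is adjacent to one inside is vacant. Freed
sites have equal parity. If a freed site \<open>c\<close> were adjacent to a translate \<open>x + s\<close>, then \<open>x\<close> would be
adjacent to \<open>c - s\<close>, which is outside the hole, and so \<open>x\<close> would be vacant.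
\<close>

lemma shift_indep:
  assumes K: "K \<in> indep_sets_of z2_adj" and vac: "vacant H K" and s: "s \<in> dirs"
    and A: "A \<subseteq> {v. (v, - s) \<in> bd H}"
  shows "shift s K A \<in> indep_sets_of z2_adj"
proof -
  have indep: "x \<in> K \<Longrightarrow> x + d \<in> K \<Longrightarrow> d \<in> dirs \<Longrightarrow> False" for x d
    using K z2_adj_add_dir[of d x] by (auto simp: indep_sets_of_def)
  have vacD: "(v, d) \<in> bd H \<Longrightarrow> v \<notin> K \<and> v + d \<notin> K" for v d
    using vac by (auto simp: vacant_def)
  have AH: "A \<subseteq> H" using A by (auto simp: bd_def)
  note into = shift_into[OF vac s]
  have no: False if u: "u \<in> shift s K A" and v: "u + d \<in> shift s K A" and d: "d \<in> dirs" for u d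
  proof -
    have d': "- d \<in> dirs" using uminus_dirs[OF d] .
    have outside: False if "x \<in> K - H" "x + e \<in> H" "e \<in> dirs" for x e
      using vacD[of "x + e" "- e"] that uminus_dirs[of e] by (auto simp: bd_def)
    have mixed: False if x: "x \<in> K \<inter> H" and c: "c \<in> A" and e: "e \<in> dirs" "c = (x + s) + e" for x c e
    proof -
      have cs: "c + - s \<notin> H" using c A by (auto simp: bd_def)
      then have "(x, e) \<in> bd H" using x e by (auto simp: bd_def add_ac)
      then show False using vacD x by blast
    qed
    consider "u \<in> K - H" | x where "x \<in> K \<inter> H" "u = x + s" | "u \<in> A"
      using u unfolding shift_def by blast
    then show False
    proof cases
      case 1
      then have "u + d \<in> H \<Longrightarrow> False" using outside d by blast
      then show False using v 1 into AH indep[OF _ _ d, of u] by (auto simp: shift_def)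
    next
      case (2 x)
      then have uH: "u \<in> H" using into by auto
      consider "u + d \<in> K - H" | y where "y \<in> K \<inter> H" "u + d = y + s" | "u + d \<in> A"
        using v unfolding shift_def by blast
      then show False
      proof cases
        case 1
        then show False using outside[of "u + d" "- d"] uH d' by simp
      next
        case (2 y)
        then have "y = x + d" using \<open>u = x + s\<close> by (simp add: algebra_simps)
        then show False using indep[of x d] d 2 \<open>x \<in> K \<inter> H\<close> by blast
      next
        case 3
        then show False using mixed[of x "u + d" d] \<open>x \<in> K \<inter> H\<close> \<open>u = x + s\<close> d by simp
      qed
    next
      case 3
      consider "u + d \<in> K - H" | y where "y \<in> K \<inter> H" "u + d = y + s" | "u + d \<in> A"
        using v unfolding shift_def by blast
      then show False
      proof cases
        case 1
        then show False using outside[of "u + d" "- d"] 3 AH d' by auto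
      next
        case (2 y)
        then have "u = (y + s) + (- d)" by (simp add: algebra_simps)
        then show False using mixed[of y u "- d"] 2 3 d' by blast
      next
        case 4: 3
        then have "even_site u = inner" "even_site (u + d) = inner"
          using 3 A inner_site by blast+
        then show False using even_site_add_dir[OF d] by simp
      qed
    qed
  qed
  then show ?thesis
    unfolding indep_sets_of_def by (auto elim!: z2_adjE)
qed

text \<open>
The configuration and the set of added sites can be recovered from the result, because a translate of
a site of the hole is never a freed site.
\<close>

lemma shift_parts:
  assumes vac: "vacant H K" and s: "s \<in> dirs" and A: "A \<subseteq> {v. (v, - s) \<in> bd H}"
  shows "shift s K A - H = K - H" "shift s K A \<inter> {v. (v, - s) \<in> bd H} = A"
    "K \<inter> H = {x. x + s \<in> shift s K A \<inter> H - {v. (v, - s) \<in> bd H}}"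
proof -
  note into = shift_into[OF vac s]
  have AH: "A \<subseteq> H" using A by (auto simp: bd_def)
  have disj: "x + s \<notin> {v. (v, - s) \<in> bd H}" if "x \<in> H" for x
    using that by (auto simp: bd_def)
  show "shift s K A - H = K - H" using into AH by (auto simp: shift_def)
  show "shift s K A \<inter> {v. (v, - s) \<in> bd H} = A"
  proof (intro equalityI subsetI)
    fix x assume x: "x \<in> shift s K A \<inter> {v. (v, - s) \<in> bd H}"
    then have "x \<in> H" "x + - s \<notin> H" by (auto simp: bd_def)
    then show "x \<in> A" using x by (auto simp: shift_def)
  next
    fix x assume "x \<in> A" then show "x \<in> shift s K A \<inter> {v. (v, - s) \<in> bd H}"
      using A by (auto simp: shift_def)
  qed
  show "K \<inter> H = {x. x + s \<in> shift s K A \<inter> H - {v. (v, - s) \<in> bd H}}"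
  proof (intro equalityI subsetI)
    fix x assume "x \<in> K \<inter> H"
    then show "x \<in> {x. x + s \<in> shift s K A \<inter> H - {v. (v, - s) \<in> bd H}}"
      using into disj[of x] by (auto simp: shift_def)
  next
    fix x assume "x \<in> {x. x + s \<in> shift s K A \<inter> H - {v. (v, - s) \<in> bd H}}"
    then show "x \<in> K \<inter> H" using A by (auto simp: shift_def)
  qed
qed

lemma card_shift:
  assumes vac: "vacant H K" and s: "s \<in> dirs" and A: "A \<subseteq> {v. (v, - s) \<in> bd H}"
    and \<Lambda>: "H \<subseteq> \<Lambda>" "finite \<Lambda>"
  shows "card (shift s K A \<inter> \<Lambda>) = card (K \<inter> \<Lambda>) + card A"
proof -
  note into = shift_into[OF vac s]
  have AH: "A \<subseteq> H" using A by (auto simp: bd_def)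
  have disj: "x + s \<notin> A" if "x \<in> H" for x using that A by (auto simp: bd_def)
  have eq: "shift s K A \<inter> \<Lambda> = (((K - H) \<inter> \<Lambda>) \<union> (\<lambda>v. v + s) ` (K \<inter> H)) \<union> A"
    using into AH \<Lambda>(1) by (auto simp: shift_def)
  have fin: "finite A" "finite (K \<inter> H)" using AH finite_H finite_subset by auto
  have "card (shift s K A \<inter> \<Lambda>) = card (((K - H) \<inter> \<Lambda>) \<union> (\<lambda>v. v + s) ` (K \<inter> H)) + card A"
    unfolding eq by (rule card_Un_disjoint) (use fin \<Lambda> disj AH in auto)
  also have "card (((K - H) \<inter> \<Lambda>) \<union> (\<lambda>v. v + s) ` (K \<inter> H)) =
      card ((K - H) \<inter> \<Lambda>) + card ((\<lambda>v. v + s) ` (K \<inter> H))"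
    by (rule card_Un_disjoint) (use fin \<Lambda> into in auto)
  also have "card ((\<lambda>v. v + s) ` (K \<inter> H)) = card (K \<inter> H)" by (rule card_image) (auto simp: inj_on_def)
  also have "card ((K - H) \<inter> \<Lambda>) + card (K \<inter> H) = card (((K - H) \<inter> \<Lambda>) \<union> (K \<inter> H))"
    by (rule card_Un_disjoint[symmetric]) (use fin \<Lambda> in auto)
  also have "((K - H) \<inter> \<Lambda>) \<union> (K \<inter> H) = K \<inter> \<Lambda>" using \<Lambda>(1) by auto
  finally show ?thesis .
qed

text \<open>
The map that shifts and adds is injective and multiplies the weight by \<open>lam\<close> for each added site.
Summing over all sets of added sites gives the factor \<open>(1 + lam) ^ m\<close>.
\<close>

lemma peierls:
  assumes lam: "0 < lam" and \<Lambda>: "H \<subseteq> \<Lambda>" "finite \<Lambda>" and \<xi>: "\<xi> \<in> indep_sets_of z2_adj"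
    and m: "card (bd H) = 4 * m"
  shows "hc_mean z2_adj lam \<Lambda> \<xi> (\<lambda>K. of_bool (vacant H K)) \<le> 1 / (1 + lam) ^ m"
proof -
  interpret G: hard_core_graph z2_adj lam by (rule z2_hard_core_graph[OF lam])
  define s :: site where "s = (1, 0)"
  have s: "s \<in> dirs" by (simp add: s_def dirs_def)
  let ?F = "{v. (v, - s) \<in> bd H}"
  let ?V = "{K \<in> G.fibre \<Lambda> \<xi>. vacant H K}"
  let ?\<Phi> = "\<lambda>(K, A). shift s K A"
  have F: "finite ?F" by (rule finite_subset[OF _ finite_H]) (auto simp: bd_def)
  have cardF: "card ?F = m" using card_bd[OF uminus_dirs[OF s]] m by simp
  have V: "finite ?V" using G.finite_fibre[OF \<Lambda>(2)] by simp
  have inj: "inj_on ?\<Phi> (?V \<times> Pow ?F)"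
  proof (rule inj_onI, clarify)
    fix K A K' A' assume a: "vacant H K" "vacant H K'" "A \<subseteq> ?F" "A' \<subseteq> ?F" "shift s K A = shift s K' A'"
    note p = shift_parts[OF a(1) s a(3)] and p' = shift_parts[OF a(2) s a(4)]
    have "A = A'" using p(2) p'(2) a(5) by simp
    moreover have "K - H = K' - H" using p(1) p'(1) a(5) by simp
    moreover have "K \<inter> H = K' \<inter> H" using p(3) p'(3) a(5) by simp
    ultimately show "K = K' \<and> A = A'" by blast
  qed
  have img: "?\<Phi> ` (?V \<times> Pow ?F) \<subseteq> G.fibre \<Lambda> \<xi>"
  proof clarify
    fix K A assume K: "K \<in> G.fibre \<Lambda> \<xi>" "vacant H K" and A: "A \<subseteq> ?F"
    have "shift s K A - \<Lambda> = K - \<Lambda>"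
      using shift_parts(1)[OF K(2) s A] \<Lambda>(1) by blast
    then show "shift s K A \<in> G.fibre \<Lambda> \<xi>"
      using K A shift_indep[OF _ K(2) s A] by (simp add: hc_fibre_def)
  qed
  have "(\<Sum>K\<in>?V. lam ^ card (K \<inter> \<Lambda>)) * (1 + lam) ^ m = (\<Sum>K\<in>?V. \<Sum>A\<in>Pow ?F. lam ^ (card (K \<inter> \<Lambda>) + card A))"
    by (simp add: sum_power_card_Pow[OF F] cardF sum_distrib_right power_add flip: sum_distrib_left)
  also have "\<dots> = (\<Sum>(K, A)\<in>?V \<times> Pow ?F. lam ^ (card (K \<inter> \<Lambda>) + card A))"
    by (rule sum.cartesian_product)
  also have "\<dots> = (\<Sum>x\<in>?V \<times> Pow ?F. lam ^ card (?\<Phi> x \<inter> \<Lambda>))"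
    by (rule sum.cong) (auto simp: card_shift[OF _ s _ \<Lambda>])
  also have "\<dots> = (\<Sum>K\<in>?\<Phi> ` (?V \<times> Pow ?F). lam ^ card (K \<inter> \<Lambda>))"
    by (subst sum.reindex[OF inj]) simp
  also have "\<dots> \<le> G.Z \<Lambda> \<xi>"
    unfolding hc_partition_fibre using lam by (intro sum_mono2 G.finite_fibre \<Lambda> img) auto
  finally have le: "(\<Sum>K\<in>?V. lam ^ card (K \<inter> \<Lambda>)) * (1 + lam) ^ m \<le> G.Z \<Lambda> \<xi>" .
  have "hc_mean z2_adj lam \<Lambda> \<xi> (\<lambda>K. of_bool (vacant H K)) = (\<Sum>K\<in>?V. lam ^ card (K \<inter> \<Lambda>)) / G.Z \<Lambda> \<xi>"
    unfolding wmean_def hc_weight_def sum_divide_distrib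
    using G.finite_fibre[OF \<Lambda>(2)] by (intro sum.mono_neutral_cong_right) auto
  also have "\<dots> \<le> 1 / (1 + lam) ^ m"
    using le G.partition_pos[OF \<Lambda>(2) \<xi>] lam by (simp add: field_simps)
  finally show ?thesis .
qed

end

section \<open>Holes in a configuration\<close>

definition square :: "nat \<Rightarrow> site set" where
  "square n = {- int n..int n} \<times> {- int n..int n}"

definition parity_class :: "bool \<Rightarrow> site set" where
  "parity_class i = {v. even_site v = i}"

definition region :: "bool \<Rightarrow> site set \<Rightarrow> site set" where
  "region i K = {v. even_site v = i \<and> v \<in> K} \<union> {v. \<exists>u\<in>K. even_site u = i \<and> z2_adj u v}"

definition joined :: "site set \<Rightarrow> (site \<times> site) set" where
  "joined S = {(a, b). a \<in> S \<and> b \<in> S \<and> z2_adj a b}\<^sup>*"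

definition cluster :: "site set \<Rightarrow> site \<Rightarrow> site set" where
  "cluster S x = {y. (x, y) \<in> joined S}"

definition outer :: "nat \<Rightarrow> bool \<Rightarrow> site set \<Rightarrow> site set" where
  "outer n i K = {v. \<exists>u. u \<notin> square n \<and> (u, v) \<in> joined (region i K)}"

lemma joined_sym: "(a, b) \<in> joined S \<Longrightarrow> (b, a) \<in> joined S"
  unfolding joined_def by (rule symD[OF sym_rtrancl]) (auto simp: sym_def intro: z2_adj_sym)

lemma joined_mono: "S \<subseteq> T \<Longrightarrow> (a, b) \<in> joined S \<Longrightarrow> (a, b) \<in> joined T"
  unfolding joined_def by (erule rtrancl_mono[THEN subsetD, rotated]) auto

lemma joined_refl: "(a, a) \<in> joined S"
  by (simp add: joined_def)

lemma joined_trans: "(a, b) \<in> joined S \<Longrightarrow> (b, c) \<in> joined S \<Longrightarrow> (a, c) \<in> joined S"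
  unfolding joined_def by (rule rtrancl_trans)

lemma joined_step: "(a, b) \<in> joined S \<Longrightarrow> b \<in> S \<Longrightarrow> c \<in> S \<Longrightarrow> z2_adj b c \<Longrightarrow> (a, c) \<in> joined S"
  unfolding joined_def by (erule rtrancl_into_rtrancl) simp

lemma joined_mem: "(a, b) \<in> joined S \<Longrightarrow> a \<in> S \<Longrightarrow> b \<in> S"
  unfolding joined_def by (induction rule: rtrancl_induct) auto

lemma joined_start: "(a, b) \<in> joined S \<Longrightarrow> a \<noteq> b \<Longrightarrow> a \<in> S"
  unfolding joined_def by (auto elim: converse_rtranclE)

lemma cluster_const:
  assumes f: "\<And>u v. u \<in> cluster S x \<Longrightarrow> v \<in> cluster S x \<Longrightarrow> z2_adj u v \<Longrightarrow> f u = f v"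
    and y: "(x, y) \<in> joined S"
  shows "f y = f x"
proof -
  have "(x, y) \<in> joined S \<and> f y = f x"
    using y[unfolded joined_def]
  proof (induction rule: rtrancl_induct)
    case (step y z)
    then have "(x, z) \<in> joined S" using joined_step by blast
    then show ?case using step f[of y z] by (simp add: cluster_def)
  qed (simp add: joined_refl)
  then show ?thesis ..
qed

lemma linked_cluster: "linked (cluster S x)"
  unfolding linked_def
proof (intro allI impI ballI)
  fix f :: "site \<Rightarrow> bool" and u v
  assume f: "\<forall>u\<in>cluster S x. \<forall>v\<in>cluster S x. z2_adj u v \<longrightarrow> f u = f v"
    and uv: "u \<in> cluster S x" "v \<in> cluster S x"
  have "f y = f x" if "(x, y) \<in> joined S" for y
    by (rule cluster_const[OF _ that]) (use f in blast)
  then show "f u = f v" using uv by (simp add: cluster_def)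
qed

lemma column_const:
  fixes f :: "site \<Rightarrow> bool"
  assumes "\<And>y. f (x, y + 1) = f (x, y)" shows "f (x, y) = f (x, y')"
proof -
  have "f (x, y) = f (x, 0)" for y
    by (induction y rule: int_induct[where k = 0]) (use assms assms[of "_ - 1"] in auto)
  then show ?thesis by blast
qed

lemma row_const:
  fixes f :: "site \<Rightarrow> bool"
  assumes "\<And>x. f (x + 1, y) = f (x, y)" shows "f (x, y) = f (x', y)"
  using column_const[of "\<lambda>(a, b). f (b, a)" y x x'] assms by simp

lemma linked_compl_square: "linked (- square n)"
  unfolding linked_def
proof (intro allI impI ballI)
  fix f :: "site \<Rightarrow> bool" and u v
  assume f: "\<forall>u\<in>- square n. \<forall>v\<in>- square n. z2_adj u v \<longrightarrow> f u = f v" and uv: "u \<in> - square n" "v \<in> - square n"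
  define N where "N = int n + 1"
  have mem: "(x, y) \<in> - square n" if "\<bar>x\<bar> > int n \<or> \<bar>y\<bar> > int n" for x y
    using that by (auto simp: square_def)
  have local_const: "f (x, y) = f (x', y')"
    if "z2_adj (x, y) (x', y')" "\<bar>x\<bar> > int n \<or> \<bar>y\<bar> > int n" "\<bar>x'\<bar> > int n \<or> \<bar>y'\<bar> > int n" for x y x' y'
    using f mem[OF that(2)] mem[OF that(3)] that(1) by blast
  have col: "f (x, y) = f (x, y')" if "\<bar>x\<bar> > int n" for x y y'
  proof (rule column_const)
    show "f (x, y + 1) = f (x, y)" for y
      using local_const[of x "y + 1" x y] that by (simp add: z2_adj_def)
  qed
  have row: "f (x, y) = f (x', y)" if "\<bar>y\<bar> > int n" for x x' y
  proof (rule row_const)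
    show "f (x + 1, y) = f (x, y)" for x
      using local_const[of "x + 1" y x y] that by (simp add: z2_adj_def)
  qed
  have "f (x, y) = f (N, N)" if out: "(x, y) \<in> - square n" for x y
  proof (cases "\<bar>x\<bar> > int n")
    case True
    then show ?thesis using col[of x y N] row[of N x N] by (simp add: N_def)
  next
    case False
    then have "\<bar>y\<bar> > int n" using out by (auto simp: square_def)
    then show ?thesis using row[of y x N] col[of N y N] by (simp add: N_def)
  qed
  then show "f u = f v" using uv by (metis surj_pair)
qed

lemma finite_square: "finite (square n)"
  by (simp add: square_def)

lemma square_mono: "m \<le> n \<Longrightarrow> square m \<subseteq> square n"
  by (auto simp: square_def)

lemma square_step: "u \<in> square n \<Longrightarrow> z2_adj u v \<Longrightarrow> v \<in> square (Suc n)"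
  by (cases u; cases v) (auto simp: square_def z2_adj_def)

lemma parity_class_indep: "parity_class i \<in> indep_sets_of z2_adj"
  using z2_adj_even by (auto simp: parity_class_def indep_sets_of_def)

lemma region_disjoint:
  assumes "K \<in> indep_sets_of z2_adj" shows "region i K \<inter> region (\<not> i) K = {}"
proof -
  have indep: "u \<in> K \<Longrightarrow> v \<in> K \<Longrightarrow> \<not> z2_adj u v" for u v using assms by (auto simp: indep_sets_of_def)
  have "v \<notin> region (\<not> i) K" if "v \<in> region i K" for v
    using that indep z2_adj_even unfolding region_def by blast
  then show ?thesis by blast
qed

text \<open>
Each column that meets the set contains a boundary bond above its topmost site; similarly for rows.
\<close>

lemma card_coordinates_le_bd:
  assumes "finite H"
  shows "card (fst ` H) \<le> card (bd H)" "card (snd ` H) \<le> card (bd H)"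
proof -
  have "fst ` H \<subseteq> (\<lambda>e. fst (fst e)) ` bd H"
  proof clarify
    fix a b assume ab: "(a, b) \<in> H"
    let ?S = "{y. (a, y) \<in> H}"
    have fin: "finite ?S" by (rule finite_subset[of _ "snd ` H"]) (use assms in \<open>force+\<close>)
    then have max: "Max ?S \<in> ?S" using ab by (intro Max_in) auto
    have "(a, Max ?S + 1) \<notin> H" using Max_ge[OF fin, of "Max ?S + 1"] by auto
    then have "((a, Max ?S), (0, 1)) \<in> bd H" using max by (simp add: bd_iff dirs_def)
    then show "fst (a, b) \<in> (\<lambda>e. fst (fst e)) ` bd H" by force
  qed
  then show "card (fst ` H) \<le> card (bd H)" by (rule surj_card_le[OF finite_bd[OF assms]])
  have "snd ` H \<subseteq> (\<lambda>e. snd (fst e)) ` bd H"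
  proof clarify
    fix a b assume ab: "(a, b) \<in> H"
    let ?S = "{x. (x, b) \<in> H}"
    have fin: "finite ?S" by (rule finite_subset[of _ "fst ` H"]) (use assms in \<open>force+\<close>)
    then have max: "Max ?S \<in> ?S" using ab by (intro Max_in) auto
    have "(Max ?S + 1, b) \<notin> H" using Max_ge[OF fin, of "Max ?S + 1"] by auto
    then have "((Max ?S, b), (1, 0)) \<in> bd H" using max by (simp add: bd_iff dirs_def)
    then show "snd (a, b) \<in> (\<lambda>e. snd (fst e)) ` bd H" by force
  qed
  then show "card (snd ` H) \<le> card (bd H)" by (rule surj_card_le[OF finite_bd[OF assms]])
qed

lemma linked_between:
  fixes g :: "site \<Rightarrow> int"
  assumes H: "linked H" "x \<in> H" "y \<in> H" and g: "\<And>u v. z2_adj u v \<Longrightarrow> \<bar>g u - g v\<bar> \<le> 1"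
  shows "{g x..g y} \<subseteq> g ` H"
proof
  fix c assume c: "c \<in> {g x..g y}"
  show "c \<in> g ` H"
  proof (rule ccontr)
    assume no: "c \<notin> g ` H"
    let ?f = "\<lambda>u. g u < c"
    have "?f x = ?f y"
    proof (rule linkedD[OF H(1) _ H(2,3), where f = ?f])
      fix u v assume "u \<in> H" "v \<in> H" "z2_adj u v"
      then have "g u \<noteq> c" "g v \<noteq> c" "\<bar>g u - g v\<bar> \<le> 1" using no g by auto
      then show "?f u = ?f v" by linarith
    qed
    moreover have "g x \<noteq> c" "g y \<noteq> c" using no H by auto
    ultimately show False using c by auto
  qed
qed

lemma diameter_le_card_bd:
  assumes "finite H" "linked H" "x \<in> H" "y \<in> H"
  shows "\<bar>fst x - fst y\<bar> \<le> int (card (bd H))" "\<bar>snd x - snd y\<bar> \<le> int (card (bd H))"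
proof -
  have span: "g v - g u \<le> int (card (g ` H))"
    if uv: "u \<in> H" "v \<in> H" and g: "\<And>u v. z2_adj u v \<Longrightarrow> \<bar>g u - g v\<bar> \<le> 1" for g :: "site \<Rightarrow> int" and u v
  proof -
    have "{g u..g v} \<subseteq> g ` H" by (rule linked_between[OF assms(2) uv]) (rule g)
    then have "card {g u..g v} \<le> card (g ` H)" by (rule card_mono[OF finite_imageI[OF assms(1)]])
    then show ?thesis by simp
  qed
  have lip: "z2_adj u v \<Longrightarrow> \<bar>fst u - fst v\<bar> \<le> 1" "z2_adj u v \<Longrightarrow> \<bar>snd u - snd v\<bar> \<le> 1" for u v
    by (auto simp: z2_adj_def)
  show "\<bar>fst x - fst y\<bar> \<le> int (card (bd H))"
    using span[of x y fst] span[of y x fst] lip(1) assms(3,4) card_coordinates_le_bd(1)[OF assms(1)] by fastforce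
  show "\<bar>snd x - snd y\<bar> \<le> int (card (bd H))"
    using span[of x y snd] span[of y x snd] lip(2) assms(3,4) card_coordinates_le_bd(2)[OF assms(1)] by fastforce
qed

locale boundary_config =
  fixes n :: nat and i :: bool and K :: "site set"
  assumes K: "K \<in> hc_fibre z2_adj (square n) (parity_class i)"
begin

lemma K_indep: "K \<in> indep_sets_of z2_adj"
  using K by (simp add: hc_fibre_def)

lemma compl_square_region: "- square n \<subseteq> region i K"
proof
  have occupied: "v \<in> K" if "v \<notin> square n" "even_site v = i" for v
    using K that by (auto simp: hc_fibre_def parity_class_def)
  fix v assume v: "v \<in> - square n"
  show "v \<in> region i K"
  proof (cases "even_site v = i")
    case True
    then show ?thesis using occupied v by (simp add: region_def)
  next
    case False
    obtain x y where xy: "v = (x, y)" by (cases v)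
    have "\<exists>d\<in>dirs. v + d \<notin> square n"
      using v unfolding xy square_def dirs_def by auto
    then obtain d where d: "d \<in> dirs" "v + d \<notin> square n" by blast
    then have "v + d \<in> K" "even_site (v + d) = i"
      using occupied even_site_add_dir[OF d(1), of v] False by auto
    then show ?thesis
      using z2_adj_sym[OF z2_adj_add_dir[OF d(1), of v]] by (auto simp: region_def)
  qed
qed

abbreviation R where "R \<equiv> outer n i K"

lemma compl_square_R: "- square n \<subseteq> R"
  unfolding outer_def using joined_refl by blast

lemma R_region: "R \<subseteq> region i K"
  using compl_square_region joined_mem by (auto simp: outer_def)

lemma R_closed: "u \<in> R \<Longrightarrow> v \<in> region i K \<Longrightarrow> z2_adj u v \<Longrightarrow> v \<in> R"
  using R_region joined_step unfolding outer_def by blast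

lemma linked_R: "linked R"
  unfolding linked_def
proof (intro allI impI ballI)
  fix f :: "site \<Rightarrow> bool" and u v
  assume f: "\<forall>u\<in>R. \<forall>v\<in>R. z2_adj u v \<longrightarrow> f u = f v" and uv: "u \<in> R" "v \<in> R"
  have base: "f a = f b" if "a \<notin> square n" "b \<notin> square n" for a b
    by (rule linkedD[OF linked_compl_square[of n]]) (use f compl_square_R that in blast)+
  have "\<exists>a. a \<notin> square n \<and> f x = f a" if x: "x \<in> R" for x
  proof -
    obtain a where a: "a \<notin> square n" "(a, x) \<in> joined (region i K)" using x by (auto simp: outer_def)
    have sub: "cluster (region i K) a \<subseteq> R" unfolding cluster_def outer_def using a(1) by blast
    have "f x = f a" by (rule cluster_const[OF _ a(2)]) (use f sub in blast)
    then show ?thesis using a(1) by blast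
  qed
  then show "f u = f v" using base uv by metis
qed

definition hole_at :: "site \<Rightarrow> site set" where
  "hole_at x = cluster (- R) x"

context
  fixes x assumes x: "x \<notin> R"
begin

lemma hole_at_compl: "hole_at x \<subseteq> - R"
proof
  fix y assume "y \<in> hole_at x"
  then show "y \<in> - R" using joined_mem[of x y "- R"] x by (simp add: hole_at_def cluster_def)
qed

lemma hole_at_square: "hole_at x \<subseteq> square n"
  using hole_at_compl compl_square_R by blast

lemma hole_at_self: "x \<in> hole_at x"
  by (simp add: hole_at_def cluster_def joined_refl)

lemma hole_at_closed: "u \<in> hole_at x \<Longrightarrow> v \<notin> R \<Longrightarrow> z2_adj u v \<Longrightarrow> v \<in> hole_at x"
  using hole_at_compl joined_step unfolding hole_at_def cluster_def by blast

text \<open>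
Let \<open>v\<close> in the hole and \<open>u\<close> in \<open>R\<close> be adjacent. Then \<open>v\<close> is not in the region, as it would belong to \<open>R\<close>.
So \<open>u\<close> is not an occupied site of parity \<open>i\<close>, but a vacant neighbour of one; this determines the
parities, and \<open>v\<close> is vacant, not being in the region.
\<close>

lemma hole_at_bd:
  assumes "(v, d) \<in> bd (hole_at x)"
  shows "v + d \<in> R" "v \<notin> region i K" "v \<notin> K" "v + d \<notin> K" "even_site v = i"
proof -
  have v: "v \<in> hole_at x" "d \<in> dirs" "v + d \<notin> hole_at x" using assms by (auto simp: bd_iff)
  have adj: "z2_adj v (v + d)" by (rule z2_adj_add_dir[OF v(2)])
  show out: "v + d \<in> R" using hole_at_closed[OF v(1) _ adj] v(3) by blast
  show nW: "v \<notin> region i K"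
    using R_closed[OF out _ z2_adj_sym[OF adj]] hole_at_compl v(1) by blast
  have "v + d \<in> region i K" using out R_region by blast
  moreover have "\<not> (even_site (v + d) = i \<and> v + d \<in> K)"
    using nW z2_adj_sym[OF adj] unfolding region_def by blast
  ultimately obtain u where u: "u \<in> K" "even_site u = i" "z2_adj u (v + d)"
    unfolding region_def by blast
  show "v + d \<notin> K" using u K_indep by (auto simp: indep_sets_of_def)
  show even: "even_site v = i" using z2_adj_even[OF u(3)] z2_adj_even[OF adj] u(2) by blast
  show "v \<notin> K" using nW even unfolding region_def by blast
qed

lemma vacant_hole_at: "vacant (hole_at x) K"
  using hole_at_bd(3,4) by (auto simp: vacant_def)

end

lemma hole_at_leaves:
  assumes "x \<notin> R" obtains v d where "v \<in> hole_at x" "d \<in> dirs" "v + d \<in> R"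
proof -
  have fin: "finite (hole_at x)" using hole_at_square[OF assms] finite_square finite_subset by blast
  have "fst ` hole_at x \<noteq> {}" using hole_at_self[OF assms] by blast
  then have "card (fst ` hole_at x) \<noteq> 0" using fin by simp
  then have "card (bd (hole_at x)) \<noteq> 0" using card_coordinates_le_bd(1)[OF fin] by simp
  then have "bd (hole_at x) \<noteq> {}" by auto
  then obtain v d where "(v, d) \<in> bd (hole_at x)" by auto
  then show ?thesis using that[of v d] hole_at_bd(1)[OF assms, of v d] by (simp add: bd_iff)
qed

text \<open>
The complement of a hole is \<open>R\<close> together with the other holes, each of which is adjacent to \<open>R\<close>.
\<close>

lemma linked_compl_hole_at:
  assumes x: "x \<notin> R" shows "linked (- hole_at x)"
  unfolding linked_def
proof (intro allI impI ballI)
  fix f :: "site \<Rightarrow> bool" and u v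
  assume f: "\<forall>u\<in>- hole_at x. \<forall>v\<in>- hole_at x. z2_adj u v \<longrightarrow> f u = f v"
    and uv: "u \<in> - hole_at x" "v \<in> - hole_at x"
  have RH: "R \<subseteq> - hole_at x" using hole_at_compl[OF x] by blast
  have base: "f a = f b" if "a \<in> R" "b \<in> R" for a b
    by (rule linkedD[OF linked_R _ that]) (use f RH in blast)
  have "\<exists>a\<in>R. f y = f a" if y: "y \<in> - hole_at x" for y
  proof (cases "y \<in> R")
    case False
    have disj: "hole_at y \<subseteq> - hole_at x"
    proof
      fix z assume z: "z \<in> hole_at y"
      show "z \<in> - hole_at x"
      proof
        assume "z \<in> hole_at x"
        then have "(x, y) \<in> joined (- R)"
          using z joined_trans[of x z "- R" y] joined_sym[of y z "- R"] by (simp add: hole_at_def cluster_def)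
        then show False using y by (simp add: hole_at_def cluster_def)
      qed
    qed
    obtain v d where vd: "v \<in> hole_at y" "d \<in> dirs" "v + d \<in> R"
      using hole_at_leaves[OF False] by blast
    have "f v = f y"
    proof (rule cluster_const)
      show "(y, v) \<in> joined (- R)" using vd(1) by (simp add: hole_at_def cluster_def)
      show "f a = f b" if "a \<in> cluster (- R) y" "b \<in> cluster (- R) y" "z2_adj a b" for a b
        using f disj that unfolding hole_at_def by blast
    qed
    moreover have "f v = f (v + d)"
      using f disj vd RH z2_adj_add_dir[OF vd(2)] by blast
    ultimately show ?thesis using vd(3) by blast
  qed auto
  then show "f u = f v" using base uv by metis
qed

lemma hole_hole_at:
  assumes x: "x \<notin> R" shows "hole (hole_at x) i"
proof
  show "finite (hole_at x)" using hole_at_square[OF x] finite_square finite_subset by blast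
  show "hole_at x \<noteq> {}" using hole_at_self[OF x] by blast
  show "even_site v = i" if "(v, d) \<in> bd (hole_at x)" for v d using hole_at_bd(5)[OF x that] .
  show "linked (hole_at x)" unfolding hole_at_def by (rule linked_cluster)
qed (rule linked_compl_hole_at[OF x])

end

section \<open>Crossing events and phase coexistence\<close>

definition seg :: "nat \<Rightarrow> site set" where
  "seg M = (\<lambda>a. (int a, 0)) ` {..M}"

definition long_hole :: "nat \<Rightarrow> bool \<Rightarrow> nat \<Rightarrow> site set \<Rightarrow> bool" where
  "long_hole n i M K \<longleftrightarrow>
     (\<exists>x\<in>seg M. x \<notin> outer n i K \<and> M \<le> card (bd (boundary_config.hole_at n i K x)))"

text \<open>
Intersecting with a square makes this a local event.
\<close>

definition crossing :: "bool \<Rightarrow> nat \<Rightarrow> site set \<Rightarrow> bool" where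
  "crossing j M K \<longleftrightarrow> (\<exists>x\<in>seg M. \<exists>y. y \<notin> square (2 * M) \<and>
     (x, y) \<in> joined (region j K \<inter> square (Suc (2 * M))))"

lemma seg_square: "seg M \<subseteq> square (2 * M)"
  by (auto simp: seg_def square_def)

lemma crossing_local: "crossing j M K \<longleftrightarrow> crossing j M (K \<inter> square (Suc (Suc (2 * M))))"
proof -
  let ?Q = "square (Suc (2 * M))" and ?Q' = "square (Suc (Suc (2 * M)))"
  have "v \<in> ?Q'" if "v \<in> ?Q" for v using that square_mono[of "Suc (2 * M)" "Suc (Suc (2 * M))"] by auto
  moreover have "u \<in> ?Q'" if "v \<in> ?Q" "z2_adj u v" for u v
    using square_step[OF that(1) z2_adj_sym[OF that(2)]] .
  ultimately have "region j K \<inter> ?Q = region j (K \<inter> ?Q') \<inter> ?Q"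
    unfolding region_def by blast
  then show ?thesis by (simp add: crossing_def)
qed

lemma joined_first_exit:
  assumes "(x, u) \<in> joined S" "x \<in> square m" "u \<notin> square m"
  obtains y where "y \<notin> square m" "(x, y) \<in> joined (S \<inter> square (Suc m))"
proof -
  let ?J = "joined (S \<inter> square (Suc m))"
  have "(\<exists>y. y \<notin> square m \<and> (x, y) \<in> ?J) \<or> (u \<in> square m \<and> (x, u) \<in> ?J)"
    using assms(1)[unfolded joined_def]
  proof (induction rule: rtrancl_induct)
    case base
    then show ?case using assms(2) joined_refl by blast
  next
    case (step u v)
    from step.IH show ?case
    proof
      assume u: "u \<in> square m \<and> (x, u) \<in> ?J"
      have uv: "u \<in> S" "v \<in> S" "z2_adj u v" using step.hyps(2) by auto
      have "v \<in> square (Suc m)" using square_step[of u m v] u uv(3) by blast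
      moreover have "u \<in> square (Suc m)" using u square_mono[of m "Suc m"] by auto
      ultimately have "(x, v) \<in> ?J"
        using u uv by (intro joined_step[of x u "S \<inter> square (Suc m)" v]) simp_all
      then show ?thesis by blast
    qed blast
  qed
  then show ?thesis using assms(3) that by blast
qed

context boundary_config
begin

text \<open>
If \<open>R\<close> misses the segment, then the whole segment lies in one hole, whose boundary is long. Otherwise
a site of the segment is connected to the outside of the big square.
\<close>

lemma crossing_if_no_long_hole:
  assumes "\<not> long_hole n i M K" "2 * M \<le> n"
  shows "crossing i M K"
proof (cases "\<exists>x\<in>seg M. x \<in> R")
  case True
  then obtain x u where x: "x \<in> seg M" "u \<notin> square n" "(u, x) \<in> joined (region i K)"
    by (auto simp: outer_def)
  have "u \<notin> square (2 * M)" using x(2) square_mono[OF assms(2)] by blast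
  moreover have "x \<in> square (2 * M)" using x(1) seg_square by blast
  ultimately show ?thesis
    using joined_first_exit[OF joined_sym[OF x(3)]] x(1) unfolding crossing_def by metis
next
  case False
  have 0: "(0, 0) \<in> seg M" by (auto simp: seg_def image_iff intro: bexI[of _ 0])
  then have out: "(0, 0) \<notin> R" using False by blast
  have "((0, 0), (int a, 0)) \<in> joined (- R)" if "a \<le> M" for a
    using that
  proof (induction a)
    case (Suc a)
    have "(int b, 0) \<in> seg M" if "b \<le> M" for b using that by (auto simp: seg_def)
    from this[of a] this[of "Suc a"] Suc.prems
    have "(int a, 0) \<in> - R" "(int (Suc a), 0) \<in> - R" using False by auto
    moreover have "z2_adj (int a, 0) (int (Suc a), 0)" by (simp add: z2_adj_def)
    moreover have "((0, 0), (int a, 0)) \<in> joined (- R)" using Suc.IH Suc.prems by linarith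
    ultimately show ?case using joined_step by blast
  qed (simp add: joined_refl)
  then have "int ` {..M} \<subseteq> fst ` hole_at (0, 0)"
    by (force simp: hole_at_def cluster_def image_iff)
  moreover have fin: "finite (hole_at (0, 0))"
    using hole_at_square[OF out] finite_square finite_subset by blast
  ultimately have "card (int ` {..M}) \<le> card (fst ` hole_at (0, 0))" by (intro card_mono) auto
  also have "\<dots> \<le> card (bd (hole_at (0, 0)))" by (rule card_coordinates_le_bd(1)[OF fin])
  finally have "M \<le> card (bd (hole_at (0, 0)))" by (simp add: card_image)
  then show ?thesis using assms(1) 0 out unfolding long_hole_def by blast
qed

text \<open>
The region of the other parity is disjoint from \<open>R\<close>. A connected piece of it lies in one hole, which
has a long boundary if the piece has large diameter.
\<close>

lemma no_crossing_if_no_long_hole: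
  assumes "\<not> long_hole n i M K"
  shows "\<not> crossing (\<not> i) M K"
proof
  assume "crossing (\<not> i) M K"
  then obtain x y where xy: "x \<in> seg M" "y \<notin> square (2 * M)"
    "(x, y) \<in> joined (region (\<not> i) K \<inter> square (Suc (2 * M)))" by (auto simp: crossing_def)
  have sub: "region (\<not> i) K \<subseteq> - R" using region_disjoint[OF K_indep, of i] R_region by blast
  have "x \<noteq> y" using xy(1,2) seg_square by blast
  then have "x \<in> region (\<not> i) K" using joined_start[OF xy(3)] by blast
  then have x: "x \<notin> R" using sub by blast
  have "(x, y) \<in> joined (- R)" by (rule joined_mono[OF _ xy(3)]) (use sub in blast)
  then have y: "y \<in> hole_at x" by (simp add: hole_at_def cluster_def)
  interpret H: hole "hole_at x" i by (rule hole_hole_at[OF x])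
  note diam = diameter_le_card_bd[OF H.finite_H H.linked_H hole_at_self[OF x] y]
  obtain a where a: "x = (int a, 0)" "a \<le> M" using xy(1) by (auto simp: seg_def)
  have "int M \<le> int (card (bd (hole_at x)))"
    using diam xy(2) a by (cases y) (auto simp: square_def)
  then show False using assms xy(1) x unfolding long_hole_def by auto
qed

text \<open>
Going right from a site of the hole, the first exit gives a boundary bond. It is reached
within fewer steps than there are boundary bonds, since each column passed contains one.
\<close>

lemma long_hole_edge:
  assumes "long_hole n i M K"
  obtains a k l H where "a \<le> M" "M \<le> l" "l \<le> 4 * card (square n)" "k < l"
    "hole H i" "((int (a + k), 0), (1, 0)) \<in> bd H" "card (bd H) = l" "H \<subseteq> square n" "vacant H K"
proof -
  obtain a where a: "a \<le> M" and x: "(int a, 0) \<notin> R" and len: "M \<le> card (bd (hole_at (int a, 0)))"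
    using assms by (auto simp: long_hole_def seg_def)
  let ?x = "(int a, 0)" and ?H = "hole_at (int a, 0)"
  interpret H: hole ?H i by (rule hole_hole_at[OF x])
  have "bd ?H \<subseteq> ?H \<times> dirs" by (auto simp: bd_iff)
  then have "card (bd ?H) \<le> card (?H \<times> dirs)" by (intro card_mono finite_cartesian_product H.finite_H) auto
  also have "\<dots> \<le> 4 * card (square n)"
    using card_mono[OF finite_square hole_at_square[OF x]] by (simp add: card_cartesian_product dirs_def)
  finally have upper: "card (bd ?H) \<le> 4 * card (square n)" .
  have "\<exists>k. (int (a + k) + 1, 0) \<notin> ?H"
  proof (rule ccontr)
    assume "\<not> ?thesis"
    then have "(\<lambda>k. (int (a + k) + 1, 0)) ` UNIV \<subseteq> ?H" by auto
    moreover have "inj (\<lambda>k :: nat. (int (a + k) + 1, 0 :: int))" by (auto simp: inj_on_def)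
    ultimately show False using H.finite_H by (meson finite_imageD finite_subset infinite_UNIV_nat)
  qed
  define k where "k = (LEAST k. (int (a + k) + 1, 0) \<notin> ?H)"
  have k: "(int (a + k) + 1, 0) \<notin> ?H" unfolding k_def by (rule LeastI_ex) fact
  have before: "(int (a + j), 0) \<in> ?H" if "j \<le> k" for j
  proof (cases j)
    case 0
    then show ?thesis using hole_at_self[OF x] by simp
  next
    case (Suc j')
    then have "(int (a + j') + 1, 0) \<in> ?H"
      using that not_less_Least[of j' "\<lambda>k. (int (a + k) + 1, 0) \<notin> ?H"] unfolding k_def by auto
    then show ?thesis using Suc by (simp add: add_ac)
  qed
  have "(\<lambda>j. int (a + j)) ` {..k} \<subseteq> fst ` ?H" using before by force
  then have "card ((\<lambda>j. int (a + j)) ` {..k}) \<le> card (fst ` ?H)" by (intro card_mono) (simp_all add: H.finite_H)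
  also have "\<dots> \<le> card (bd ?H)" by (rule card_coordinates_le_bd(1)[OF H.finite_H])
  finally have "k < card (bd ?H)" by (simp add: card_image inj_on_def)
  moreover have "((int (a + k), 0), (1, 0)) \<in> bd ?H"
    using before[of k] k by (simp add: bd_iff dirs_def)
  ultimately show ?thesis
    using that[of a "card (bd ?H)" k ?H] a len upper hole_hole_at[OF x] hole_at_square[OF x]
      vacant_hole_at[OF x] by simp
qed

end

definition holes_through :: "bool \<Rightarrow> nat \<Rightarrow> nat \<Rightarrow> nat \<Rightarrow> site set set" where
  "holes_through i n a l =
     {H. hole H i \<and> ((int a, 0), (1, 0)) \<in> bd H \<and> card (bd H) = l \<and> H \<subseteq> square n}"

lemma holes_through_bound:
  assumes "2 \<le> l"
  shows "finite (holes_through i n a l)" "real (card (holes_through i n a l)) \<le> 200000 * 1.58746 ^ l"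
proof -
  obtain m where m: "l = Suc (Suc m)" using assms by (metis Suc_le_D numeral_2_eq_2 Suc_le_mono)
  let ?Hs = "{H. hole H i \<and> ((int a, 0), (1, 0)) \<in> bd H \<and> card (bd H) = Suc (Suc m)}"
  note fin = card_holes_through_edge(1)[of i "((int a, 0), (1, 0))" m]
  have sub: "holes_through i n a l \<subseteq> ?Hs" by (auto simp: holes_through_def m)
  then show "finite (holes_through i n a l)" using fin finite_subset by blast
  have "real (card (holes_through i n a l)) \<le> real (card ?Hs)" using card_mono[OF fin sub] by simp
  also have "\<dots> \<le> real (2 * continuations [] m)"
    using card_holes_through_edge(2)[of i "((int a, 0), (1, 0))" m] by (rule of_nat_mono)
  also have "\<dots> \<le> 200000 * 1.58746 ^ m" using continuations_bound[of m] by simp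
  also have "\<dots> \<le> 200000 * 1.58746 ^ l"
    by (intro mult_left_mono power_increasing) (auto simp: m)
  finally show "real (card (holes_through i n a l)) \<le> 200000 * 1.58746 ^ l" .
qed

text \<open>
The union bound over the starting point in the segment, the length of the boundary, the first exit to
the right and the hole. The factor \<open>(l + 1) * (l + 2)\<close> bounds the number of choices for the first and
third.
\<close>

lemma mean_long_hole:
  assumes lam: "0 < lam" and \<theta>: "0 < \<theta>" "\<theta> ^ 4 = 1 / (1 + lam)" and M: "2 \<le> M"
  shows "hc_mean z2_adj lam (square n) (parity_class i) (\<lambda>K. of_bool (long_hole n i M K)) \<le>
    200000 * (\<Sum>l = M..4 * card (square n). real ((l + 1) * (l + 2)) * (1.58746 * \<theta>) ^ l)"
proof -
  interpret G: hard_core_graph z2_adj lam by (rule z2_hard_core_graph[OF lam])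
  let ?N = "4 * card (square n)" and ?m = "G.mean (square n) (parity_class i)"
  let ?F = "G.fibre (square n) (parity_class i)"
  let ?Hs = "\<lambda>a k l. holes_through i n (a + k) l"
  have w: "0 \<le> G.weight (square n) (parity_class i) K" for K
    by (rule G.weight_nonneg[OF finite_square parity_class_indep])
  have "?m (\<lambda>K. of_bool (long_hole n i M K)) \<le>
      ?m (\<lambda>K. \<Sum>a\<le>M. \<Sum>l = M..?N. \<Sum>k<l. \<Sum>H\<in>?Hs a k l. of_bool (vacant H K))"
  proof (rule wmean_mono[OF w])
    fix K assume K: "K \<in> ?F"
    let ?S = "\<lambda>a l k. \<Sum>H\<in>?Hs a k l. of_bool (vacant H K) :: real"
    show "of_bool (long_hole n i M K) \<le> (\<Sum>a\<le>M. \<Sum>l = M..?N. \<Sum>k<l. ?S a l k)"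
    proof (cases "long_hole n i M K")
      case True
      interpret boundary_config n i K by unfold_locales (rule K)
      obtain a k l H where h: "a \<le> M" "M \<le> l" "l \<le> ?N" "k < l" and
        H: "hole H i" "((int (a + k), 0), (1, 0)) \<in> bd H" "card (bd H) = l" "H \<subseteq> square n" "vacant H K"
        using long_hole_edge[OF True] by metis
      have Hs: "H \<in> ?Hs a k l" using H by (simp add: holes_through_def)
      have "1 \<le> ?S a l k"
        using member_le_sum[OF Hs, of "\<lambda>H. of_bool (vacant H K) :: real"] holes_through_bound(1)[of l i n "a + k"]
          M h H(5) by simp
      also have "\<dots> \<le> (\<Sum>k<l. ?S a l k)"
        using h by (intro member_le_sum[of k _ "?S a l"]) (auto intro: sum_nonneg)
      also have "\<dots> \<le> (\<Sum>l = M..?N. \<Sum>k<l. ?S a l k)"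
        using h by (intro member_le_sum[of l _ "\<lambda>l. \<Sum>k<l. ?S a l k"]) (auto intro!: sum_nonneg)
      also have "\<dots> \<le> (\<Sum>a\<le>M. \<Sum>l = M..?N. \<Sum>k<l. ?S a l k)"
        using h by (intro member_le_sum[of a _ "\<lambda>a. \<Sum>l = M..?N. \<Sum>k<l. ?S a l k"]) (auto intro!: sum_nonneg)
      finally show ?thesis using True by simp
    qed (auto intro!: sum_nonneg)
  qed
  also have "\<dots> = (\<Sum>a\<le>M. \<Sum>l = M..?N. \<Sum>k<l. \<Sum>H\<in>?Hs a k l. ?m (\<lambda>K. of_bool (vacant H K)))"
    by (simp only: wmean_sum)
  also have "\<dots> \<le> (\<Sum>a\<le>M. \<Sum>l = M..?N. \<Sum>k<l. 200000 * (1.58746 * \<theta>) ^ l)"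
  proof (intro sum_mono)
    fix a l k assume l: "l \<in> {M..?N}"
    have "?m (\<lambda>K. of_bool (vacant H K)) \<le> \<theta> ^ l" if "H \<in> ?Hs a k l" for H
    proof -
      interpret hole H i using that by (simp add: holes_through_def)
      obtain m where m: "card (bd H) = 4 * m" using card_bd[of "(1, 0)"] by (auto simp: dirs_def)
      have "?m (\<lambda>K. of_bool (vacant H K)) \<le> 1 / (1 + lam) ^ m"
        using that by (intro peierls lam finite_square parity_class_indep m) (simp add: holes_through_def)
      also have "\<dots> = (\<theta> ^ 4) ^ m" by (simp add: \<theta>(2) power_divide)
      also have "\<dots> = \<theta> ^ l" using that m by (simp add: holes_through_def flip: power_mult)
      finally show ?thesis .
    qed
    then have "(\<Sum>H\<in>?Hs a k l. ?m (\<lambda>K. of_bool (vacant H K))) \<le> real (card (?Hs a k l)) * \<theta> ^ l"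
      by (rule sum_bounded_above)
    also have "\<dots> \<le> 200000 * 1.58746 ^ l * \<theta> ^ l"
      using holes_through_bound(2)[of l i n "a + k"] l M \<theta>(1) by (intro mult_right_mono) auto
    finally show "(\<Sum>H\<in>?Hs a k l. ?m (\<lambda>K. of_bool (vacant H K))) \<le> 200000 * (1.58746 * \<theta>) ^ l"
      by (simp only: power_mult_distrib mult.assoc)
  qed
  also have "\<dots> = real (M + 1) * (\<Sum>l = M..?N. real l * (200000 * (1.58746 * \<theta>) ^ l))"
    by simp
  also have "\<dots> = (\<Sum>l = M..?N. real ((M + 1) * l) * (200000 * (1.58746 * \<theta>) ^ l))"
    by (simp only: sum_distrib_left of_nat_mult mult.assoc)
  also have "\<dots> \<le> (\<Sum>l = M..?N. real ((l + 1) * (l + 2)) * (200000 * (1.58746 * \<theta>) ^ l))"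
  proof (intro sum_mono mult_right_mono)
    fix l assume "l \<in> {M..?N}"
    then have "(M + 1) * l \<le> (l + 1) * (l + 2)" by (intro mult_mono) auto
    then show "real ((M + 1) * l) \<le> real ((l + 1) * (l + 2))" by (rule of_nat_mono)
  qed (use \<theta>(1) in auto)
  also have "\<dots> = 200000 * (\<Sum>l = M..?N. real ((l + 1) * (l + 2)) * (1.58746 * \<theta>) ^ l)"
    by (simp only: sum_distrib_left mult_ac)
  finally show ?thesis .
qed

lemma summable_quadratic_geometric:
  fixes q :: real assumes "\<bar>q\<bar> < 1"
  shows "summable (\<lambda>l. real ((l + 1) * (l + 2)) * q ^ l)"
proof -
  \<comment> \<open>The coefficients come from differentiating the geometric series twice.\<close>
  have geo: "summable (\<lambda>n. (\<lambda>_. 1) n * x ^ n)" if "norm x < 1" for x :: real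
    using that by (simp add: summable_geometric)
  have "summable (\<lambda>n. diffs (\<lambda>_. 1) n * x ^ n)" if "norm x < 1" for x :: real
    using termdiff_converges[OF that geo] .
  then have "summable (\<lambda>n. diffs (diffs (\<lambda>_. 1)) n * q ^ n)"
    using assms by (intro termdiff_converges[of q 1]) auto
  then show ?thesis by (simp add: diffs_def algebra_simps)
qed

text \<open>
The series of the previous bound converges because \<open>1.58746 ^ 4 < 6.3506 < 1 + lam\<close>; its tail bounds
the probability for all squares and both parities at once.
\<close>

lemma long_holes_rare:
  assumes lam: "lam > 5.3506"
  obtains M where "\<And>n i. hc_mean z2_adj lam (square n) (parity_class i) (\<lambda>K. of_bool (long_hole n i M K)) \<le> 1 / 3"
proof -
  define \<theta> where "\<theta> = root 4 (1 / (1 + lam))"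
  have \<theta>: "0 < \<theta>" "\<theta> ^ 4 = 1 / (1 + lam)"
    using lam by (auto simp: \<theta>_def real_root_pow_pos)
  define q where "q = 1.58746 * \<theta>"
  have "q ^ 4 = 1.58746 ^ 4 / (1 + lam)" by (simp only: q_def power_mult_distrib \<theta>(2)) simp
  also have "\<dots> < 1" using lam by (simp add: power4_eq_xxxx)
  finally have "q < 1" using one_le_power[of q 4] by linarith
  then have "summable (\<lambda>l. real ((l + 1) * (l + 2)) * q ^ l)"
    using \<theta>(1) by (intro summable_quadratic_geometric) (simp add: q_def)
  \<comment> \<open>The factor 200000 of the union bound turns this tail into 1 / 3.\<close>
  then have "\<exists>N. \<forall>m\<ge>N. \<forall>n. norm (\<Sum>l = m..<n. real ((l + 1) * (l + 2)) * q ^ l) < 1 / 600000"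
    unfolding summable_Cauchy by (meson divide_pos_pos zero_less_numeral zero_less_one)
  then obtain N where N: "\<And>m n. N \<le> m \<Longrightarrow>
      norm (\<Sum>l = m..<n. real ((l + 1) * (l + 2)) * q ^ l) < 1 / 600000" by blast
  \<comment> \<open>Words of turns count a contour only from two bonds on.\<close>
  show ?thesis
  proof (rule that[of "max N 2"])
    fix n i
    let ?M = "max N 2" and ?L = "4 * card (square n)"
    have "hc_mean z2_adj lam (square n) (parity_class i) (\<lambda>K. of_bool (long_hole n i ?M K)) \<le>
        200000 * (\<Sum>l = ?M..?L. real ((l + 1) * (l + 2)) * q ^ l)"
      unfolding q_def using lam by (intro mean_long_hole \<theta>) auto
    also have "(\<Sum>l = ?M..?L. real ((l + 1) * (l + 2)) * q ^ l) =
        (\<Sum>l = ?M..<Suc ?L. real ((l + 1) * (l + 2)) * q ^ l)"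
      by (simp only: atLeastLessThanSuc_atLeastAtMost)
    also have "\<dots> \<le> 1 / 600000"
      using N[of ?M "Suc ?L"] by (simp only: real_norm_def) linarith
    finally show "hc_mean z2_adj lam (square n) (parity_class i) (\<lambda>K. of_bool (long_hole n i ?M K)) \<le> 1 / 3"
      by simp
  qed
qed

theorem theorem1p1:
  fixes lam :: real
  assumes "lam > 5.3506"
  shows "\<exists>\<mu> \<nu>. hard_core_gibbs z2_adj lam \<mu> \<and> hard_core_gibbs z2_adj lam \<nu> \<and> \<mu> \<noteq> \<nu>"
proof -
  have lam: "0 < lam" using assms by simp
  interpret G: hard_core_graph z2_adj lam by (rule z2_hard_core_graph[OF lam])
  obtain M where M: "\<And>n i. G.mean (square n) (parity_class i) (\<lambda>K. of_bool (long_hole n i M K)) \<le> 1 / 3"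
    using long_holes_rare[OF assms] by blast
  have exhaust: "\<forall>\<^sub>F n in sequentially. F \<subseteq> square n" if F: "finite F" for F
  proof -
    have "\<forall>\<^sub>F n in sequentially. v \<in> square n" for v
      using eventually_ge_at_top[of "nat (\<bar>fst v\<bar> + \<bar>snd v\<bar>)"]
      by eventually_elim (auto simp: square_def mem_Times_iff)
    then have "\<forall>\<^sub>F n in sequentially. \<forall>v\<in>F. v \<in> square n" using F by (intro eventually_ball_finite) auto
    then show ?thesis by eventually_elim blast
  qed
  let ?\<Delta> = "square (Suc (Suc (2 * M)))"
  let ?\<phi> = "\<lambda>S. of_bool (crossing True M S) :: real"
  have \<phi>: "?\<phi> (K \<inter> ?\<Delta>) = ?\<phi> K" for K using crossing_local[of True M K] by simp
  have \<Delta>: "finite ?\<Delta>" by (rule finite_square)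
  have gibbs: "\<exists>\<mu> r. hard_core_gibbs z2_adj lam \<mu> \<and> strict_mono r \<and> (\<forall>\<Delta> \<phi>. finite \<Delta> \<longrightarrow>
      (\<lambda>n. G.mean (square (r n)) (parity_class i) (\<lambda>K. \<phi> (K \<inter> \<Delta>))) \<longlonglongrightarrow> (\<integral>I. \<phi> (I \<inter> \<Delta>) \<partial>\<mu>))" for i
    by (rule G.gibbs_limit[of square, OF finite_square parity_class_indep]) (rule exhaust)
  from gibbs[of True] obtain \<mu> r where \<mu>: "hard_core_gibbs z2_adj lam \<mu>" "strict_mono r"
    and "\<forall>\<Delta> \<phi>. finite \<Delta> \<longrightarrow> (\<lambda>n. G.mean (square (r n)) (parity_class True) (\<lambda>K. \<phi> (K \<inter> \<Delta>)))
      \<longlonglongrightarrow> (\<integral>I. \<phi> (I \<inter> \<Delta>) \<partial>\<mu>)"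
    by blast
  from this(3)[THEN spec, THEN spec, THEN mp, OF \<Delta>, of ?\<phi>]
  have lim_\<mu>: "(\<lambda>n. G.mean (square (r n)) (parity_class True) ?\<phi>) \<longlonglongrightarrow> (\<integral>I. ?\<phi> (I \<inter> ?\<Delta>) \<partial>\<mu>)"
    by (simp only: \<phi>)
  from gibbs[of False] obtain \<nu> s where \<nu>: "hard_core_gibbs z2_adj lam \<nu>" "strict_mono s"
    and "\<forall>\<Delta> \<phi>. finite \<Delta> \<longrightarrow> (\<lambda>n. G.mean (square (s n)) (parity_class False) (\<lambda>K. \<phi> (K \<inter> \<Delta>)))
      \<longlonglongrightarrow> (\<integral>I. \<phi> (I \<inter> \<Delta>) \<partial>\<nu>)"
    by blast
  from this(3)[THEN spec, THEN spec, THEN mp, OF \<Delta>, of ?\<phi>]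
  have lim_\<nu>: "(\<lambda>n. G.mean (square (s n)) (parity_class False) ?\<phi>) \<longlonglongrightarrow> (\<integral>I. ?\<phi> (I \<inter> ?\<Delta>) \<partial>\<nu>)"
    by (simp only: \<phi>)
  have w: "0 \<le> G.weight (square n) (parity_class i) K" for n i K
    by (rule G.weight_nonneg[OF finite_square parity_class_indep])
  \<comment> \<open>Even boundary condition: the even region crosses unless there is a long hole.\<close>
  have low: "2 / 3 \<le> G.mean (square n) (parity_class True) ?\<phi>" if n: "2 * M \<le> n" for n
  proof -
    have "1 = G.mean (square n) (parity_class True) (\<lambda>_. 1)"
      using G.weight_sum[OF finite_square[of n] parity_class_indep[of True]] by (simp add: wmean_def)
    also have "\<dots> \<le> G.mean (square n) (parity_class True) (\<lambda>K. ?\<phi> K + of_bool (long_hole n True M K))"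
    proof (rule wmean_mono[OF w])
      fix K assume "K \<in> G.fibre (square n) (parity_class True)"
      then interpret boundary_config n True K by unfold_locales
      show "1 \<le> ?\<phi> K + of_bool (long_hole n True M K)"
        using crossing_if_no_long_hole[OF _ n] by auto
    qed
    also have "\<dots> \<le> G.mean (square n) (parity_class True) ?\<phi> + 1 / 3"
      using M[of n True] by (simp add: wmean_add)
    finally show ?thesis by simp
  qed
  \<comment> \<open>Odd boundary condition: the even region crosses only if there is a long hole.\<close>
  have high: "G.mean (square n) (parity_class False) ?\<phi> \<le> 1 / 3" for n
  proof -
    have "G.mean (square n) (parity_class False) ?\<phi> \<le>
        G.mean (square n) (parity_class False) (\<lambda>K. of_bool (long_hole n False M K))"
    proof (rule wmean_mono[OF w])
      fix K assume "K \<in> G.fibre (square n) (parity_class False)"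
      then interpret boundary_config n False K by unfold_locales
      show "?\<phi> K \<le> of_bool (long_hole n False M K)"
        using no_crossing_if_no_long_hole[of M] by auto
    qed
    then show ?thesis using M[of n False] by simp
  qed
  have "2 / 3 \<le> (\<integral>I. ?\<phi> (I \<inter> ?\<Delta>) \<partial>\<mu>)"
  proof (rule LIMSEQ_le_const[OF lim_\<mu>], intro exI allI impI)
    fix n assume "2 * M \<le> n"
    then have "2 * M \<le> r n" using seq_suble[OF \<mu>(2), of n] by linarith
    then show "2 / 3 \<le> G.mean (square (r n)) (parity_class True) ?\<phi>" by (rule low)
  qed
  moreover have "(\<integral>I. ?\<phi> (I \<inter> ?\<Delta>) \<partial>\<nu>) \<le> 1 / 3"
    by (rule LIMSEQ_le_const2[OF lim_\<nu>]) (use high in auto)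
  ultimately have "\<mu> \<noteq> \<nu>" by auto
  then show ?thesis using \<mu>(1) \<nu>(1) by blast
qed

end
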